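(* Let $d\ge2$. The family $\{C\in\mathcal{C}_{ar}^d:\ \mathrm{supp}(\mu_C^{abs})=\mathrm{supp}(\mu_C^{dis})=\mathrm{supp}(\mu_C^{sing})=\mathbb{I}^d\}$ is dense in $(\mathcal{C}_{ar}^d,d_\infty)$.
   Context: Notation: $\mathbb{I}=[0,1]$; conventions $\inf\emptyset=\infty$, $1/\infty=0$, $1/0=\infty$. The support of a finite Borel measure is the complement of the union of all open sets of measure $0$. The uniform metric is $d_\infty(A,B)=\sup_{\mathbf{x}\in\mathbb{I}^d}|A(\mathbf{x})-B(\mathbf{x})|$. A generator is a continuous non-increasing $\psi:[0,\infty)\to\mathbb{I}$ with $\psi(0)=1$, $\psi(\infty):=\lim_{z\to\infty}\psi(z)=0$, strictly decreasing on $[0,\inf\{x:\psi(x)=0\})$; its pseudo-inverse is $\varphi(y)=\inf\{z\in[0,\infty]:\psi(z)=y\}$, $y\in\mathbb{I}$. $\mathcal{C}_{ar}^d$ is the set of $d$-dimensional Archimedean copulas, i.e. copulas of the form $C(\mathbf{x})=\psi(\sum_{i=1}^d\varphi(x_i))$ (this function is a copula iff $\psi$ is $d$-monotone, i.e., with $\psi$ continuous on $[0,\infty)$, on $(0,\infty)$ $\psi$ is differentiable up to order $d-2$, $(-1)^k\psi^{(k)}\ge0$ for $k\le d-2$, and $(-1)^{d-2}\psi^{(d-2)}$ is non-increasing and convex). $\mu_C$ is the probability measure on $\mathbb{I}^d$ with distribution function $C$; $C^{1:d-1}$ is the marginal copula of the first $d-1$ coordinates, with measure $\mu_{C^{1:d-1}}$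 (always absolutely continuous for $C\in\mathcal{C}_{ar}^d$). A finite measure is called discrete if it is concentrated on a countable set, and singular if it has no point masses and is concentrated on a Lebesgue null set. Let $K_C:\mathbb{I}^{d-1}\times\mathcal{B}(\mathbb{I})\to\mathbb{I}$ be (a version of) the regular conditional distribution of the last coordinate given the first $d-1$ under $\mu_C$, and for each $\mathbf{x}$ let $K_C(\mathbf{x},\cdot)=K_C^{abs}(\mathbf{x},\cdot)+K_C^{dis}(\mathbf{x},\cdot)+K_C^{sing}(\mathbf{x},\cdot)$ be its decomposition into absolutely continuous, discrete and singular (i.e. having no point masses and concentrated on a Lebesgue null set) parts; these are sub-Markov kernels. For $\ast\in\{abs,dis,sing\}$ the measure $\mu_C^{\ast}$ on $\mathbb{I}^d$ is defined by $\mu_C^{\ast}(E\times F)=\int_E K_C^{\ast}(\mathbf{x},F)\,d\mu_{C^{1:d-1}}(\mathbf{x})$ for Borel $E\subseteq\mathbb{I}^{d-1}$, $F\subseteq\mathbb{I}$. *)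

theory Defs
  imports "HOL-Probability.Probability"
begin

section \<open>The unit cube\<close>

text \<open>
  Points of \<open>\<real>\<^sup>d\<close> are extensional functions on the index set \<open>{..<d}\<close>; the coordinates
  \<open>1, \<dots>, d\<close> are numbered \<open>0, \<dots>, d - 1\<close>, so that the last coordinate of \<open>x\<close> is \<open>x (d - 1)\<close> and
  the vector of the first \<open>d - 1\<close> coordinates is \<open>restrict x {..<d - 1}\<close>.
\<close>

definition cube :: "nat \<Rightarrow> (nat \<Rightarrow> real) set" where
  "cube d = (\<Pi>\<^sub>E i\<in>{..<d}. {0..1})"

definition cube_topology :: "nat \<Rightarrow> (nat \<Rightarrow> real) topology" where
  "cube_topology d = product_topology (\<lambda>i. top_of_set {0..1}) {..<d}"

abbreviation unit_borel :: "real measure" where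
  "unit_borel \<equiv> restrict_space borel {0..1}"

abbreviation unit_lborel :: "real measure" where
  "unit_lborel \<equiv> restrict_space lborel {0..1}"

definition cube_borel :: "nat \<Rightarrow> (nat \<Rightarrow> real) measure" where
  "cube_borel d = (\<Pi>\<^sub>M i\<in>{..<d}. unit_borel)"

text \<open>The product set \<open>E \<times> F\<close> for \<open>E \<subseteq> cube (d - 1)\<close> and \<open>F \<subseteq> {0..1}\<close>, as a subset of \<open>cube d\<close>.\<close>

definition rect :: "nat \<Rightarrow> (nat \<Rightarrow> real) set \<Rightarrow> real set \<Rightarrow> (nat \<Rightarrow> real) set" where
  "rect d E F = {x \<in> cube d. restrict x {..<d - 1} \<in> E \<and> x (d - 1) \<in> F}"

definition support_in :: "'a topology \<Rightarrow> 'a measure \<Rightarrow> 'a set" where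
  "support_in X M = topspace X - \<Union>{U. openin X U \<and> U \<in> null_sets M}"


section \<open>Copulas\<close>

definition has_distribution_function ::
    "nat \<Rightarrow> (nat \<Rightarrow> real) measure \<Rightarrow> ((nat \<Rightarrow> real) \<Rightarrow> real) \<Rightarrow> bool" where
  "has_distribution_function d N C \<longleftrightarrow>
     prob_space N \<and> sets N = sets (cube_borel d) \<and>
     (\<forall>x\<in>cube d. measure N {y \<in> cube d. \<forall>i<d. y i \<le> x i} = C x)"

text \<open>
  A copula is a distribution function on the cube with uniform univariate margins. Copulas are
  taken to be extensional, so that they are equal as soon as they agree on the cube.
\<close>

definition copulas :: "nat \<Rightarrow> ((nat \<Rightarrow> real) \<Rightarrow> real) set" where
  "copulas d = {C \<in> extensional (cube d). \<exists>N. has_distribution_function d N C \<and>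
     (\<forall>i<d. distr N unit_borel (\<lambda>x. x i) = unit_lborel)}"

definition copula_measure :: "nat \<Rightarrow> ((nat \<Rightarrow> real) \<Rightarrow> real) \<Rightarrow> (nat \<Rightarrow> real) measure" where
  "copula_measure d C = (THE N. has_distribution_function d N C)"

definition marginal :: "nat \<Rightarrow> ((nat \<Rightarrow> real) \<Rightarrow> real) \<Rightarrow> (nat \<Rightarrow> real) \<Rightarrow> real" where
  "marginal d C = (\<lambda>x\<in>cube (d - 1). C (x(d - 1 := 1)))"

definition marginal_measure :: "nat \<Rightarrow> ((nat \<Rightarrow> real) \<Rightarrow> real) \<Rightarrow> (nat \<Rightarrow> real) measure" where
  "marginal_measure d C = copula_measure (d - 1) (marginal d C)"

text \<open>
  \<^const>\<open>Metric_space\<close> demands a total distance function that is non-negative everywhere, hence the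
  value \<open>0\<close> for arguments that are not copulas, for which the supremum may be unspecified.
\<close>

definition d_infty :: "nat \<Rightarrow> ((nat \<Rightarrow> real) \<Rightarrow> real) \<Rightarrow> ((nat \<Rightarrow> real) \<Rightarrow> real) \<Rightarrow> real" where
  "d_infty d A B =
     (if A \<in> copulas d \<and> B \<in> copulas d then SUP x\<in>cube d. \<bar>A x - B x\<bar> else 0)"


section \<open>Archimedean copulas\<close>

text \<open>Only the values of \<open>\<psi>\<close> on \<open>{0..}\<close> are relevant.\<close>

definition generator :: "(real \<Rightarrow> real) \<Rightarrow> bool" where
  "generator \<psi> \<longleftrightarrow>
     \<psi> ` {0..} \<subseteq> {0..1} \<and> continuous_on {0..} \<psi> \<and> antimono_on {0..} \<psi> \<and>
     \<psi> 0 = 1 \<and> (\<psi> \<longlongrightarrow> 0) at_top \<and>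
     (\<forall>x y. 0 \<le> x \<and> x < y \<and> ennreal y < Inf (ennreal ` {z. 0 \<le> z \<and> \<psi> z = 0}) \<longrightarrow> \<psi> y < \<psi> x)"

text \<open>The extension of a generator to \<open>[0,\<infinity>]\<close> by \<open>\<psi>(\<infinity>) = 0\<close>.\<close>

definition gen_ext :: "(real \<Rightarrow> real) \<Rightarrow> ennreal \<Rightarrow> real" where
  "gen_ext \<psi> z = (if z = \<infinity> then 0 else \<psi> (enn2real z))"

definition pseudo_inverse :: "(real \<Rightarrow> real) \<Rightarrow> real \<Rightarrow> ennreal" where
  "pseudo_inverse \<psi> y = Inf {z. gen_ext \<psi> z = y}"

definition archimedean_copulas :: "nat \<Rightarrow> ((nat \<Rightarrow> real) \<Rightarrow> real) set" where
  "archimedean_copulas d = {C \<in> copulas d. \<exists>\<psi>. generator \<psi> \<and>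
     (\<forall>x\<in>cube d. C x = gen_ext \<psi> (\<Sum>i<d. pseudo_inverse \<psi> (x i)))}"


section \<open>Conditional distributions and their decomposition\<close>

definition is_cond_kernel ::
    "nat \<Rightarrow> ((nat \<Rightarrow> real) \<Rightarrow> real) \<Rightarrow> ((nat \<Rightarrow> real) \<Rightarrow> real measure) \<Rightarrow> bool" where
  "is_cond_kernel d C K \<longleftrightarrow>
     K \<in> cube_borel (d - 1) \<rightarrow>\<^sub>M prob_algebra unit_borel \<and>
     (\<forall>E\<in>sets (cube_borel (d - 1)). \<forall>F\<in>sets unit_borel.
        emeasure (copula_measure d C) (rect d E F) =
          (\<integral>\<^sup>+x\<in>E. emeasure (K x) F \<partial>marginal_measure d C))"

text \<open>
  A version of the conditional distribution of the last coordinate given the others. It is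
  determined only up to a null set of the marginal measure, which does not affect the measures
  built from it below.
\<close>

definition cond_kernel :: "nat \<Rightarrow> ((nat \<Rightarrow> real) \<Rightarrow> real) \<Rightarrow> (nat \<Rightarrow> real) \<Rightarrow> real measure" where
  "cond_kernel d C = (SOME K. is_cond_kernel d C K)"

definition discrete_measure :: "real measure \<Rightarrow> bool" where
  "discrete_measure M \<longleftrightarrow> (\<exists>A\<in>sets M. countable A \<and> emeasure M (space M - A) = 0)"

definition singular_measure :: "real measure \<Rightarrow> bool" where
  "singular_measure M \<longleftrightarrow> (\<forall>x\<in>space M. emeasure M {x} = 0) \<and>
     (\<exists>A\<in>null_sets unit_lborel. emeasure M (space M - A) = 0)"

definition is_decomposition ::
    "real measure \<Rightarrow> real measure \<Rightarrow> real measure \<Rightarrow> real measure \<Rightarrow> bool" where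
  "is_decomposition M A D S \<longleftrightarrow>
     sets A = sets unit_borel \<and> sets D = sets unit_borel \<and> sets S = sets unit_borel \<and>
     absolutely_continuous unit_lborel A \<and> discrete_measure D \<and> singular_measure S \<and>
     (\<forall>F\<in>sets unit_borel. emeasure M F = emeasure A F + emeasure D F + emeasure S F)"

definition abs_part :: "real measure \<Rightarrow> real measure" where
  "abs_part M = (THE A. \<exists>D S. is_decomposition M A D S)"

definition dis_part :: "real measure \<Rightarrow> real measure" where
  "dis_part M = (THE D. \<exists>A S. is_decomposition M A D S)"

definition sing_part :: "real measure \<Rightarrow> real measure" where
  "sing_part M = (THE S. \<exists>A D. is_decomposition M A D S)"

text \<open>
  The measure on the cube given by \<open>E \<times> F \<mapsto> \<integral>\<^bsub>E\<^esub> K(x,F) d\<mu>(x)\<close>, where \<open>\<mu>\<close> is the marginal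
  measure of \<open>C\<close> for the first \<open>d - 1\<close> coordinates.
\<close>

definition kernel_measure ::
    "nat \<Rightarrow> ((nat \<Rightarrow> real) \<Rightarrow> real) \<Rightarrow> ((nat \<Rightarrow> real) \<Rightarrow> real measure) \<Rightarrow> (nat \<Rightarrow> real) measure" where
  "kernel_measure d C K = (THE N. sets N = sets (cube_borel d) \<and>
     (\<forall>E\<in>sets (cube_borel (d - 1)). \<forall>F\<in>sets unit_borel.
        emeasure N (rect d E F) = (\<integral>\<^sup>+x\<in>E. emeasure (K x) F \<partial>marginal_measure d C)))"

definition mu_abs :: "nat \<Rightarrow> ((nat \<Rightarrow> real) \<Rightarrow> real) \<Rightarrow> (nat \<Rightarrow> real) measure" where
  "mu_abs d C = kernel_measure d C (\<lambda>x. abs_part (cond_kernel d C x))"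

definition mu_dis :: "nat \<Rightarrow> ((nat \<Rightarrow> real) \<Rightarrow> real) \<Rightarrow> (nat \<Rightarrow> real) measure" where
  "mu_dis d C = kernel_measure d C (\<lambda>x. dis_part (cond_kernel d C x))"

definition mu_sing :: "nat \<Rightarrow> ((nat \<Rightarrow> real) \<Rightarrow> real) \<Rightarrow> (nat \<Rightarrow> real) measure" where
  "mu_sing d C = kernel_measure d C (\<lambda>x. sing_part (cond_kernel d C x))"


section \<open>The metric space of Archimedean copulas\<close>

lemma copula_range:
  assumes "C \<in> copulas d" "x \<in> cube d"
  shows "C x \<in> {0..1}"
proof -
  obtain N where N: "has_distribution_function d N C"
    using assms(1) by (auto simp: copulas_def)
  then have "prob_space N" "C x = measure N {y \<in> cube d. \<forall>i<d. y i \<le> x i}"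
    using assms(2) by (auto simp: has_distribution_function_def)
  then show ?thesis
    by (simp add: prob_space.prob_le_1)
qed

lemma cube_nonempty: "cube d \<noteq> {}"
  by (auto simp: cube_def PiE_eq_empty_iff)

lemma d_infty_upper:
  assumes "A \<in> copulas d" "B \<in> copulas d" "x \<in> cube d"
  shows "\<bar>A x - B x\<bar> \<le> d_infty d A B"
proof -
  have "bdd_above ((\<lambda>x. \<bar>A x - B x\<bar>) ` cube d)"
    by (rule bdd_aboveI2[where M = 1])
      (use copula_range[OF assms(1)] copula_range[OF assms(2)] in \<open>fastforce simp: abs_if\<close>)
  then have "\<bar>A x - B x\<bar> \<le> (SUP x\<in>cube d. \<bar>A x - B x\<bar>)"
    by (rule cSUP_upper[OF assms(3)])
  then show ?thesis
    using assms by (simp add: d_infty_def)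
qed

lemma Metric_space_copulas: "Metric_space (copulas d) (d_infty d)"
proof
  show "0 \<le> d_infty d A B" for A B
  proof (cases "A \<in> copulas d \<and> B \<in> copulas d")
    case True
    obtain x where "x \<in> cube d" using cube_nonempty by blast
    with True have "\<bar>A x - B x\<bar> \<le> d_infty d A B" by (auto intro: d_infty_upper)
    then show ?thesis by linarith
  qed (auto simp: d_infty_def)
  show "d_infty d A B = d_infty d B A" for A B
    by (simp add: d_infty_def abs_minus_commute)
  show "d_infty d A B = 0 \<longleftrightarrow> A = B" if A: "A \<in> copulas d" and B: "B \<in> copulas d" for A B
  proof
    assume eq: "d_infty d A B = 0"
    show "A = B"
    proof (rule extensionalityI)
      show "A \<in> extensional (cube d)" "B \<in> extensional (cube d)"
        using A B by (auto simp: copulas_def)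
      show "A x = B x" if "x \<in> cube d" for x
        using d_infty_upper[OF A B that] eq by simp
    qed
  qed (simp add: d_infty_def cube_nonempty)
  show "d_infty d A C \<le> d_infty d A B + d_infty d B C"
    if A: "A \<in> copulas d" and B: "B \<in> copulas d" and C: "C \<in> copulas d" for A B C
  proof -
    have "(SUP x\<in>cube d. \<bar>A x - C x\<bar>) \<le> d_infty d A B + d_infty d B C"
    proof (rule cSUP_least[OF cube_nonempty])
      fix x assume "x \<in> cube d"
      then show "\<bar>A x - C x\<bar> \<le> d_infty d A B + d_infty d B C"
        using d_infty_upper[OF A B] d_infty_upper[OF B C] by fastforce
    qed
    then show ?thesis using A C by (simp add: d_infty_def)
  qed
qed

lemma Metric_space_archimedean_copulas: "Metric_space (archimedean_copulas d) (d_infty d)"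
  by (rule Metric_space.subspace[OF Metric_space_copulas]) (auto simp: archimedean_copulas_def)

end

theory Submission
  imports Defs
begin

text \<open>
  Put \<open>s = d - 1\<close>. A measure \<open>E\<close> on \<open>(0,\<infinity>)\<close> with \<open>\<integral> r\<^sup>s dE(r) = 1\<close> yields the generator
  \<open>\<psi>(z) = \<integral> max(0, r - z)\<^sup>s dE(r)\<close>, and the measure with density \<open>s!\<close> with respect to
  \<open>dz\<^sub>1 \<dots> dz\<^sub>s dE(r)\<close> on \<open>{z \<ge> 0, \<Sum>z \<le> r}\<close> is carried to the measure of the copula of \<open>\<psi>\<close> by
  \<open>(z, r) \<mapsto> (\<psi>(z\<^sub>1), \<dots>, \<psi>(z\<^sub>s), \<psi>(r - \<Sum>z))\<close>. The conditional law of the last coordinate is therefore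
  the image of \<open>E\<close>, restricted to \<open>[\<Sum>z,\<infinity>)\<close> and normalised, under the locally bi-Lipschitz map
  \<open>r \<mapsto> \<psi>(r - \<Sum>z)\<close>, so its absolutely continuous, discrete and singular parts come from those of \<open>E\<close>.
  If each part of \<open>E\<close> charges all intervals in \<open>(0,\<infinity>)\<close>, all three supports are full.

  For density, an Archimedean copula with generator \<open>\<psi>\<close> has nonnegative box volumes, so the \<open>d\<close>-th
  differences of \<open>\<psi>\<close> on a grid \<open>h\<nat>\<close> are nonnegative up to sign; summing them back up \<open>d\<close> times shows
  that \<open>\<psi>\<close> is uniformly close to a mixture of functions \<open>max(0, (m + 1)h - z)\<^sup>s\<close>. Adding a small
  multiple of a measure with three full parts gives \<open>E\<close>. Copulas being 1-Lipschitz, uniformly close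
  generators have uniformly close copulas.
\<close>

section \<open>Uniqueness of the measures attached to a copula\<close>

text \<open>The measure \<open>r ^ s dE(r)\<close> is the law of the sum of all
  \<open>phi (x i)\<close> under the copula, i.e. the radial law in Williamson's representation of
  \<open>psi\<close> by \<open>max 0 (1 - z / r) ^ s\<close>. Dividing that law by
  \<open>r ^ s\<close> makes the density on the simplex independent of \<open>z\<close>:
  conditioning on the first coordinates merely truncates \<open>E\<close> at their sum, and no
  derivative of \<open>psi\<close> is ever formed. The price is that \<open>E\<close> could have
  infinite mass near 0; finite mass is therefore demanded, and it makes \<open>psi\<close>
  Lipschitz. Since \<open>E\<close> charges intervals arbitrarily far out, \<open>psi\<close> is
  positive and strictly decreasing and has a true inverse on \<open>(0,1]\<close>. Copula measures,
  conditional kernels and their parts are given by descriptions, so uniqueness must be proved before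
  any of them can be computed; the kernel is even determined only almost everywhere. In the density
  part the given generator is known only to yield a copula. Its monotonicity of order d enters
  through differences alone, so a summation formula on a grid replaces Williamson's integral
  formula, with error terms of a few grid steps.\<close>

lemma space_cube_borel: "space (cube_borel d) = cube d"
  by (auto simp: cube_borel_def cube_def space_PiM space_restrict_space)

lemma space_unit_borel: "space unit_borel = {0..1}"
  by (simp add: space_restrict_space)

lemma sets_unit_borel_iff: "A \<in> sets unit_borel \<longleftrightarrow> A \<in> sets borel \<and> A \<subseteq> {0..1::real}"
  by (simp add: sets_restrict_space_iff Int_absorb2 inf_commute conj_commute)

lemma sets_unit_lborel [simp]: "sets unit_lborel = sets unit_borel"
  by (intro sets_restrict_space_cong) simp

lemma cube_nth: "x \<in> cube d \<Longrightarrow> i < d \<Longrightarrow> 0 \<le> x i \<and> x i \<le> 1"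
  by (auto simp: cube_def PiE_iff)

lemma measurable_cube_nth: "i < d \<Longrightarrow> (\<lambda>y. y i) \<in> cube_borel d \<rightarrow>\<^sub>M unit_borel"
  unfolding cube_borel_def by (intro measurable_component_singleton) auto

lemma borel_measurable_cube_nth: "i < d \<Longrightarrow> (\<lambda>y. y i) \<in> borel_measurable (cube_borel d)"
  using measurable_cube_nth[of i d] by (simp add: measurable_restrict_space2_iff)

lemma sets_lower_box:
  "{y \<in> cube d. \<forall>i<d. y i \<le> x i} \<in> sets (cube_borel d)"
proof -
  have "{y \<in> cube d. \<forall>i<d. y i \<le> x i} = (\<Pi>\<^sub>E i\<in>{..<d}. {0..1} \<inter> {..x i})"
    unfolding cube_def by (rule set_eqI) (simp add: PiE_iff Ball_def, blast)
  also have "\<dots> \<in> sets (cube_borel d)"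
    unfolding cube_borel_def by (intro sets_PiM_I_finite) (auto simp: sets_unit_borel_iff)
  finally show ?thesis .
qed

lemma cube_iff: "x \<in> cube d \<longleftrightarrow> x \<in> extensional {..<d} \<and> (\<forall>i<d. 0 \<le> x i \<and> x i \<le> 1)"
  by (auto simp: cube_def PiE_iff)

lemma sets_rect:
  assumes "d \<ge> 1" "E \<in> sets (cube_borel (d - 1))" "F \<in> sets unit_borel"
  shows "rect d E F \<in> sets (cube_borel d)"
proof -
  have 1: "(\<lambda>x. restrict x {..<d - 1}) \<in> cube_borel d \<rightarrow>\<^sub>M cube_borel (d - 1)"
    unfolding cube_borel_def by (rule measurable_restrict_subset) auto
  have 2: "(\<lambda>x. x (d - 1)) \<in> cube_borel d \<rightarrow>\<^sub>M unit_borel"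
    unfolding cube_borel_def using assms(1) by (intro measurable_component_singleton) auto
  have "{x \<in> space (cube_borel d). restrict x {..<d - 1} \<in> E \<and> x (d - 1) \<in> F} \<in> sets (cube_borel d)"
    by (intro sets.sets_Collect_conj) (use measurable_sets[OF 1 assms(2)] measurable_sets[OF 2 assms(3)]
      in \<open>auto simp: vimage_def Int_def conj_commute\<close>)
  then show ?thesis by (simp add: rect_def space_cube_borel)
qed

text \<open>This makes the description in \<open>kernel_measure\<close> unique. A box splits into
  the box of its first \<open>d - 1\<close> sides and its last side, and boxes form a generator
  closed under intersections. Finiteness is asked of one measure only because the competitor in that
  description is arbitrary.\<close>

lemma measure_eqI_rect:
  assumes d: "d \<ge> 1" and M: "sets M = sets (cube_borel d)" "finite_measure M"
    and N: "sets N = sets (cube_borel d)"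
    and eq: "\<And>E F. E \<in> sets (cube_borel (d - 1)) \<Longrightarrow> F \<in> sets unit_borel \<Longrightarrow>
      emeasure M (rect d E F) = emeasure N (rect d E F)"
  shows "M = N"
proof (rule measure_eqI_PiM_finite[where I = "{..<d}" and M = "\<lambda>_. unit_borel"])
  show "sets M = sets (Pi\<^sub>M {..<d} (\<lambda>_. unit_borel))" "sets N = sets (Pi\<^sub>M {..<d} (\<lambda>_. unit_borel))"
    using M N by (simp_all add: cube_borel_def)
  interpret finite_measure M by fact
  show "range (\<lambda>i::nat. cube d) \<subseteq> prod_algebra {..<d} (\<lambda>_. unit_borel)"
    unfolding cube_def using sets.top[of unit_borel]
    by (auto intro!: prod_algebraI_finite simp: space_unit_borel)
  show "(\<Union>i::nat. cube d) = space (Pi\<^sub>M {..<d} (\<lambda>_. unit_borel))"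
    using space_cube_borel[of d] by (simp add: cube_borel_def)
  show "emeasure M (cube d) \<noteq> \<infinity>" for i :: nat by simp
  fix A assume A: "\<And>i. i \<in> {..<d} \<Longrightarrow> A i \<in> sets unit_borel"
  have sub: "A i \<subseteq> {0..1}" if "i < d" for i using A[of i] that by (simp add: sets_unit_borel_iff)
  have "Pi\<^sub>E {..<d} A = rect d (Pi\<^sub>E {..<d - 1} A) (A (d - 1))"
  proof -
    have all: "(\<forall>i<d. P i) \<longleftrightarrow> (\<forall>i<d - 1. P i) \<and> P (d - 1)" for P
      using d by (metis One_nat_def Suc_pred less_Suc_eq less_eq_Suc_le)
    show ?thesis
    proof (intro set_eqI)
      fix x
      have "(\<forall>i<d. x i \<in> A i) \<Longrightarrow> (\<forall>i<d. x i \<in> {0..1})" using sub by blast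
      then show "x \<in> Pi\<^sub>E {..<d} A \<longleftrightarrow> x \<in> rect d (Pi\<^sub>E {..<d - 1} A) (A (d - 1))"
        using all[of "\<lambda>i. x i \<in> A i"]
        by (simp only: rect_def cube_def PiE_iff mem_Collect_eq Ball_def lessThan_iff
            restrict_extensional simp_thms restrict_apply' cong: imp_cong conj_cong) blast
    qed
  qed
  moreover have "Pi\<^sub>E {..<d - 1} A \<in> sets (cube_borel (d - 1))"
    unfolding cube_borel_def by (intro sets_PiM_I_finite) (use A d in auto)
  moreover have "A (d - 1) \<in> sets unit_borel" using A[of "d - 1"] d by simp
  ultimately show "emeasure M (Pi\<^sub>E {..<d} A) = emeasure N (Pi\<^sub>E {..<d} A)"
    using eq by metis
qed simp

text \<open>Lower boxes are closed under intersection, the new corner being the coordinatewise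
  minimum, and they generate the Borel sets of the cube because each half space
  \<open>y i \<le> a\<close> is one of them or empty.\<close>

lemma has_distribution_function_unique:
  assumes M: "has_distribution_function d M C" and N: "has_distribution_function d N C"
  shows "M = N"
proof -
  define G where "G = (\<lambda>x. {y \<in> cube d. \<forall>i<d. y i \<le> x i}) ` cube d"
  interpret M: prob_space M using M by (simp add: has_distribution_function_def)
  interpret N: prob_space N using N by (simp add: has_distribution_function_def)
  have gen: "sets (cube_borel d) = sigma_sets (cube d) G"
  proof (rule antisym)
    show "sigma_sets (cube d) G \<subseteq> sets (cube_borel d)"
      unfolding space_cube_borel[symmetric]
      by (intro sets.sigma_sets_subset) (auto simp: G_def space_cube_borel sets_lower_box)
    have Gsub: "G \<subseteq> Pow (cube d)" by (auto simp: G_def)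
    have proj: "(\<lambda>y. y i) \<in> sigma (cube d) G \<rightarrow>\<^sub>M unit_borel" if i: "i < d" for i
    proof (rule measurable_restrict_space2)
      show "(\<lambda>y. y i) \<in> space (sigma (cube d) G) \<rightarrow> {0..1}"
        using i cube_nth by (auto simp: space_measure_of_conv)
      have "{y \<in> cube d. y i \<le> a} \<in> sigma_sets (cube d) G" for a
      proof (cases "a < 0")
        case True
        then have *: "{y \<in> cube d. y i \<le> a} = {}" using cube_nth[OF _ i] by force
        show ?thesis unfolding * by (rule sigma_sets.Empty)
      next
        case False
        \<comment> \<open>The corner has to lie in the cube, hence the cut at 1; coordinates equal
          to 1 impose no condition.\<close>
        define x where "x = (\<lambda>j\<in>{..<d}. if j = i then min a 1 else 1)"
        have "x \<in> cube d" using False by (simp add: x_def cube_iff)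
        moreover have "y i \<le> a \<longleftrightarrow> (\<forall>j<d. y j \<le> x j)" if y: "y \<in> cube d" for y
          using i cube_nth[OF y] by (auto simp: x_def)
        then have "{y \<in> cube d. y i \<le> a} = {y \<in> cube d. \<forall>j<d. y j \<le> x j}" by blast
        ultimately show ?thesis unfolding G_def by (intro sigma_sets.Basic) blast
      qed
      then show "(\<lambda>y. y i) \<in> borel_measurable (sigma (cube d) G)"
        using Gsub by (intro borel_measurableI_le) (auto simp: space_measure_of_conv sets_measure_of)
    qed
    have "sets (\<Pi>\<^sub>M i\<in>{..<d}. unit_borel) \<subseteq> sets (sigma (cube d) G)"
    proof (rule sets_PiM_in_sets)
      show "space (sigma (cube d) G) = (\<Pi>\<^sub>E i\<in>{..<d}. space unit_borel)"
        by (simp add: space_measure_of_conv cube_def space_unit_borel)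
      show "{x \<in> space (sigma (cube d) G). x i \<in> A} \<in> sets (sigma (cube d) G)"
        if "i \<in> {..<d}" "A \<in> sets unit_borel" for i A
        using measurable_sets[OF proj that(2)] that(1) by (simp add: vimage_def Int_def conj_commute)
    qed
    then show "sets (cube_borel d) \<subseteq> sigma_sets (cube d) G"
      using Gsub by (simp add: cube_borel_def sets_measure_of)
  qed
  show ?thesis
  proof (rule measure_eqI_generator_eq[where E = G and \<Omega> = "cube d" and A = "\<lambda>_. cube d"])
    show "Int_stable G"
    proof (rule Int_stableI)
      fix a b assume "a \<in> G" "b \<in> G"
      then obtain x y where xy: "x \<in> cube d" "y \<in> cube d"
        "a = {z \<in> cube d. \<forall>i<d. z i \<le> x i}" "b = {z \<in> cube d. \<forall>i<d. z i \<le> y i}"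
        by (auto simp: G_def)
      define w where "w = (\<lambda>i\<in>{..<d}. min (x i) (y i))"
      have "0 \<le> w i \<and> w i \<le> 1" if "i < d" for i
        using cube_nth[OF xy(1) that] cube_nth[OF xy(2) that] that by (simp add: w_def min_le_iff_disj)
      then have "w \<in> cube d" by (simp add: cube_iff w_def)
      moreover have "a \<inter> b = {z \<in> cube d. \<forall>i<d. z i \<le> w i}"
        unfolding xy(3,4) by (rule set_eqI) (simp add: w_def, blast)
      ultimately show "a \<inter> b \<in> G" unfolding G_def by blast
    qed
    show "emeasure M X = emeasure N X" if "X \<in> G" for X
    proof -
      have "measure M X = measure N X"
        using that M[unfolded has_distribution_function_def] N[unfolded has_distribution_function_def]
        unfolding G_def by fastforce
      then show ?thesis by (simp add: M.emeasure_eq_measure N.emeasure_eq_measure)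
    qed
    have "cube d = {y \<in> cube d. \<forall>i<d. y i \<le> (\<lambda>i\<in>{..<d}. 1) i}"
      by (rule set_eqI) (simp add: cube_iff, blast)
    moreover have "(\<lambda>i\<in>{..<d}. 1) \<in> cube d" by (simp add: cube_iff)
    ultimately show "range (\<lambda>_::nat. cube d) \<subseteq> G" unfolding G_def by blast
    show "G \<subseteq> Pow (cube d)" by (auto simp: G_def)
    show "sets M = sigma_sets (cube d) G" "sets N = sigma_sets (cube d) G"
      using M N gen by (simp_all add: has_distribution_function_def)
  qed simp_all
qed

lemma copula_measure_eq: "has_distribution_function d N C \<Longrightarrow> copula_measure d C = N"
  unfolding copula_measure_def using has_distribution_function_unique by (intro the_equality) auto

text \<open>A countable generator: statements that hold almost everywhere for each generating set
  then hold outside a single null set.\<close>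

lemma borel_eq_atMost_rat: "borel = sigma UNIV (range (\<lambda>q::rat. {..real_of_rat q}))"
proof (rule borel_eq_sigmaI1[OF borel_eq_atMost])
  let ?R = "range (\<lambda>q::rat. {..real_of_rat q})"
  interpret sigma_algebra UNIV "sigma_sets UNIV ?R" by (rule sigma_algebra_sigma_sets) auto
  have "{..a} \<in> sigma_sets UNIV ?R" for a :: real
  proof -
    have "{..a} = (\<Inter>q\<in>{q. a < real_of_rat q}. {..real_of_rat q})"
    proof (intro antisym subsetI)
      fix x assume x: "x \<in> (\<Inter>q\<in>{q. a < real_of_rat q}. {..real_of_rat q})"
      show "x \<in> {..a}"
      proof (rule ccontr)
        assume "x \<notin> {..a}"
        then obtain q where "a < real_of_rat q" "real_of_rat q < x" using of_rat_dense[of a x] by auto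
        then show False using x by fastforce
      qed
    qed auto
    also have "\<dots> \<in> sigma_sets UNIV ?R"
      by (intro countable_INT'') (auto simp: sigma_sets_top intro: sigma_sets.Basic)
    finally show ?thesis .
  qed
  then show "\<And>x. x \<in> range atMost \<Longrightarrow> x \<in> sets (sigma UNIV ?R)" by auto
qed auto

lemma measure_eqI_unit_borel:
  assumes sets: "sets M = sets unit_borel" "sets N = sets unit_borel"
    and fin: "finite_measure M" "finite_measure N"
    and q: "\<And>q. q \<in> \<rat> \<Longrightarrow> emeasure M ({..q} \<inter> {0..1}) = emeasure N ({..q} \<inter> {0..1})"
  shows "M = N"
proof -
  interpret M: finite_measure M by fact
  interpret N: finite_measure N by fact
  define M' where "M' = distr M borel (\<lambda>x. x)"
  define N' where "N' = distr N borel (\<lambda>x. x)"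
  have id: "(\<lambda>x. x) \<in> M \<rightarrow>\<^sub>M borel" "(\<lambda>x. x) \<in> N \<rightarrow>\<^sub>M borel"
    using sets by (simp_all cong: measurable_cong_sets add: measurable_restrict_space1)
  have sp: "space M = {0..1}" "space N = {0..1}"
    using sets[THEN sets_eq_imp_space_eq] by (auto simp: space_unit_borel)
  have "M' = N'"
  proof (rule measure_eqI_generator_eq[where E = "range (\<lambda>a::rat. {..real_of_rat a})" and \<Omega> = UNIV
        and A = "\<lambda>n. {..real n}"])
    show "Int_stable (range (\<lambda>a::rat. {..real_of_rat a}))"
    proof (rule Int_stableI)
      fix a b assume "a \<in> range (\<lambda>a::rat. {..real_of_rat a})" "b \<in> range (\<lambda>a::rat. {..real_of_rat a})"
      then obtain p q where "a = {..real_of_rat p}" "b = {..real_of_rat q}" by auto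
      then have "a \<inter> b = {..real_of_rat (min p q)}" by (auto simp: min_def of_rat_less_eq)
      then show "a \<inter> b \<in> range (\<lambda>a::rat. {..real_of_rat a})" by auto
    qed
    show "emeasure M' X = emeasure N' X" if X: "X \<in> range (\<lambda>a::rat. {..real_of_rat a})" for X
      using that q id by (auto simp: M'_def N'_def emeasure_distr sp)
    show "sets M' = sigma_sets UNIV (range (\<lambda>a::rat. {..real_of_rat a}))"
      "sets N' = sigma_sets UNIV (range (\<lambda>a::rat. {..real_of_rat a}))"
      using borel_eq_atMost_rat[THEN arg_cong[where f = sets]] by (simp_all add: M'_def N'_def)
    have "real n = real_of_rat (of_nat n)" for n by simp
    then show "range (\<lambda>n. {..real n}) \<subseteq> range (\<lambda>a::rat. {..real_of_rat a})" by blast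
    show "(\<Union>n. {..real n}) = UNIV" using real_arch_simple by auto
    show "emeasure M' {..real i} \<noteq> \<infinity>" for i
      unfolding M'_def by (subst emeasure_distr[OF id(1)]) auto
  qed auto
  show "M = N"
  proof (rule measure_eqI)
    show "sets M = sets N" using sets by simp
    fix A assume "A \<in> sets M"
    then have A: "A \<in> sets borel" "A \<subseteq> {0..1}" using sets by (auto simp: sets_unit_borel_iff)
    have "emeasure M' A = emeasure N' A" using \<open>M' = N'\<close> by simp
    then show "emeasure M A = emeasure N A"
      using A id by (simp add: M'_def N'_def emeasure_distr sp Int_absorb2)
  qed
qed

text \<open>For fixed \<open>F\<close> both kernels are densities of the same finite measure on the
  front cube, so they agree almost everywhere. Doing this for the countably many sets
  \<open>{..q} \<inter> {0..1}\<close> with rational \<open>q\<close> leaves one exceptional null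
  set, outside of which the two probability measures coincide.\<close>

lemma is_cond_kernel_AE_unique:
  assumes d: "d \<ge> 1" and fin: "finite_measure (marginal_measure d C)"
    and sets: "sets (marginal_measure d C) = sets (cube_borel (d - 1))"
    and K: "is_cond_kernel d C K" and L: "is_cond_kernel d C L"
  shows "AE x in marginal_measure d C. K x = L x"
proof -
  let ?\<mu> = "marginal_measure d C"
  have KL: "K \<in> cube_borel (d - 1) \<rightarrow>\<^sub>M prob_algebra unit_borel"
    "L \<in> cube_borel (d - 1) \<rightarrow>\<^sub>M prob_algebra unit_borel"
    using K L by (auto simp: is_cond_kernel_def)
  have meas: "(\<lambda>x. emeasure (J x) F) \<in> borel_measurable ?\<mu>"
    if "F \<in> sets unit_borel" "J \<in> cube_borel (d - 1) \<rightarrow>\<^sub>M prob_algebra unit_borel" for F J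
    using measurable_emeasure_kernel[OF measurable_prob_algebraD[OF that(2)] that(1)] sets
    by (simp cong: measurable_cong_sets)
  have eq: "AE x in ?\<mu>. emeasure (K x) F = emeasure (L x) F" if F: "F \<in> sets unit_borel" for F
  proof (rule finite_measure.density_unique_finite_measure[OF fin])
    show "(\<lambda>x. emeasure (K x) F) \<in> borel_measurable ?\<mu>" "(\<lambda>x. emeasure (L x) F) \<in> borel_measurable ?\<mu>"
      using meas F KL by auto
    show "(\<integral>\<^sup>+x\<in>A. emeasure (K x) F \<partial>?\<mu>) = (\<integral>\<^sup>+x\<in>A. emeasure (L x) F \<partial>?\<mu>)"
      if "A \<in> sets ?\<mu>" for A
    proof -
      have "A \<in> sets (cube_borel (d - 1))" using that sets by simp
      then show ?thesis
        using K[unfolded is_cond_kernel_def, THEN conjunct2, rule_format, OF _ F]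
          L[unfolded is_cond_kernel_def, THEN conjunct2, rule_format, OF _ F] by (simp only:)
    qed
  qed auto
  have "AE x in ?\<mu>. emeasure (K x) ({..q} \<inter> {0..1}) = emeasure (L x) ({..q} \<inter> {0..1})" for q
    by (rule eq) (simp add: sets_unit_borel_iff)
  then have "AE x in ?\<mu>. \<forall>q\<in>\<rat>. emeasure (K x) ({..q} \<inter> {0..1}) = emeasure (L x) ({..q} \<inter> {0..1})"
    by (simp only: AE_ball_countable[OF countable_rat]) blast
  then show ?thesis
  proof (rule AE_mp, intro AE_I2 impI)
    fix x assume x: "x \<in> space ?\<mu>"
      and q: "\<forall>q\<in>\<rat>. emeasure (K x) ({..q} \<inter> {0..1}) = emeasure (L x) ({..q} \<inter> {0..1})"
    have "x \<in> space (cube_borel (d - 1))" using x sets_eq_imp_space_eq[OF sets] by simp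
    from measurable_space[OF KL(1) this] measurable_space[OF KL(2) this]
    have PK: "prob_space (K x)" "sets (K x) = sets unit_borel"
      and PL: "prob_space (L x)" "sets (L x) = sets unit_borel"
      by (auto simp: space_prob_algebra)
    show "K x = L x"
    proof (rule measure_eqI_unit_borel[OF PK(2) PL(2)])
      show "finite_measure (K x)" "finite_measure (L x)"
        using PK(1) PL(1) by (simp_all add: prob_space.axioms)
    qed (use q in blast)
  qed
qed

section \<open>Uniqueness of the three parts of a measure on the unit interval\<close>

lemma is_decompositionD:
  assumes "is_decomposition M A D S"
  shows "sets A = sets unit_borel" "sets D = sets unit_borel" "sets S = sets unit_borel"
    "absolutely_continuous unit_lborel A" "discrete_measure D" "singular_measure S"
    "\<And>F. F \<in> sets unit_borel \<Longrightarrow> emeasure M F = emeasure A F + emeasure D F + emeasure S F"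
  using assms unfolding is_decomposition_def by (elim conjE; simp)+

text \<open>Both discrete parts live on one countable set \<open>P\<close> and both singular parts
  on one Lebesgue null set \<open>W\<close> containing \<open>P\<close>. As the singular parts do
  not see \<open>P\<close> and the absolutely continuous parts do not see \<open>W\<close>, the
  discrete, singular and absolutely continuous parts must be the restrictions of \<open>M\<close> to
  \<open>P\<close>, to \<open>W - P\<close> and to the complement of \<open>W\<close>.\<close>

lemma is_decomposition_unique:
  assumes "is_decomposition M A D S" "is_decomposition M A' D' S'"
  shows "A = A' \<and> D = D' \<and> S = S'"
proof -
  have ex_N: "\<exists>N. countable N \<and> N \<in> sets unit_borel \<and> emeasure D ({0..1} - N) = 0" if "is_decomposition M A D S" for A D S
  proof -
    have "sets D = sets unit_borel" "space D = {0..1}"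
      using that sets_eq_imp_space_eq[of D unit_borel] by (auto simp: is_decomposition_def space_unit_borel)
    then show ?thesis using that by (auto simp: is_decomposition_def discrete_measure_def)
  qed
  obtain N where N: "countable N" "N \<in> sets unit_borel" "emeasure D ({0..1} - N) = 0"
    using ex_N[OF assms(1)] by blast
  obtain N' where N': "countable N'" "N' \<in> sets unit_borel" "emeasure D' ({0..1} - N') = 0"
    using ex_N[OF assms(2)] by blast
  have ex_Z: "\<exists>Z \<in> null_sets unit_lborel. emeasure S ({0..1} - Z) = 0" if "is_decomposition M A D S" for A D S
  proof -
    have "space S = {0..1}"
      using that sets_eq_imp_space_eq[of S unit_borel] by (auto simp: is_decomposition_def space_unit_borel)
    then show ?thesis using that by (auto simp: is_decomposition_def singular_measure_def)
  qed
  obtain Z where Z: "Z \<in> null_sets unit_lborel" "emeasure S ({0..1} - Z) = 0"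
    using ex_Z[OF assms(1)] by blast
  obtain Z' where Z': "Z' \<in> null_sets unit_lborel" "emeasure S' ({0..1} - Z') = 0"
    using ex_Z[OF assms(2)] by blast
  define P where "P = N \<union> N'"
  define W where "W = Z \<union> Z' \<union> P"
  have P: "countable P" "P \<in> sets unit_borel" using N N' by (auto simp: P_def)
  have "P \<in> null_sets unit_lborel"
    using P by (subst null_sets_restrict_space)
      (auto simp: sets_unit_borel_iff intro!: countable_imp_null_set_lborel)
  then have W: "W \<in> null_sets unit_lborel" using Z Z' by (auto simp: W_def)
  then have Ws: "W \<in> sets unit_borel" using null_setsD2 by fastforce
  have key: "emeasure D F = emeasure M (F \<inter> P) \<and> emeasure S F = emeasure M (F \<inter> (W - P))
      \<and> emeasure A F = emeasure M (F - W)"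
    if dec: "is_decomposition M A D S" and F: "F \<in> sets unit_borel"
      and D: "emeasure D ({0..1} - P) = 0" and S: "emeasure S ({0..1} - W) = 0" for A D S F
  proof -
    have s: "sets A = sets unit_borel" "sets D = sets unit_borel" "sets S = sets unit_borel"
      and ac: "absolutely_continuous unit_lborel A"
      and sum: "\<And>F. F \<in> sets unit_borel \<Longrightarrow> emeasure M F = emeasure A F + emeasure D F + emeasure S F"
      and sing: "singular_measure S"
      by (rule is_decompositionD[OF dec]; assumption?)+
    have Fsub: "F \<subseteq> {0..1}" using F by (simp add: sets_unit_borel_iff)
    have "space S = {0..1}" using sets_eq_imp_space_eq[OF s(3)] by (simp add: space_unit_borel)
    then have "(\<Union>p\<in>P. {p}) \<in> null_sets S"
      using P sing s by (intro null_sets_UN' null_setsI)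
        (auto simp: singular_measure_def sets_unit_borel_iff)
    then have "P \<in> null_sets S" by simp
    then have SP: "emeasure S B = 0" if "B \<subseteq> P" for B
      using that emeasure_mono[of B P S] by (auto simp: null_sets_def)
    have AW: "emeasure A B = 0" if "B \<subseteq> W" for B
      using W ac that emeasure_mono[of B W A] by (auto simp: null_sets_def absolutely_continuous_def)
    have DP: "emeasure D B = 0" if "B \<subseteq> {0..1} - P" for B
      using D that emeasure_mono[of B "{0..1} - P" D] P s
      by (auto simp: sets_unit_borel_iff)
    have SW: "emeasure S B = 0" if "B \<subseteq> {0..1} - W" for B
      using S that emeasure_mono[of B "{0..1} - W" S] Ws s
      by (auto simp: sets_unit_borel_iff)
    have split: "emeasure X F = emeasure X (F \<inter> P) + emeasure X (F \<inter> (W - P)) + emeasure X (F - W)"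
      if X: "sets X = sets unit_borel" for X
    proof -
      have "F = (F \<inter> P \<union> F \<inter> (W - P)) \<union> (F - W)" by (auto simp: W_def)
      moreover have "emeasure X ((F \<inter> P \<union> F \<inter> (W - P)) \<union> (F - W)) =
          emeasure X (F \<inter> P \<union> F \<inter> (W - P)) + emeasure X (F - W)"
        using F P Ws X by (intro plus_emeasure[symmetric]) (auto simp: W_def)
      moreover have "emeasure X (F \<inter> P \<union> F \<inter> (W - P)) = emeasure X (F \<inter> P) + emeasure X (F \<inter> (W - P))"
        using F P Ws X by (intro plus_emeasure[symmetric]) auto
      ultimately show ?thesis by simp
    qed
    have "F \<inter> P \<in> sets unit_borel" "F \<inter> (W - P) \<in> sets unit_borel" "F - W \<in> sets unit_borel"
      using F P Ws by (simp_all only: sets.Int sets.Diff)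
    note M = this[THEN sum]
    have "P \<subseteq> W" by (auto simp: W_def)
    then have "emeasure A (F \<inter> P) = 0" "emeasure A (F \<inter> (W - P)) = 0" "emeasure D (F \<inter> (W - P)) = 0"
      "emeasure D (F - W) = 0" "emeasure S (F \<inter> P) = 0" "emeasure S (F - W) = 0"
      using Fsub by (intro AW DP SP SW; auto)+
    then show ?thesis
      unfolding M split[OF s(1)] split[OF s(2)] split[OF s(3)] by simp
  qed
  have "sets D = sets unit_borel" "sets D' = sets unit_borel" "sets S = sets unit_borel" "sets S' = sets unit_borel"
    "sets A = sets unit_borel" "sets A' = sets unit_borel"
    using is_decompositionD[OF assms(1)] is_decompositionD[OF assms(2)] by simp_all
  note s = this
  have le: "emeasure X ({0..1} - B) = 0" if "emeasure X ({0..1} - B') = 0" "B' \<subseteq> B"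
    "sets X = sets unit_borel" "B' \<in> sets unit_borel" for X B B'
  proof -
    have "{0..1} - B' \<in> sets X" using that(3,4) by (auto simp: sets_unit_borel_iff)
    then have "emeasure X ({0..1} - B) \<le> emeasure X ({0..1} - B')"
      using that(2) by (intro emeasure_mono) auto
    then show ?thesis using that(1) by simp
  qed
  have ZZ: "Z \<in> sets unit_borel" "Z' \<in> sets unit_borel"
    using Z(1) Z'(1) null_setsD2 by fastforce+
  have *: "emeasure D ({0..1} - P) = 0" "emeasure D' ({0..1} - P) = 0"
    "emeasure S ({0..1} - W) = 0" "emeasure S' ({0..1} - W) = 0"
    by (rule le[OF N(3) _ s(1) N(2)] le[OF N'(3) _ s(2) N'(2)] le[OF Z(2) _ s(3) ZZ(1)] le[OF Z'(2) _ s(4) ZZ(2)];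
      auto simp: P_def W_def)+
  show ?thesis
  proof (intro conjI measure_eqI)
    note k = key[OF assms(1) _ *(1,3)] and k' = key[OF assms(2) _ *(2,4)]
    show "emeasure A F = emeasure A' F" if "F \<in> sets A" for F
      using k[of F] k'[of F] that by (simp only: s)
    show "emeasure D F = emeasure D' F" if "F \<in> sets D" for F
      using k[of F] k'[of F] that by (simp only: s)
    show "emeasure S F = emeasure S' F" if "F \<in> sets S" for F
      using k[of F] k'[of F] that by (simp only: s)
  qed (simp_all add: s)
qed

lemma decomposition_parts_eq:
  assumes "is_decomposition M A D S"
  shows "abs_part M = A" "dis_part M = D" "sing_part M = S"
proof -
  note u = is_decomposition_unique[OF assms]
  show "abs_part M = A" unfolding abs_part_def
    by (rule the_equality) (use assms in blast, elim exE, drule u, simp)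
  show "dis_part M = D" unfolding dis_part_def
    by (rule the_equality) (use assms in blast, elim exE, drule u, simp)
  show "sing_part M = S" unfolding sing_part_def
    by (rule the_equality) (use assms in blast, elim exE, drule u, simp)
qed

section \<open>Mixtures and a singular continuous measure\<close>

definition mixture :: "(nat \<Rightarrow> ennreal) \<Rightarrow> (nat \<Rightarrow> real measure) \<Rightarrow> real measure" where
  "mixture w N = measure_of UNIV (sets borel) (\<lambda>A. \<Sum>n. w n * emeasure (N n) A)"

lemma sets_mixture [simp, measurable_cong]: "sets (mixture w N) = sets borel"
  by (simp add: mixture_def sets_measure_of_conv sets.sigma_sets_eq[of borel, simplified])

lemma space_mixture [simp]: "space (mixture w N) = UNIV"
  by (simp add: mixture_def space_measure_of_conv)

lemma suminf_commute_ennreal: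
  fixes f :: "nat \<Rightarrow> nat \<Rightarrow> ennreal"
  shows "(\<Sum>i. \<Sum>j. f i j) = (\<Sum>j. \<Sum>i. f i j)"
proof -
  have "(\<Sum>i. \<Sum>j. f i j) = (\<integral>\<^sup>+i. (\<Sum>j. f i j) \<partial>count_space UNIV)"
    by (simp add: nn_integral_count_space_nat)
  also have "\<dots> = (\<Sum>j. \<integral>\<^sup>+i. f i j \<partial>count_space UNIV)"
    by (intro nn_integral_suminf) simp
  finally show ?thesis by (simp add: nn_integral_count_space_nat)
qed

lemma emeasure_mixture:
  assumes N: "\<And>n. sets (N n) = sets borel" and A: "A \<in> sets borel"
  shows "emeasure (mixture w N) A = (\<Sum>n. w n * emeasure (N n) A)"
proof (rule emeasure_measure_of[OF mixture_def])
  show "countably_additive (sets (mixture w N)) (\<lambda>A. \<Sum>n. w n * emeasure (N n) A)"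
  proof (rule countably_additiveI)
    fix B :: "nat \<Rightarrow> real set"
    assume B: "range B \<subseteq> sets (mixture w N)" "disjoint_family B"
    have "(\<Sum>i. \<Sum>n. w n * emeasure (N n) (B i)) = (\<Sum>n. \<Sum>i. w n * emeasure (N n) (B i))"
      by (rule suminf_commute_ennreal)
    also have "\<dots> = (\<Sum>n. w n * emeasure (N n) (\<Union>i. B i))"
      using B N by (simp add: ennreal_suminf_cmult suminf_emeasure)
    finally show "(\<Sum>i. \<Sum>n. w n * emeasure (N n) (B i)) = (\<Sum>n. w n * emeasure (N n) (\<Union>i. B i))" .
  qed
qed (use A in \<open>auto simp: positive_def\<close>)

text \<open>Induction over nonnegative measurable functions. In the limit step monotone convergence
  is used for the mixture, for each component, and for the counting measure that turns the weighted
  sum into an integral.\<close>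

lemma nn_integral_mixture:
  assumes N: "\<And>n. sets (N n) = sets borel" and f: "f \<in> borel_measurable borel"
  shows "(\<integral>\<^sup>+x. f x \<partial>mixture w N) = (\<Sum>n. w n * (\<integral>\<^sup>+x. f x \<partial>N n))"
  using f
proof induction
  case (cong f g)
  then have "f = g" by auto
  then show ?case using cong by simp
next
  case (set A)
  then show ?case using N by (simp add: emeasure_mixture)
next
  case (mult f c)
  have "f \<in> borel_measurable (N n)" for n using mult.hyps N by (simp cong: measurable_cong_sets)
  moreover have "f \<in> borel_measurable (mixture w N)" using mult.hyps by (simp cong: measurable_cong_sets)
  ultimately show ?case using mult
    by (simp add: nn_integral_cmult mult.left_commute[of _ c])
next
  case (add f g)
  have "f \<in> borel_measurable (N n)" "g \<in> borel_measurable (N n)" for n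
    using add.hyps N by (simp_all cong: measurable_cong_sets)
  moreover have "f \<in> borel_measurable (mixture w N)" "g \<in> borel_measurable (mixture w N)"
    using add.hyps by (simp_all cong: measurable_cong_sets)
  ultimately show ?case using add
    by (simp add: nn_integral_add distrib_left suminf_add)
next
  case (seq F)
  have m: "F i \<in> borel_measurable (N n)" for i n using seq.hyps N by (simp cong: measurable_cong_sets)
  have m': "F i \<in> borel_measurable (mixture w N)" for i using seq.hyps by (simp cong: measurable_cong_sets)
  have inc: "incseq (\<lambda>i. (\<integral>\<^sup>+x. F i x \<partial>M))" for M
    using incseq_SucD[OF seq.hyps(3)] by (intro incseq_SucI nn_integral_mono) (simp add: le_fun_def)
  have G: "(\<integral>\<^sup>+x. (SUP i. F i) x \<partial>M) = (\<integral>\<^sup>+x. (SUP i. F i x) \<partial>M)" for M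
    by (simp add: image_comp)
  have "(\<integral>\<^sup>+x. (SUP i. F i) x \<partial>mixture w N) = (SUP i. \<integral>\<^sup>+x. F i x \<partial>mixture w N)"
    unfolding G by (rule nn_integral_monotone_convergence_SUP[OF seq.hyps(3) m'])
  also have "\<dots> = (SUP i. \<integral>\<^sup>+n. w n * (\<integral>\<^sup>+x. F i x \<partial>N n) \<partial>count_space UNIV)"
    by (simp only: seq.IH nn_integral_count_space_nat)
  also have "\<dots> = (\<integral>\<^sup>+n. (SUP i. w n * (\<integral>\<^sup>+x. F i x \<partial>N n)) \<partial>count_space UNIV)"
  proof (rule nn_integral_monotone_convergence_SUP[symmetric])
    show "incseq (\<lambda>i n. w n * (\<integral>\<^sup>+x. F i x \<partial>N n))"
      by (intro incseq_SucI le_funI mult_left_mono incseq_SucD[OF inc]) simp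
  qed simp
  also have "\<dots> = (\<integral>\<^sup>+n. w n * (\<integral>\<^sup>+x. (SUP i. F i) x \<partial>N n) \<partial>count_space UNIV)"
    unfolding G nn_integral_monotone_convergence_SUP[OF seq.hyps(3) m]
    by (simp only: SUP_mult_left_ennreal)
  finally show ?case by (simp only: nn_integral_count_space_nat)
qed

section \<open>Measures of the three types that charge every interval of the half line\<close>

definition charges_intervals :: "real measure \<Rightarrow> bool" where
  "charges_intervals M \<longleftrightarrow> (\<forall>a b. 0 \<le> a \<longrightarrow> a < b \<longrightarrow> 0 < emeasure M {a<..<b})"

definition concentrated_on :: "real set \<Rightarrow> real measure \<Rightarrow> bool" where
  "concentrated_on A M \<longleftrightarrow> emeasure M (- A) = 0"

text \<open>Let \<open>\<kappa>\<close> be a probability measure with an atom at every rational and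
  no other mass, and \<open>f\<close> its left-continuous distribution function. Density of the
  atoms makes \<open>f\<close> strictly increasing. The range of \<open>f\<close> avoids the open
  jump intervals, whose lengths are the atom masses and add up to 1, so that almost nothing of
  \<open>{0..1}\<close> is left for it.\<close>

lemma strict_mono_null_range:
  obtains f :: "real \<Rightarrow> real" and R where "strict_mono f" "(f \<longlongrightarrow> 0) at_bot"
    "\<And>x. 0 < f x" "range f \<subseteq> R" "R \<subseteq> {0..1}" "R \<in> null_sets lborel"
proof -
  define q where "q = from_nat_into (\<rat> :: real set)"
  have q: "bij_betw q UNIV \<rat>"
    unfolding q_def by (intro bij_betw_from_nat_into countable_rat) (simp add: Rats_infinite)
  then have inj: "inj q" and range_q: "range q = \<rat>" by (auto simp: bij_betw_def)
  define \<kappa> where "\<kappa> = distr (map_pmf q (geometric_pmf (1/2))) borel (\<lambda>x. x)"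
  interpret K: prob_space \<kappa> unfolding \<kappa>_def by (rule measure_pmf.prob_space_distr) simp
  interpret K: real_distribution \<kappa> by standard (simp_all add: \<kappa>_def)
  have atom: "measure \<kappa> {q n} = (1/2) ^ n * (1/2)" for n
  proof -
    have "q -` {q n} = {n}" using inj by (auto simp: inj_def)
    then have "measure \<kappa> {q n} = measure (measure_pmf (geometric_pmf (1/2))) {n}"
      by (simp add: \<kappa>_def measure_distr del: measure_pmf_single)
    then show ?thesis by (simp add: measure_pmf_single)
  qed
  have atom_sum: "(\<Sum>n. emeasure \<kappa> {q n}) = 1"
  proof -
    have "(\<Sum>n. emeasure \<kappa> {q n}) = (\<Sum>n. ennreal ((1/2) ^ n * (1/2)))"
      by (simp only: K.emeasure_eq_measure atom)
    also have "\<dots> = ennreal (\<Sum>n. (1/2) ^ n * (1/2))"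
      by (intro suminf_ennreal2 summable_mult2 summable_geometric) auto
    also have "(\<Sum>n. (1/2) ^ n * (1/2)) = (1::real)"
      by (subst suminf_mult2[symmetric]) (auto simp: suminf_geometric)
    finally show ?thesis by simp
  qed
  define f where "f x = measure \<kappa> {..<x}" for x
  have jump: "f (q n) + (1/2) ^ n * (1/2) \<le> f x" if "q n < x" for n x
  proof -
    have "f (q n) + measure \<kappa> {q n} = measure \<kappa> ({..<q n} \<union> {q n})"
      unfolding f_def by (intro K.finite_measure_Union[symmetric]) auto
    also have "\<dots> \<le> f x" unfolding f_def using that by (intro K.finite_measure_mono) auto
    finally show ?thesis by (simp add: atom)
  qed
  have mono: "f x \<le> f y" if "x \<le> y" for x y
    unfolding f_def using that by (intro K.finite_measure_mono) auto
  have strict: "f x < f y" if xy: "x < y" for x y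
  proof -
    obtain r where r: "r \<in> range q" "x < r" "r < y"
      unfolding range_q using Rats_dense_in_real[OF xy] by auto
    then obtain n where "r = q n" by (elim rangeE)
    with r have n: "x < q n" "q n < y" by simp_all
    have "(0::real) < (1/2) ^ n * (1/2)" by simp
    then show ?thesis using mono[OF less_imp_le[OF n(1)]] jump[OF n(2)] by linarith
  qed
  \<comment> \<open>The jump of \<open>f\<close> at \<open>q n\<close>. As \<open>f\<close> omits
    the mass at its own argument, \<open>f (q n)\<close> is the lower end of the jump, and no value
    of \<open>f\<close> falls inside.\<close>
  define I where "I n = {f (q n) <..< f (q n) + (1/2) ^ n * (1/2)}" for n
  have disj: "disjoint_family I"
  proof (unfold disjoint_family_on_def, intro ballI impI)
    fix m n :: nat assume "m \<noteq> n"
    then have "q m \<noteq> q n" using inj by (auto simp: inj_def)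
    then consider "q m < q n" | "q n < q m" by linarith
    then show "I m \<inter> I n = {}"
      by cases (use jump[of m "q n"] jump[of n "q m"] in \<open>auto simp: I_def\<close>)
  qed
  have Isub: "I n \<subseteq> {0..1}" for n
  proof -
    have "f (q n) + (1/2) ^ n * (1/2) \<le> 1"
      using jump[of n "q n + 1"] K.prob_le_1[of "{..<q n + 1}"] unfolding f_def by linarith
    moreover have "0 \<le> f (q n)" by (simp add: f_def)
    ultimately show ?thesis by (auto simp: I_def)
  qed
  have "emeasure lborel (\<Union>n. I n) = (\<Sum>n. emeasure lborel (I n))"
    by (rule suminf_emeasure[OF _ disj, symmetric]) (auto simp: I_def)
  also have "\<dots> = (\<Sum>n. emeasure \<kappa> {q n})"
    by (simp add: I_def K.emeasure_eq_measure atom)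
  finally have "emeasure lborel (\<Union>n. I n) = 1" by (simp add: atom_sum)
  then have "emeasure lborel ({0..1} - (\<Union>n. I n)) = 0"
    using Isub by (subst emeasure_Diff) (auto simp: I_def)
  then have "{0..1} - (\<Union>n. I n) \<in> null_sets lborel"
    by (intro null_setsI) (auto simp: I_def)
  moreover have "range f \<subseteq> {0..1} - (\<Union>n. I n)"
  proof -
    have "f x \<notin> I n" for x n
      using jump[of n x] mono[of x "q n"] by (cases "q n < x") (auto simp: I_def)
    then show ?thesis by (auto simp: f_def)
  qed
  moreover have "strict_mono f" using strict by (auto intro: strict_monoI)
  moreover have "0 < f x" for x using strict[of "x - 1" x] by (auto simp: f_def intro: le_less_trans[rotated])
  moreover have "(f \<longlongrightarrow> 0) at_bot"
  proof (rule tendsto_sandwich[OF _ _ tendsto_const K.cdf_lim_at_bot])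
    show "\<forall>\<^sub>F x in at_bot. 0 \<le> f x" by (simp add: f_def)
    show "\<forall>\<^sub>F x in at_bot. f x \<le> cdf \<kappa> x"
      by (intro always_eventually allI) (auto simp: f_def cdf_def intro!: K.finite_measure_mono)
  qed
  ultimately show ?thesis by (intro that[of f "{0..1} - (\<Union>n. I n)"]) auto
qed

text \<open>Image under the above \<open>f\<close> of a finite measure with the same null sets as
  Lebesgue measure. Injectivity of \<open>f\<close> excludes atoms, its null range gives
  singularity, and its limit 0 at minus infinity puts a half line of positive mass into each
  interval next to 0.\<close>

lemma singular_continuous_measure:
  obtains \<rho> :: "real measure" and R where "sets \<rho> = sets borel" "finite_measure \<rho>"
    "\<And>x. emeasure \<rho> {x} = 0" "R \<in> null_sets lborel" "R \<subseteq> {0..1}" "emeasure \<rho> (- R) = 0"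
    "\<And>e. e > 0 \<Longrightarrow> 0 < emeasure \<rho> {0<..<e}"
proof -
  obtain f :: "real \<Rightarrow> real" and R where f: "strict_mono f" "(f \<longlongrightarrow> 0) at_bot"
    "\<And>x. 0 < f x" "range f \<subseteq> R" "R \<subseteq> {0..1}" "R \<in> null_sets lborel"
    using strict_mono_null_range by blast
  have [measurable]: "f \<in> borel_measurable borel"
    using f(1) by (intro borel_measurable_mono strict_mono_mono)
  \<comment> \<open>A positive density with finite integral replaces Lebesgue measure by a finite
    measure without changing the null sets.\<close>
  obtain h :: "real \<Rightarrow> ennreal" where h: "h \<in> borel_measurable lborel" "integral\<^sup>N lborel h \<noteq> \<infinity>"
    "\<And>x. x \<in> space lborel \<Longrightarrow> 0 < h x \<and> h x < \<infinity>"
    using sigma_finite_measure.Ex_finite_integrable_function[OF sigma_finite_lborel] by blast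
  define X where "X = density lborel h"
  have setsX [measurable_cong]: "sets X = sets borel" by (simp add: X_def)
  have null: "A \<in> null_sets X \<longleftrightarrow> A \<in> null_sets lborel" for A
  proof -
    have "(AE x in lborel. x \<in> A \<longrightarrow> h x = 0) \<longleftrightarrow> (AE x in lborel. x \<notin> A)"
      using h(3) by (intro AE_cong) (auto simp: less_le)
    then show ?thesis unfolding X_def
      by (cases "A \<in> sets lborel") (auto simp: null_sets_density_iff[OF h(1)] AE_iff_null_sets)
  qed
  define \<rho> where "\<rho> = distr X borel f"
  have em: "emeasure \<rho> A = emeasure X (f -` A)" if "A \<in> sets borel" for A
    using that by (simp add: \<rho>_def emeasure_distr X_def)
  show ?thesis
  proof (rule that[of \<rho> R])
    show "sets \<rho> = sets borel" by (simp add: \<rho>_def)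
    have "finite_measure X" using h by (intro finite_measureI) (simp add: X_def emeasure_density)
    then show "finite_measure \<rho>" unfolding \<rho>_def by (rule finite_measure.finite_measure_distr) simp
    show "emeasure \<rho> {x} = 0" for x
    proof -
      have "f -` {x} \<subseteq> {inv f x}" using strict_mono_imp_inj_on[OF f(1)] by (auto simp: inv_f_f)
      moreover have "emeasure X {inv f x} = 0" using null[of "{inv f x}"] by (auto simp: null_sets_def)
      ultimately have "emeasure X (f -` {x}) = 0"
        using emeasure_mono[of "f -` {x}" "{inv f x}" X] setsX by simp
      then show ?thesis by (simp add: em)
    qed
    show "emeasure \<rho> (- R) = 0"
    proof -
      have "f -` (- R) = {}" using f(4) by auto
      then show ?thesis using f(6) by (subst em) auto
    qed
    show "0 < emeasure \<rho> {0<..<e}" if "e > 0" for e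
    proof -
      have "\<forall>\<^sub>F x in at_bot. f x < e" using f(2) that by (rule order_tendstoD)
      then obtain t where t: "f t < e" by (auto simp: eventually_at_bot_linorder)
      have "{..t} \<notin> null_sets lborel"
      proof
        assume "{..t} \<in> null_sets lborel"
        then have "{t - 1..t} \<in> null_sets lborel" by (rule null_sets_subset) auto
        then show False by (simp add: null_sets_def)
      qed
      then have "emeasure X {..t} \<noteq> 0" using null[of "{..t}"] by (auto simp: null_sets_def X_def)
      moreover have "emeasure X {..t} \<le> emeasure X (f -` {0<..<e})"
      proof (rule emeasure_mono)
        have "f x < e" if "x \<le> t" for x
          using strict_mono_less_eq[OF f(1), of x t] that t by linarith
        then show "{..t} \<subseteq> f -` {0<..<e}" using f(3) by auto
        show "f -` {0<..<e} \<in> sets X"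
          using measurable_sets_borel[OF \<open>f \<in> borel_measurable borel\<close>, of "{0<..<e}"] setsX by simp
      qed
      ultimately have "0 < emeasure X (f -` {0<..<e})" by (simp add: zero_less_iff_neq_zero) (metis le_zero_eq)
      then show ?thesis by (simp add: em)
    qed
  qed (use f in auto)
qed

lemma emeasure_mixture_pos:
  assumes "\<And>n. sets (N n) = sets borel" "A \<in> sets borel" "0 < w n" "0 < emeasure (N n) A"
  shows "0 < emeasure (mixture w N) A"
proof -
  have "0 < w n * emeasure (N n) A" using assms by (simp add: ennreal_zero_less_mult_iff)
  also have "\<dots> \<le> (\<Sum>n. w n * emeasure (N n) A)"
    using sum_le_suminf[of "\<lambda>n. w n * emeasure (N n) A" "{n}"] by simp
  finally show ?thesis using assms by (simp add: emeasure_mixture)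
qed

lemma emeasure_mixture_zero:
  assumes "\<And>n. sets (N n) = sets borel" "A \<in> sets borel" "\<And>n. w n = 0 \<or> emeasure (N n) A = 0"
  shows "emeasure (mixture w N) A = 0"
proof -
  have *: "w n * emeasure (N n) A = 0" for n using assms(3)[of n] by auto
  show ?thesis by (simp add: emeasure_mixture[OF assms(1,2)] *)
qed

text \<open>For pieces located at or below \<open>c n\<close>, dividing by
  \<open>1 + c n ^ s\<close> makes the total mass and the moment of order \<open>s\<close> of the
  weighted sum finite at once, whatever the growth of \<open>c\<close>.\<close>

definition moment_weight :: "nat \<Rightarrow> real \<Rightarrow> nat \<Rightarrow> ennreal" where
  "moment_weight s c n = ennreal ((1/2) ^ n / (1 + c ^ s))"

definition positive_rational :: "nat \<Rightarrow> real" where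
  "positive_rational = from_nat_into (\<rat> \<inter> {0<..})"

lemma positive_rational_pos: "0 < positive_rational n"
proof -
  have "(1::real) \<in> \<rat> \<inter> {0<..}" by simp
  then have "\<rat> \<inter> {0<..} \<noteq> ({} :: real set)" by blast
  from from_nat_into[OF this, of n] show ?thesis by (simp add: positive_rational_def)
qed

lemma positive_rational_dense:
  assumes "0 \<le> a" "a < b"
  obtains n where "a < positive_rational n" "positive_rational n < b"
proof -
    obtain r where r: "r \<in> \<rat>" "a < r" "r < b" using Rats_dense_in_real[OF assms(2)] by auto
  have "\<exists>n. from_nat_into (\<rat> \<inter> {0<..}) n = r"
    using r assms(1) by (intro from_nat_into_surj) (auto intro: countable_rat)
  then show ?thesis using that r by (auto simp: positive_rational_def)
qed

lemma suminf_moment_weight: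
  assumes f: "\<And>n. f n \<le> ennreal (C * (1 + c n ^ s))" and "C \<ge> 0" "\<And>n. c n \<ge> 0"
  shows "(\<Sum>n. moment_weight s (c n) n * f n) < \<infinity>"
proof -
  have "moment_weight s (c n) n * f n \<le> ennreal (C * (1/2) ^ n)" for n
  proof -
    have "moment_weight s (c n) n * f n \<le> moment_weight s (c n) n * ennreal (C * (1 + c n ^ s))"
      using f by (intro mult_left_mono) auto
    also have "\<dots> = ennreal ((1/2) ^ n / (1 + c n ^ s) * (C * (1 + c n ^ s)))"
      unfolding moment_weight_def using assms(2,3) by (intro ennreal_mult[symmetric]) auto
    also have "(1/2) ^ n / (1 + c n ^ s) * (C * (1 + c n ^ s)) = C * (1/2) ^ n"
      using assms(3)[of n] by (simp add: add_nonneg_eq_0_iff)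
    finally show ?thesis .
  qed
  then have "(\<Sum>n. moment_weight s (c n) n * f n) \<le> (\<Sum>n. ennreal (C * (1/2) ^ n))"
    by (intro suminf_le) auto
  also have "\<dots> = ennreal (\<Sum>n. C * (1/2) ^ n)"
    using assms(2) by (intro suminf_ennreal2 summable_mult summable_geometric) auto
  finally show ?thesis by (simp add: le_less_trans)
qed

lemma moment_weight_pos: "c \<ge> 0 \<Longrightarrow> 0 < moment_weight s c n"
  by (simp add: moment_weight_def add_pos_nonneg)

text \<open>The moment condition makes the generator finite, the finite mass makes it Lipschitz, and
  the last condition places the measure on the open half line.\<close>

definition admissible :: "nat \<Rightarrow> real measure \<Rightarrow> bool" where
  "admissible s M \<longleftrightarrow> sets M = sets borel \<and> emeasure M UNIV < \<infinity> \<and>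
     (\<integral>\<^sup>+r. ennreal (r ^ s) \<partial>M) < \<infinity> \<and> emeasure M {..0} = 0"

lemma ex_charging_absolutely_continuous: "\<exists>M. admissible s M \<and> charges_intervals M \<and> absolutely_continuous lborel M"
proof -
  define M where "M = density lborel (\<lambda>x. ennreal (exp (- x)) * indicator {0..} x)"
  have em: "emeasure M A = (\<integral>\<^sup>+x. ennreal (exp (- x)) * indicator {0..} x * indicator A x \<partial>lborel)"
    if "A \<in> sets borel" for A
    using that by (simp add: M_def emeasure_density)
  have "(\<integral>\<^sup>+r. ennreal (r ^ k) \<partial>M) = ennreal (fact k)" for k
  proof -
    have "(\<integral>\<^sup>+r. ennreal (r ^ k) \<partial>M) =
        (\<integral>\<^sup>+x. (ennreal (exp (- x)) * indicator {0..} x) * ennreal (x ^ k) \<partial>lborel)"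
      unfolding M_def by (subst nn_integral_density) auto
    also have "\<dots> = (\<integral>\<^sup>+x. ennreal (x ^ k * exp (-x)) * indicator {0 ..} x \<partial>lborel)"
      by (intro nn_integral_cong) (auto simp: indicator_def ennreal_mult' mult.commute)
    finally show ?thesis by (simp add: nn_intergal_power_times_exp_Ici)
  qed
  note mom = this
  have "emeasure M UNIV < \<infinity>" using mom[of 0] by (simp add: M_def)
  moreover have "emeasure M {..0} = 0"
  proof -
    have "emeasure M {..0} = (\<integral>\<^sup>+x\<in>{0}. ennreal (exp (- x)) \<partial>lborel)"
      by (subst em) (auto intro!: nn_integral_cong simp: indicator_def)
    also have "\<dots> = 0" by (rule nn_integral_null_set) auto
    finally show ?thesis .
  qed
  moreover have "charges_intervals M"
    unfolding charges_intervals_def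
  proof (intro allI impI)
    fix a b :: real assume ab: "0 \<le> a" "a < b"
    show "0 < emeasure M {a<..<b}"
    proof (rule ccontr)
      assume "\<not> ?thesis"
      then have "{a<..<b} \<in> null_sets M" by (intro null_setsI) (auto simp: M_def)
      then have "AE x in lborel. x \<in> {a<..<b} \<longrightarrow> ennreal (exp (- x)) * indicator {0..} x = 0"
        unfolding M_def by (subst (asm) null_sets_density_iff) auto
      then have "AE x in lborel. x \<notin> {a<..<b}"
        by eventually_elim (use ab in auto)
      then have "{a<..<b} \<in> null_sets lborel" by (subst AE_iff_null_sets) auto
      then show False using ab by (simp add: null_sets_def)
    qed
  qed
  moreover have "absolutely_continuous lborel M"
    unfolding M_def by (rule absolutely_continuousI_density) simp
  moreover have "sets M = sets borel" by (simp add: M_def)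
  moreover have "(\<integral>\<^sup>+r. ennreal (r ^ s) \<partial>M) < \<infinity>" by (simp add: mom)
  ultimately show ?thesis unfolding admissible_def by blast
qed

text \<open>Weighted point masses at the positive rationals.\<close>

lemma ex_charging_discrete: "\<exists>M. admissible s M \<and> charges_intervals M \<and> (\<exists>D. countable D \<and> emeasure M (- D) = 0)"
proof -
  let ?q = positive_rational
  define M where "M = mixture (\<lambda>n. moment_weight s (?q n) n) (\<lambda>n. return borel (?q n))"
  have sets: "sets (return borel (?q n)) = sets borel" for n by simp
  have "(\<Sum>n. moment_weight s (?q n) n * 1) < \<infinity>"
    by (rule suminf_moment_weight[where C = 1]) (auto simp: positive_rational_pos less_imp_le)
  then have "emeasure M UNIV < \<infinity>" by (simp add: M_def emeasure_mixture)
  moreover have "(\<integral>\<^sup>+r. ennreal (r ^ s) \<partial>M) < \<infinity>"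
  proof -
    have "(\<Sum>n. moment_weight s (?q n) n * ennreal (?q n ^ s)) < \<infinity>"
      by (rule suminf_moment_weight[where C = 1])
        (auto simp: positive_rational_pos less_imp_le intro!: ennreal_leI simp del: ennreal_plus)
    then show ?thesis unfolding M_def by (subst nn_integral_mixture) (simp_all add: nn_integral_return)
  qed
  moreover have "emeasure M {..0} = 0"
    unfolding M_def using positive_rational_pos by (intro emeasure_mixture_zero) (auto simp: not_le)
  moreover have "charges_intervals M"
    unfolding charges_intervals_def
  proof (intro allI impI)
    fix a b :: real assume ab: "0 \<le> a" "a < b"
    then obtain n where "a < ?q n" "?q n < b" by (rule positive_rational_dense)
    then show "0 < emeasure M {a<..<b}"
      unfolding M_def by (intro emeasure_mixture_pos[where n = n])
        (auto simp: moment_weight_pos positive_rational_pos less_imp_le)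
  qed
  moreover have "countable (range ?q)" by simp
  moreover have "emeasure M (- range ?q) = 0"
  proof -
    have "range ?q \<in> sets borel" by (rule sets.countable) auto
    then have "- range ?q \<in> sets borel" by auto
    then show ?thesis unfolding M_def by (intro emeasure_mixture_zero) auto
  qed
  moreover have "sets M = sets borel" by (simp add: M_def)
  ultimately show ?thesis unfolding admissible_def by blast
qed

text \<open>Translates of one singular measure \<open>\<rho>\<close> to all positive rationals.
  Since \<open>\<rho>\<close> charges every interval next to 0, the translate to a rational inside
  \<open>(a,b)\<close> charges \<open>(a,b)\<close>; countably many translates of the carrier of
  \<open>\<rho>\<close> are still a null set.\<close>

lemma ex_charging_singular: "\<exists>M. admissible s M \<and> charges_intervals M \<and> (\<forall>x. emeasure M {x} = 0) \<and>
  (\<exists>Z\<in>null_sets lborel. emeasure M (- Z) = 0)"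
proof -
  let ?q = positive_rational
  obtain \<rho> :: "real measure" and R where \<rho>: "sets \<rho> = sets borel" "finite_measure \<rho>"
    "\<And>x. emeasure \<rho> {x} = 0" "R \<in> null_sets lborel" "R \<subseteq> {0..1}" "emeasure \<rho> (- R) = 0"
    "\<And>e. e > 0 \<Longrightarrow> 0 < emeasure \<rho> {0<..<e}"
    using singular_continuous_measure by metis
  interpret finite_measure \<rho> by fact
  have [simp]: "space \<rho> = UNIV" using sets_eq_imp_space_eq[OF \<rho>(1)] by simp
  have shift_meas: "(\<lambda>r. c + r) \<in> \<rho> \<rightarrow>\<^sub>M borel" for c :: real using \<rho>(1) by (simp cong: measurable_cong_sets)
  have Rs: "R \<in> sets borel" using \<rho>(4) by auto
  define T where "T n = distr \<rho> borel (\<lambda>r. ?q n + r)" for n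
  have sets_T: "sets (T n) = sets borel" for n by (simp add: T_def)
  have T: "emeasure (T n) A = emeasure \<rho> ((\<lambda>r. ?q n + r) -` A)" if "A \<in> sets borel" for n A
    unfolding T_def using that by (subst emeasure_distr[OF shift_meas]) auto
  \<comment> \<open>The carrier of \<open>\<rho>\<close> is contained in \<open>{0..1}\<close>, so
    the translate to \<open>?q n\<close> lives below \<open>?q n + 1\<close>; this bound enters the
    weight.\<close>
  define M where "M = mixture (\<lambda>n. moment_weight s (?q n + 1) n) T"
  have AE: "AE r in \<rho>. r \<in> R"
    by (rule AE_I[of _ _ "- R"]) (use \<rho>(1,6) Rs in auto)
  have q1: "0 \<le> ?q n + 1" for n using positive_rational_pos[of n] by simp
  have "emeasure (T n) UNIV \<le> ennreal (measure \<rho> UNIV * (1 + (?q n + 1) ^ s))" for n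
  proof -
    have "emeasure (T n) UNIV = ennreal (measure \<rho> UNIV)" by (simp add: T emeasure_eq_measure)
    also have "measure \<rho> UNIV \<le> measure \<rho> UNIV * (1 + (?q n + 1) ^ s)"
      using q1[of n] by (simp add: mult_le_cancel_left1)
    finally show ?thesis by (simp add: ennreal_leI)
  qed
  then have "emeasure M UNIV < \<infinity>"
    unfolding M_def emeasure_mixture[OF sets_T space_in_borel]
    using q1 by (intro suminf_moment_weight) auto
  moreover have "(\<integral>\<^sup>+r. ennreal (r ^ s) \<partial>M) < \<infinity>"
  proof -
    have "(\<integral>\<^sup>+r. ennreal (r ^ s) \<partial>T n) \<le> ennreal (measure \<rho> UNIV * (1 + (?q n + 1) ^ s))" for n
    proof -
      have "(\<integral>\<^sup>+r. ennreal (r ^ s) \<partial>T n) = (\<integral>\<^sup>+r. ennreal ((?q n + r) ^ s) \<partial>\<rho>)"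
        unfolding T_def by (rule nn_integral_distr[OF shift_meas]) simp
      also have "\<dots> \<le> (\<integral>\<^sup>+r. ennreal (1 + (?q n + 1) ^ s) \<partial>\<rho>)"
      proof (rule nn_integral_mono_AE)
        show "AE r in \<rho>. ennreal ((?q n + r) ^ s) \<le> ennreal (1 + (?q n + 1) ^ s)"
          using AE
        proof eventually_elim
          fix r assume "r \<in> R"
          then have "0 \<le> r" "r \<le> 1" using \<rho>(5) by auto
          then have "(?q n + r) ^ s \<le> (?q n + 1) ^ s"
            using positive_rational_pos[of n] by (intro power_mono) auto
          then show "ennreal ((?q n + r) ^ s) \<le> ennreal (1 + (?q n + 1) ^ s)"
            by (intro ennreal_leI) simp
        qed
      qed
      also have "\<dots> = ennreal (measure \<rho> UNIV * (1 + (?q n + 1) ^ s))"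
        using q1[of n] by (simp add: emeasure_eq_measure ennreal_mult mult.commute)
      finally show ?thesis .
    qed
    then have "(\<Sum>n. moment_weight s (?q n + 1) n * (\<integral>\<^sup>+r. ennreal (r ^ s) \<partial>T n)) < \<infinity>"
      using q1 by (intro suminf_moment_weight) auto
    then show ?thesis
      unfolding M_def by (subst nn_integral_mixture[OF sets_T]) simp_all
  qed
  moreover have "emeasure M {..0} = 0"
  proof (unfold M_def, intro emeasure_mixture_zero[OF sets_T] disjI2)
    fix n
    have "(\<lambda>r. ?q n + r) -` {..0} \<subseteq> - R"
    proof
      fix r assume "r \<in> (\<lambda>r. ?q n + r) -` {..0}"
      then have "r < 0" using positive_rational_pos[of n] by simp
      then show "r \<in> - R" using \<rho>(5) by force
    qed
    then have "emeasure \<rho> ((\<lambda>r. ?q n + r) -` {..0}) \<le> emeasure \<rho> (- R)"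
      using Rs \<rho>(1) by (intro emeasure_mono) auto
    then show "emeasure (T n) {..0} = 0" using \<rho>(6) by (simp add: T)
  qed simp
  moreover have "charges_intervals M"
    unfolding charges_intervals_def
  proof (intro allI impI)
    fix a b :: real assume ab: "0 \<le> a" "a < b"
    then obtain n where n: "a < ?q n" "?q n < b" by (rule positive_rational_dense)
    have "0 < emeasure \<rho> {0<..<b - ?q n}" using \<rho>(7) n by simp
    also have "\<dots> \<le> emeasure \<rho> ((\<lambda>r. ?q n + r) -` {a<..<b})"
      using n measurable_sets[OF shift_meas, of "{a<..<b}" "?q n"] by (intro emeasure_mono) auto
    finally show "0 < emeasure M {a<..<b}"
      unfolding M_def using q1 by (intro emeasure_mixture_pos[OF sets_T, where n = n])
        (auto simp: moment_weight_pos T)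
  qed
  moreover have "emeasure M {x} = 0" for x
  proof (unfold M_def, intro emeasure_mixture_zero[OF sets_T] disjI2)
    fix n
    have "(\<lambda>r. ?q n + r) -` {x} = {x - ?q n}" by auto
    then show "emeasure (T n) {x} = 0" using \<rho>(3) by (simp add: T)
  qed simp
  moreover have "(\<Union>n. (+) (?q n) ` R) \<in> null_sets lborel"
  proof (intro null_sets_UN)
    fix n
    have "(+) (?q n) ` R = {x. x - ?q n \<in> R}" by (force simp: image_iff)
    then show "(+) (?q n) ` R \<in> null_sets lborel" using null_sets_translation[OF \<rho>(4)] by simp
  qed
  moreover have "emeasure M (- (\<Union>n. (+) (?q n) ` R)) = 0"
  proof (unfold M_def, intro emeasure_mixture_zero[OF sets_T] disjI2)
    have "(\<Union>n. (+) (?q n) ` R) \<in> sets borel" using calculation(6) by auto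
    then show m: "- (\<Union>n. (+) (?q n) ` R) \<in> sets borel" by (rule borel_comp)
    fix n
    have "(\<lambda>r. ?q n + r) -` (- (\<Union>n. (+) (?q n) ` R)) \<subseteq> - R" by auto
    then have "emeasure \<rho> ((\<lambda>r. ?q n + r) -` (- (\<Union>n. (+) (?q n) ` R))) \<le> emeasure \<rho> (- R)"
      using Rs \<rho>(1) by (intro emeasure_mono) auto
    then show "emeasure (T n) (- (\<Union>n. (+) (?q n) ` R)) = 0" using \<rho>(6) m by (simp add: T)
  qed
  moreover have "sets M = sets borel" by (simp add: M_def)
  ultimately show ?thesis unfolding admissible_def by blast
qed

section \<open>Generators of radial measures\<close>

text \<open>Lebesgue measure of the set of \<open>z \<ge> 0\<close> in dimension \<open>k\<close>
  with coordinate sum at most \<open>c\<close>. In dimension 0 it is the indicator of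
  \<open>0 \<le> c\<close>, which starts the induction below.\<close>

definition simplex_volume :: "nat \<Rightarrow> real \<Rightarrow> real" where
  "simplex_volume k c = (if 0 \<le> c then c ^ k / fact k else 0)"

lemma simplex_volume_measurable [measurable]: "simplex_volume k \<in> borel_measurable borel"
  unfolding simplex_volume_def by measurable

lemma nn_integral_simplex_slice:
  "(\<integral>\<^sup>+y. indicator {a..} y * ennreal (simplex_volume k (c - y)) \<partial>lborel) = ennreal (simplex_volume (Suc k) (c - a))"
proof (cases "a \<le> c")
  case True
  have "(\<integral>\<^sup>+y. indicator {a..} y * ennreal (simplex_volume k (c - y)) \<partial>lborel) =
      (\<integral>\<^sup>+y. ennreal ((c - y) ^ k / fact k) * indicator {a..c} y \<partial>lborel)"
    by (intro nn_integral_cong) (auto simp: simplex_volume_def indicator_def)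
  also have "\<dots> = ennreal (- ((c - c) ^ Suc k / fact (Suc k)) - - ((c - a) ^ Suc k / fact (Suc k)))"
  proof (rule nn_integral_FTC_Icc)
    fix y
    have "((\<lambda>y. (c - y) ^ Suc k) has_real_derivative - (real (Suc k) * (c - y) ^ k)) (at y)"
      by (auto intro!: derivative_eq_intros simp del: power_Suc)
    from DERIV_minus[OF DERIV_cdivide[OF this, of "fact (Suc k)"]]
    have "((\<lambda>y. - ((c - y) ^ Suc k / fact (Suc k))) has_real_derivative
        real (Suc k) * (c - y) ^ k / fact (Suc k)) (at y)"
      by (simp only: minus_divide_left minus_minus)
    moreover have "real (Suc k) * (c - y) ^ k / fact (Suc k) = (c - y) ^ k / fact k"
      unfolding fact_Suc by (rule mult_divide_mult_cancel_left) simp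
    ultimately show "((\<lambda>y. - ((c - y) ^ Suc k / fact (Suc k))) has_real_derivative
        (c - y) ^ k / fact k) (at y)" by (simp only:)
  qed (use True in auto)
  finally show ?thesis using True by (simp add: simplex_volume_def)
next
  case False
  have "(\<integral>\<^sup>+y. indicator {a..} y * ennreal (simplex_volume k (c - y)) \<partial>lborel) = (\<integral>\<^sup>+y. 0 \<partial>(lborel :: real measure))"
    using False by (intro nn_integral_cong) (auto simp: simplex_volume_def indicator_def)
  then show ?thesis using False by (simp add: simplex_volume_def)
qed

interpretation lborels: product_sigma_finite "\<lambda>_::nat. lborel :: real measure"
  by standard

text \<open>Translating by \<open>a\<close> reduces this to a simplex of side \<open>c\<close> minus
  the sum of the \<open>a i\<close>. The parameter \<open>k\<close> is there for the induction:
  integrating out one coordinate raises it by one. With \<open>k = 0\<close> it is the volume of a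
  simplex cut by lower bounds.\<close>

lemma nn_integral_simplex:
  "(\<integral>\<^sup>+z. (\<Prod>i<n. indicator {a i..} (z i)) * ennreal (simplex_volume k (c - (\<Sum>i<n. z i))) \<partial>(\<Pi>\<^sub>M i\<in>{..<n}. lborel))
    = ennreal (simplex_volume (k + n) (c - (\<Sum>i<n. a i)))"
proof (induction n arbitrary: k c)
  case 0
  then show ?case by (simp add: PiM_empty)
next
  case (Suc n)
  have "(\<integral>\<^sup>+z. (\<Prod>i<Suc n. indicator {a i..} (z i)) * ennreal (simplex_volume k (c - (\<Sum>i<Suc n. z i)))
      \<partial>(\<Pi>\<^sub>M i\<in>{..<Suc n}. lborel)) =
    (\<integral>\<^sup>+z. (\<integral>\<^sup>+y. (\<Prod>i<Suc n. indicator {a i..} ((z(n := y)) i)) *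
       ennreal (simplex_volume k (c - (\<Sum>i<Suc n. (z(n := y)) i))) \<partial>lborel) \<partial>(\<Pi>\<^sub>M i\<in>{..<n}. lborel))"
    unfolding lessThan_Suc
    by (subst lborels.product_nn_integral_insert) (auto simp: lessThan_Suc[symmetric])
  also have "\<dots> = (\<integral>\<^sup>+z. (\<Prod>i<n. indicator {a i..} (z i)) *
      ennreal (simplex_volume (Suc k) ((c - a n) - (\<Sum>i<n. z i))) \<partial>(\<Pi>\<^sub>M i\<in>{..<n}. lborel))"
  proof (intro nn_integral_cong)
    fix z :: "nat \<Rightarrow> real"
    let ?P = "\<Prod>i<n. indicator {a i..} (z i) :: ennreal" and ?S = "\<Sum>i<n. z i"
    have "(\<Prod>i<n. indicator {a i..} ((z(n := y)) i)) = ?P" "(\<Sum>i<n. (z(n := y)) i) = ?S" for y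
      by (auto intro!: prod.cong sum.cong)
    then have "(\<integral>\<^sup>+y. (\<Prod>i<Suc n. indicator {a i..} ((z(n := y)) i)) *
       ennreal (simplex_volume k (c - (\<Sum>i<Suc n. (z(n := y)) i))) \<partial>lborel) =
      (\<integral>\<^sup>+y. ?P * (indicator {a n..} y * ennreal (simplex_volume k ((c - ?S) - y))) \<partial>lborel)"
      by (simp add: mult.assoc diff_diff_eq)
    also have "\<dots> = ?P * ennreal (simplex_volume (Suc k) ((c - ?S) - a n))"
      by (subst nn_integral_cmult) (auto simp: nn_integral_simplex_slice)
    also have "(c - ?S) - a n = (c - a n) - ?S" by simp
    finally show "(\<integral>\<^sup>+y. (\<Prod>i<Suc n. indicator {a i..} ((z(n := y)) i)) *
       ennreal (simplex_volume k (c - (\<Sum>i<Suc n. (z(n := y)) i))) \<partial>lborel) =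
       ?P * ennreal (simplex_volume (Suc k) ((c - a n) - ?S))" .
  qed
  also have "\<dots> = ennreal (simplex_volume (Suc k + n) ((c - a n) - (\<Sum>i<n. a i)))"
    by (rule Suc.IH)
  finally show ?case by (simp add: diff_diff_eq add.commute)
qed

lemma power_diff_le:
  fixes a b :: real
  assumes "0 \<le> b" "b \<le> a"
  shows "a ^ Suc n - b ^ Suc n \<le> real (Suc n) * (a - b) * a ^ n"
proof (induction n)
  case (Suc n)
  have "a ^ Suc (Suc n) - b ^ Suc (Suc n) = a * (a ^ Suc n - b ^ Suc n) + (a - b) * b ^ Suc n"
    by (simp add: algebra_simps)
  also have "\<dots> \<le> a * (real (Suc n) * (a - b) * a ^ n) + (a - b) * a ^ Suc n"
    using assms Suc.IH by (intro add_mono mult_left_mono power_mono) auto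
  also have "\<dots> = real (Suc (Suc n)) * (a - b) * a ^ Suc n"
    by (simp add: algebra_simps)
  finally show ?case .
qed simp

text \<open>Powers expand distances above 1. This is the source of the lower bound on the decrease
  of \<open>psi\<close>, as \<open>power_diff_le\<close> is the source of its Lipschitz
  bound.\<close>

lemma power_diff_ge:
  fixes a b :: real
  assumes "1 \<le> b" "b \<le> a"
  shows "a - b \<le> a ^ Suc n - b ^ Suc n"
proof (induction n)
  case (Suc n)
  have "a - b \<le> a ^ Suc n - b ^ Suc n" by (rule Suc.IH)
  also have "\<dots> \<le> a * (a ^ Suc n - b ^ Suc n)"
    using assms power_mono[of b a "Suc n"] by (intro mult_le_cancel_right1[THEN iffD2]) auto
  also have "\<dots> \<le> a * (a ^ Suc n - b ^ Suc n) + (a - b) * b ^ Suc n"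
    using assms by simp
  also have "\<dots> = a ^ Suc (Suc n) - b ^ Suc (Suc n)"
    by (simp add: algebra_simps)
  finally show ?case .
qed simp

section \<open>Generators, and the generator of a radial measure\<close>

lemma generator_range: "generator \<psi> \<Longrightarrow> 0 \<le> z \<Longrightarrow> 0 \<le> \<psi> z \<and> \<psi> z \<le> 1"
  unfolding generator_def by (simp add: image_subset_iff)

lemma generator_antimono:
  assumes "generator \<psi>" "0 \<le> x" "x \<le> y"
  shows "\<psi> y \<le> \<psi> x"
proof -
  have "antimono_on {0..} \<psi>" using assms(1) by (simp add: generator_def)
  from monotone_onD[OF this, of x y] assms show ?thesis by simp
qed

lemma generator_surj:
  assumes g: "generator \<psi>" and u: "0 < u" "u \<le> 1"
  obtains z where "0 \<le> z" "\<psi> z = u"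
proof -
  have lim: "(\<psi> \<longlongrightarrow> 0) at_top" and cont: "continuous_on {0..} \<psi>" and "\<psi> 0 = 1"
    using g by (simp_all add: generator_def)
  have "\<forall>\<^sub>F z in at_top. \<psi> z < u" using lim u(1) by (rule order_tendstoD)
  then have "\<forall>\<^sub>F z in at_top. \<psi> z < u \<and> 0 \<le> z"
    by (intro eventually_conj eventually_ge_at_top)
  then have "\<exists>b. \<psi> b < u \<and> 0 \<le> b"
    by (rule eventually_happens'[OF trivial_limit_at_top_linorder])
  then obtain b where b: "\<psi> b < u" "0 \<le> b" by blast
  have "\<exists>x\<ge>0. x \<le> b \<and> \<psi> x = u"
    using b u \<open>\<psi> 0 = 1\<close> continuous_on_subset[OF cont, of "{0..b}"] by (intro IVT2') simp_all
  then obtain x where "0 \<le> x" "\<psi> x = u" by blast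
  then show ?thesis by (rule that)
qed

text \<open>Here \<open>s\<close> stands for \<open>d - 1\<close>. Each of the three parts is itself
  \<open>admissible\<close>, so that every construction made for \<open>E\<close> can be repeated
  for a part.\<close>

locale radial =
  fixes s :: nat and E A D S :: "real measure"
  assumes s_pos: "1 \<le> s"
    and E_adm: "admissible s E" and A_adm: "admissible s A"
    and D_adm: "admissible s D" and S_adm: "admissible s S"
    and E_sum: "\<And>B. B \<in> sets borel \<Longrightarrow> emeasure E B = emeasure A B + emeasure D B + emeasure S B"
    and E_moment: "(\<integral>\<^sup>+r. ennreal (r ^ s) \<partial>E) = 1"
    and A_charges: "charges_intervals A" and D_charges: "charges_intervals D"
    and S_charges: "charges_intervals S"
    and A_ac: "absolutely_continuous lborel A"
    and D_disc: "\<exists>B. countable B \<and> emeasure D (- B) = 0"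
    and S_diffuse: "\<And>x. emeasure S {x} = 0"
    and S_null: "\<exists>Z\<in>null_sets lborel. emeasure S (- Z) = 0"
begin

lemma sets_E [simp, measurable_cong]: "sets E = sets borel"
  using E_adm by (simp add: admissible_def)

lemma space_E [simp]: "space E = UNIV"
  using sets_eq_imp_space_eq[OF sets_E] by simp

sublocale E: finite_measure E
  using E_adm by (intro finite_measureI) (auto simp: admissible_def)

lemma AE_E_pos: "AE r in E. 0 < r"
  by (rule AE_I[of _ _ "{..0}"]) (use E_adm in \<open>auto simp: admissible_def not_less\<close>)

text \<open>The inner \<open>max 0 z\<close> continues \<open>psi\<close> by its value at 0 to the
  negative axis, so that continuity, measurability and the Lipschitz bound hold on the whole
  line.\<close>

definition psi :: "real \<Rightarrow> real" where
  "psi z = (\<integral>r. (max 0 (r - max 0 z)) ^ s \<partial>E)"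

lemma nn_moment: "(\<integral>\<^sup>+r. ennreal ((max 0 r) ^ s) \<partial>E) = 1"
proof -
  have "(\<integral>\<^sup>+r. ennreal ((max 0 r) ^ s) \<partial>E) = (\<integral>\<^sup>+r. ennreal (r ^ s) \<partial>E)"
    by (intro nn_integral_cong_AE) (use AE_E_pos in eventually_elim, simp)
  then show ?thesis by (simp add: E_moment)
qed

lemma integrable_moment: "integrable E (\<lambda>r. (max 0 r) ^ s)"
  using nn_moment by (intro integrableI_nonneg) auto

lemma integrable_psi: "integrable E (\<lambda>r. (max 0 (r - max 0 z)) ^ s)"
  by (rule Bochner_Integration.integrable_bound[OF integrable_moment])
    (auto intro!: AE_I2 power_mono)

lemma ennreal_psi:
  assumes "0 \<le> z"
  shows "ennreal (psi z) = (\<integral>\<^sup>+r. ennreal ((max 0 (r - z)) ^ s) \<partial>E)"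
  using nn_integral_eq_integral[OF integrable_psi[of z]] assms by (simp add: psi_def)

lemma psi_nonneg: "0 \<le> psi z"
  by (simp add: psi_def)

lemma psi_0: "psi 0 = 1"
proof -
  have "ennreal (psi 0) = ennreal 1" using ennreal_psi[of 0] nn_moment by simp
  then show ?thesis using psi_nonneg[of 0] by (simp only: ennreal_inj zero_le_one)
qed

lemma psi_max: "psi (max 0 z) = psi z"
  by (simp add: psi_def)

lemma E_tail_pos: "0 \<le> c \<Longrightarrow> 0 < emeasure E {c..}"
proof -
  assume c: "0 \<le> c"
  have "0 < emeasure A {c<..<c+1}" using A_charges c by (simp add: charges_intervals_def)
  also have "\<dots> \<le> emeasure E {c<..<c+1}" by (subst E_sum) auto
  also have "\<dots> \<le> emeasure E {c..}" by (intro emeasure_mono) auto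
  finally show ?thesis .
qed

text \<open>For \<open>r \<ge> L + 1\<close> both \<open>r - x\<close> and \<open>r - y\<close> are
  at least 1, where the power expands distances; smaller \<open>r\<close> contribute something
  nonnegative. The bound gives strict monotonicity and, read backwards, a local Lipschitz constant
  for the inverse of \<open>psi\<close>.\<close>

lemma psi_decrease:
  assumes "0 \<le> x" "x \<le> y" "y \<le> L"
  shows "(y - x) * measure E {L + 1..} \<le> psi x - psi y"
proof -
  obtain n where n: "s = Suc n" using s_pos by (cases s) auto
  have "(y - x) * measure E {L + 1..} = (\<integral>r. (y - x) * indicator {L + 1..} r \<partial>E)"
    by simp
  also have "\<dots> \<le> (\<integral>r. (max 0 (r - max 0 x)) ^ s - (max 0 (r - max 0 y)) ^ s \<partial>E)"
  proof (rule integral_mono)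
    show "integrable E (\<lambda>r. (y - x) * indicator {L + 1..} r)"
      by (intro integrable_mult_right integrable_real_indicator) (auto simp: E.emeasure_finite less_top[symmetric])
    show "integrable E (\<lambda>r. (max 0 (r - max 0 x)) ^ s - (max 0 (r - max 0 y)) ^ s)"
      by (intro Bochner_Integration.integrable_diff integrable_psi)
    fix r
    show "(y - x) * indicator {L + 1..} r \<le> (max 0 (r - max 0 x)) ^ s - (max 0 (r - max 0 y)) ^ s"
    proof (cases "L + 1 \<le> r")
      case True
      then have "(r - x) - (r - y) \<le> (r - x) ^ Suc n - (r - y) ^ Suc n"
        using assms by (intro power_diff_ge) auto
      then show ?thesis using True assms by (simp add: n)
    next
      case False
      then show ?thesis using assms by (auto intro!: power_mono)
    qed
  qed
  also have "\<dots> = psi x - psi y"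
    unfolding psi_def by (intro Bochner_Integration.integral_diff integrable_psi)
  finally show ?thesis .
qed

lemma measure_tail_pos: "0 \<le> c \<Longrightarrow> 0 < measure E {c..}"
  using E_tail_pos[of c] by (simp add: E.emeasure_eq_measure)

lemma psi_strict: "0 \<le> x \<Longrightarrow> x < y \<Longrightarrow> psi y < psi x"
  using psi_decrease[of x y y] mult_pos_pos[OF _ measure_tail_pos, of "y - x" "y + 1"]
  by auto

lemma psi_less_iff: "0 \<le> x \<Longrightarrow> 0 \<le> y \<Longrightarrow> psi x < psi y \<longleftrightarrow> y < x"
  using psi_strict[of x y] psi_strict[of y x] by (cases x y rule: linorder_cases) auto

lemma psi_le_iff: "0 \<le> x \<Longrightarrow> 0 \<le> y \<Longrightarrow> psi x \<le> psi y \<longleftrightarrow> y \<le> x"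
  using psi_less_iff[of y x] by (simp add: not_less[symmetric])

lemma psi_pos: "0 < psi z"
proof -
  have "psi (max 0 z + 1) < psi (max 0 z)" by (intro psi_strict) auto
  then show ?thesis using psi_nonneg[of "max 0 z + 1"] by (simp add: psi_max)
qed

lemma psi_le_1: "psi z \<le> 1"
proof -
  have "psi (max 0 z) \<le> psi 0" by (subst psi_le_iff) auto
  then show ?thesis by (simp add: psi_0 psi_max)
qed

text \<open>The integrand has slope at most \<open>s * r ^ (s - 1)\<close> for positive
  \<open>r\<close>, which \<open>s * (1 + r ^ s)\<close> dominates; the latter is integrable by
  finiteness of mass and moment.\<close>

lemma psi_lipschitz:
  obtains K where "0 \<le> K" "\<And>x y. \<bar>psi x - psi y\<bar> \<le> K * \<bar>x - y\<bar>"
proof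
  obtain n where n: "s = Suc n" using s_pos by (cases s) auto
  define K where "K = (\<integral>r. real s * (1 + (max 0 r) ^ s) \<partial>E)"
  have int: "integrable E (\<lambda>r. real s * (1 + (max 0 r) ^ s))"
    by (intro integrable_mult_right Bochner_Integration.integrable_add integrable_moment) simp
  show "0 \<le> K" unfolding K_def by (intro Bochner_Integration.integral_nonneg) simp
  have key: "psi x - psi y \<le> K * (y - x)" if "0 \<le> x" "x \<le> y" for x y
  proof -
    have "psi x - psi y = (\<integral>r. (max 0 (r - max 0 x)) ^ s - (max 0 (r - max 0 y)) ^ s \<partial>E)"
      unfolding psi_def by (intro Bochner_Integration.integral_diff[symmetric] integrable_psi)
    also have "\<dots> \<le> (\<integral>r. real s * (1 + (max 0 r) ^ s) * (y - x) \<partial>E)"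
    proof (rule integral_mono)
      show "integrable E (\<lambda>r. (max 0 (r - max 0 x)) ^ s - (max 0 (r - max 0 y)) ^ s)"
        by (intro Bochner_Integration.integrable_diff integrable_psi)
      show "integrable E (\<lambda>r. real s * (1 + (max 0 r) ^ s) * (y - x))"
        by (intro integrable_mult_left int)
      fix r
      let ?a = "max 0 (r - x)" and ?b = "max 0 (r - y)"
      have "?a ^ Suc n - ?b ^ Suc n \<le> real (Suc n) * (?a - ?b) * ?a ^ n"
        using that by (intro power_diff_le) auto
      also have "\<dots> \<le> real (Suc n) * (y - x) * (1 + (max 0 r) ^ Suc n)"
      proof (intro mult_mono)
        show "?a - ?b \<le> y - x" using that by auto
        have "?a ^ n \<le> (max 0 r) ^ n" using that by (intro power_mono) auto
        also have "\<dots> \<le> 1 + (max 0 r) ^ Suc n"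
        proof (cases "max 0 r \<le> 1")
          case True
          then have "(max 0 r) ^ n \<le> 1" by (intro power_le_one) auto
          then show ?thesis by (smt (verit) max.cobounded1 zero_le_power)
        next
          case False
          then have "(max 0 r) ^ n \<le> (max 0 r) ^ Suc n" by (intro power_increasing) auto
          then show ?thesis by simp
        qed
        finally show "?a ^ n \<le> 1 + (max 0 r) ^ Suc n" .
      qed (use that in auto)
      finally show "(max 0 (r - max 0 x)) ^ s - (max 0 (r - max 0 y)) ^ s
          \<le> real s * (1 + (max 0 r) ^ s) * (y - x)"
        using that by (simp add: n mult_ac)
    qed
    also have "\<dots> = K * (y - x)" by (simp add: K_def)
    finally show ?thesis .
  qed
  have abs: "\<bar>psi x - psi y\<bar> \<le> K * \<bar>x - y\<bar>" if "0 \<le> x" "x \<le> y" for x y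
    using key[OF that] that psi_le_iff[of y x] by simp
  have abs': "\<bar>psi x - psi y\<bar> \<le> K * \<bar>x - y\<bar>" if "0 \<le> x" "0 \<le> y" for x y
  proof (cases "x \<le> y")
    case False
    then show ?thesis using abs[OF that(2), of x] by (simp add: abs_minus_commute)
  qed (use abs[OF that(1)] in blast)
  show "\<bar>psi x - psi y\<bar> \<le> K * \<bar>x - y\<bar>" for x y
  proof -
    have "\<bar>psi (max 0 x) - psi (max 0 y)\<bar> \<le> K * \<bar>max 0 x - max 0 y\<bar>"
      by (rule abs') simp_all
    also have "\<dots> \<le> K * \<bar>x - y\<bar>" using \<open>0 \<le> K\<close> by (intro mult_left_mono) auto
    finally show ?thesis by (simp add: psi_max)
  qed
qed

lemma isCont_psi: "isCont psi x"
proof -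
  obtain K where K: "0 \<le> K" "\<And>x y. \<bar>psi x - psi y\<bar> \<le> K * \<bar>x - y\<bar>" using psi_lipschitz by blast
  have "K-lipschitz_on UNIV psi" using K by (intro lipschitz_onI) (auto simp: dist_real_def)
  then have "continuous_on UNIV psi" by (rule lipschitz_on_continuous_on)
  then show ?thesis by (simp add: continuous_on_eq_continuous_at)
qed

lemma psi_measurable [measurable]: "psi \<in> borel_measurable borel"
  by (intro borel_measurable_continuous_onI continuous_at_imp_continuous_on) (simp add: isCont_psi)

lemma psi_at_top: "(psi \<longlongrightarrow> 0) at_top"
proof -
  have "((\<lambda>z. \<integral>r. (max 0 (r - max 0 z)) ^ s \<partial>E) \<longlongrightarrow> (\<integral>r. 0 \<partial>E)) at_top"
  proof (rule integral_dominated_convergence_at_top[where w = "\<lambda>r. (max 0 r) ^ s"])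
    show "\<forall>\<^sub>F z in at_top. AE r in E. norm (max 0 (r - max 0 z) ^ s) \<le> max 0 r ^ s"
      by (intro always_eventually allI AE_I2) (auto intro!: power_mono)
    show "AE r in E. ((\<lambda>z. max 0 (r - max 0 z) ^ s) \<longlongrightarrow> 0) at_top"
    proof (rule AE_I2)
      fix r :: real
      have "max 0 (r - max 0 z) ^ s = 0" if "z \<ge> r" for z
      proof -
        have "max 0 (r - max 0 z) = 0" using that by linarith
        then show ?thesis using s_pos by (simp only: power_eq_0_iff) simp
      qed
      then have "\<forall>\<^sub>F z in at_top. max 0 (r - max 0 z) ^ s = 0"
        unfolding eventually_at_top_linorder by blast
      then show "((\<lambda>z. max 0 (r - max 0 z) ^ s) \<longlongrightarrow> 0) at_top" by (rule tendsto_eventually)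
    qed
  qed (auto intro: integrable_moment)
  then show ?thesis unfolding psi_def[abs_def] by simp
qed

lemma generator_psi: "generator psi"
  unfolding generator_def
proof (intro conjI allI impI)
  show "psi ` {0..} \<subseteq> {0..1}" using psi_nonneg psi_le_1 by auto
  show "continuous_on {0..} psi" by (intro continuous_at_imp_continuous_on ballI isCont_psi)
  show "antimono_on {0..} psi" by (intro monotone_onI) (simp add: psi_le_iff)
  show "psi 0 = 1" "(psi \<longlongrightarrow> 0) at_top" by (rule psi_0 psi_at_top)+
  show "psi y < psi x" if "0 \<le> x \<and> x < y \<and> ennreal y < Inf (ennreal ` {z. 0 \<le> z \<and> psi z = 0})" for x y
    using that by (intro psi_strict) blast+
qed

lemma psi_surj:
  assumes "0 < u" "u \<le> 1"
  obtains z where "0 \<le> z" "psi z = u"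
  using generator_surj[OF generator_psi assms] by blast

text \<open>A real-valued inverse of \<open>psi\<close> on \<open>(0,1]\<close>, where the
  pseudo-inverse is finite. The default 0 elsewhere keeps it total, nonnegative and
  measurable.\<close>

definition phi :: "real \<Rightarrow> real" where
  "phi u = (if 0 < u \<and> u \<le> 1 then (THE z. 0 \<le> z \<and> psi z = u) else 0)"

lemma phi_psi:
  assumes "0 \<le> z"
  shows "phi (psi z) = z"
proof -
  have "y = z" if "0 \<le> y" "psi y = psi z" for y
    using psi_le_iff[OF that(1) assms] psi_le_iff[OF assms that(1)] that(2) by simp
  then have "(THE y. 0 \<le> y \<and> psi y = psi z) = z" using assms by (intro the_equality) auto
  then show ?thesis by (simp add: phi_def psi_pos psi_le_1)
qed

lemma psi_phi:
  assumes "0 < u" "u \<le> 1"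
  shows "psi (phi u) = u"
proof -
  obtain z where "0 \<le> z" "psi z = u" using psi_surj[OF assms] by blast
  then show ?thesis using phi_psi by auto
qed

lemma phi_nonneg: "0 \<le> phi u"
proof (cases "0 < u \<and> u \<le> 1")
  case True
  then obtain z where "0 \<le> z" "psi z = u" using psi_surj[of u] by blast
  then show ?thesis using phi_psi by auto
qed (auto simp: phi_def)

lemma phi_measurable [measurable]: "phi \<in> borel_measurable borel"
proof (rule borel_measurableI_le)
  fix c
  have "{x \<in> space borel. phi x \<le> c} = (if c < 0 then {} else {x. x \<le> 0 \<or> 1 < x \<or> psi c \<le> x})"
  proof (cases "c < 0")
    case True
    then have "\<not> phi x \<le> c" for x using phi_nonneg[of x] by linarith
    then show ?thesis using True by simp
  next
    case False
    have "phi x \<le> c \<longleftrightarrow> x \<le> 0 \<or> 1 < x \<or> psi c \<le> x" for x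
    proof (cases "0 < x \<and> x \<le> 1")
      case True
      then show ?thesis
        using psi_le_iff[of c "phi x"] \<open>\<not> c < 0\<close> phi_nonneg[of x] psi_phi[of x] by auto
    next
      case *: False
      then have "phi x = 0" unfolding phi_def by (rule if_not_P)
      then show ?thesis using * False by auto
    qed
    then show ?thesis using False by simp
  qed
  also have "\<dots> \<in> sets borel" by simp
  finally show "{x \<in> space borel. phi x \<le> c} \<in> sets borel" .
qed

end

section \<open>The copula of a radial measure\<close>

text \<open>Where \<open>\<psi>\<close> is positive it is strictly larger at every earlier point, so
  \<open>a\<close> is the first argument with its value.\<close>

lemma pseudo_inverse_generator:
  assumes g: "generator \<psi>" and a: "0 \<le> a" "0 < \<psi> a"
  shows "pseudo_inverse \<psi> (\<psi> a) = ennreal a"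
proof -
  have strict: "\<psi> a < \<psi> x" if x: "0 \<le> x" "x < a" for x
  proof -
    have "continuous_on {0..} \<psi>" using g by (simp add: generator_def)
    then have "(\<psi> \<longlongrightarrow> \<psi> a) (at a within {0..})" using a by (simp add: continuous_on_def)
    then have "\<forall>\<^sub>F y in at a within {0..}. 0 < \<psi> y" using a(2) by (rule order_tendstoD)
    then obtain e where e: "e > 0" "\<And>y. 0 \<le> y \<Longrightarrow> y \<noteq> a \<Longrightarrow> dist y a < e \<Longrightarrow> 0 < \<psi> y"
      unfolding eventually_at by auto
    \<comment> \<open>Strict decrease is granted only strictly before the first zero. Continuity
      gives a later point at which \<open>\<psi>\<close> is still positive, which puts
      \<open>a\<close> strictly before it.\<close>
    define b where "b = a + e / 2"
    have b: "a < b" "0 < \<psi> b" using e a by (auto simp: b_def dist_real_def)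
    have "ennreal a < ennreal b" using b a by (simp add: ennreal_lessI)
    also have "ennreal b \<le> Inf (ennreal ` {z. 0 \<le> z \<and> \<psi> z = 0})"
    proof (rule Inf_greatest)
      fix u assume "u \<in> ennreal ` {z. 0 \<le> z \<and> \<psi> z = 0}"
      then obtain z where z: "u = ennreal z" "0 \<le> z" "\<psi> z = 0" by blast
      have "b \<le> z"
      proof (rule ccontr)
        assume "\<not> b \<le> z"
        then have "\<psi> b \<le> \<psi> z" using z by (intro generator_antimono[OF g]) auto
        then show False using z b by simp
      qed
      then show "ennreal b \<le> u" using z by (simp add: ennreal_leI)
    qed
    finally show ?thesis using g x unfolding generator_def by blast
  qed
  show ?thesis
    unfolding pseudo_inverse_def
  proof (rule antisym)
    have "gen_ext \<psi> (ennreal a) = \<psi> a" using a by (simp add: gen_ext_def)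
    then show "Inf {z. gen_ext \<psi> z = \<psi> a} \<le> ennreal a" by (intro Inf_lower) simp
    show "ennreal a \<le> Inf {z. gen_ext \<psi> z = \<psi> a}"
    proof (rule Inf_greatest)
      fix z assume "z \<in> {z. gen_ext \<psi> z = \<psi> a}"
      then have z: "gen_ext \<psi> z = \<psi> a" by simp
      then have "z \<noteq> \<infinity>" using a by (auto simp: gen_ext_def)
      then obtain x where x: "z = ennreal x" "0 \<le> x" by (cases z) auto
      then have "\<psi> x = \<psi> a" using z by (simp add: gen_ext_def)
      then have "a \<le> x" using strict[of x] x by (cases "x < a") auto
      then show "ennreal a \<le> z" using x by (simp add: ennreal_leI)
    qed
  qed
qed

lemma gen_ext_sum_pseudo_inverse:
  assumes g: "generator \<psi>" and a: "\<And>i. i \<in> I \<Longrightarrow> 0 \<le> a i \<and> 0 < \<psi> (a i)"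
  shows "gen_ext \<psi> (\<Sum>i\<in>I. pseudo_inverse \<psi> (\<psi> (a i))) = \<psi> (\<Sum>i\<in>I. a i)"
proof -
  have "(\<Sum>i\<in>I. pseudo_inverse \<psi> (\<psi> (a i))) = (\<Sum>i\<in>I. ennreal (a i))"
    by (intro sum.cong refl pseudo_inverse_generator[OF g]) (use a in auto)
  also have "\<dots> = ennreal (\<Sum>i\<in>I. a i)" using a by (intro sum_ennreal) auto
  finally show ?thesis using a by (simp add: gen_ext_def sum_nonneg)
qed

lemma prod_indicator_eq:
  "(\<Prod>i<(n::nat). indicator (X i) (z i)) = (if \<forall>i<n. z i \<in> X i then 1 else 0 :: ennreal)"
  by (induction n) (auto simp: less_Suc_eq indicator_def)

context radial begin

abbreviation "Z \<equiv> \<Pi>\<^sub>M i\<in>{..<s}. (lborel :: real measure)"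

text \<open>The factor \<open>fact s\<close> cancels the one in the volume
  \<open>r ^ s / fact s\<close> of the simplex, so that the total mass is the moment of
  \<open>E\<close>, which is 1.\<close>

definition wt :: "(nat \<Rightarrow> real) \<Rightarrow> real \<Rightarrow> ennreal" where
  "wt z r = ennreal (fact s) * ((\<Prod>i<s. indicator {0..} (z i)) * indicator {0..} (r - (\<Sum>i<s. z i)))"

definition T :: "(nat \<Rightarrow> real) \<Rightarrow> real \<Rightarrow> nat \<Rightarrow> real" where
  "T z r = (\<lambda>i\<in>{..<Suc s}. psi (if i < s then z i else r - (\<Sum>j<s. z j)))"

text \<open>The measure \<open>\<theta>\<close> varies while the map \<open>T\<close> is always
  built from the generator of \<open>E\<close>: for \<open>E\<close> this is the copula measure, for
  \<open>A\<close>, \<open>D\<close> and \<open>S\<close> it will be the three kernel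
  measures.\<close>

definition Q :: "real measure \<Rightarrow> (nat \<Rightarrow> real) measure" where
  "Q \<theta> = distr (density (Z \<Otimes>\<^sub>M \<theta>) (\<lambda>(z, r). wt z r)) (cube_borel (Suc s)) (\<lambda>(z, r). T z r)"

lemma sets_Q [simp, measurable_cong]: "sets (Q \<theta>) = sets (cube_borel (Suc s))"
  by (simp add: Q_def)

lemma space_Q [simp]: "space (Q \<theta>) = cube (Suc s)"
  by (simp add: Q_def space_cube_borel)

lemma T_cube: "T z r \<in> cube (Suc s)"
  by (simp add: T_def cube_iff psi_nonneg psi_le_1)

lemma psi_unit_borel: "f \<in> borel_measurable M \<Longrightarrow> (\<lambda>x. psi (f x)) \<in> M \<rightarrow>\<^sub>M unit_borel"
  by (intro measurable_restrict_space2) (auto simp: psi_nonneg psi_le_1)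

lemma coord_borel: "i < s \<Longrightarrow> (\<lambda>z. z i) \<in> borel_measurable Z"
  using measurable_component_singleton[of i "{..<s}" "\<lambda>_. lborel :: real measure"] by simp

lemma sum_borel: "(\<lambda>z. \<Sum>i<s. z i) \<in> borel_measurable Z"
  by (intro borel_measurable_sum coord_borel) simp

lemma fst_coord: "i < s \<Longrightarrow> (\<lambda>x. fst x i) \<in> borel_measurable (Z \<Otimes>\<^sub>M M)"
  by (rule measurable_compose[OF measurable_fst coord_borel])

lemma fst_sum: "(\<lambda>x. \<Sum>i<s. fst x i) \<in> borel_measurable (Z \<Otimes>\<^sub>M M)"
  by (rule measurable_compose[OF measurable_fst sum_borel])

lemma T_measurable:
  assumes [measurable_cong]: "sets M = sets borel"
  shows "(\<lambda>(z, r). T z r) \<in> Z \<Otimes>\<^sub>M M \<rightarrow>\<^sub>M cube_borel (Suc s)"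
  unfolding T_def split_beta' cube_borel_def
proof (intro measurable_restrict psi_unit_borel)
  fix i assume "i \<in> {..<Suc s}"
  have "snd \<in> borel_measurable (Z \<Otimes>\<^sub>M M)" by measurable
  then show "(\<lambda>x. if i < s then fst x i else snd x - (\<Sum>j<s. fst x j)) \<in> borel_measurable (Z \<Otimes>\<^sub>M M)"
    using fst_coord[of i M] fst_sum[of M] by (cases "i < s") simp_all
qed

lemma wt_measurable:
  assumes [measurable_cong]: "sets M = sets borel"
  shows "(\<lambda>(z, r). wt z r) \<in> borel_measurable (Z \<Otimes>\<^sub>M M)"
  unfolding wt_def split_beta'
proof (intro borel_measurable_times_ennreal borel_measurable_prod_ennreal borel_measurable_const)
  show "(\<lambda>x. indicator {0..} (fst x i) :: ennreal) \<in> borel_measurable (Z \<Otimes>\<^sub>M M)" if "i \<in> {..<s}" for i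
    by (rule measurable_compose[OF fst_coord]) (use that in auto)
  have "snd \<in> borel_measurable (Z \<Otimes>\<^sub>M M)" by measurable
  then have "(\<lambda>x. snd x - (\<Sum>i<s. fst x i)) \<in> borel_measurable (Z \<Otimes>\<^sub>M M)"
    using fst_sum[of M] by simp
  then show "(\<lambda>x. indicator {0..} (snd x - (\<Sum>i<s. fst x i)) :: ennreal) \<in> borel_measurable (Z \<Otimes>\<^sub>M M)"
    by (rule measurable_compose) simp
qed

lemma admissible_sets: "admissible s \<theta> \<Longrightarrow> sets \<theta> = sets borel"
  by (simp add: admissible_def)

lemma admissible_finite_measure: "admissible s \<theta> \<Longrightarrow> finite_measure \<theta>"
  using sets_eq_imp_space_eq[of \<theta> borel] by (intro finite_measureI) (auto simp: admissible_def)

lemma integrand_measurable: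
  assumes "sets M = sets borel" "f \<in> borel_measurable (cube_borel (Suc s))"
  shows "(\<lambda>(z, r). wt z r * f (T z r)) \<in> borel_measurable (Z \<Otimes>\<^sub>M M)"
  using borel_measurable_times_ennreal[OF wt_measurable[OF assms(1)] measurable_compose[OF T_measurable[OF assms(1)] assms(2)]]
  by (simp add: split_beta')

lemma nn_integral_Q:
  assumes \<theta>: "admissible s \<theta>" and f: "f \<in> borel_measurable (cube_borel (Suc s))"
  shows "(\<integral>\<^sup>+x. f x \<partial>Q \<theta>) = (\<integral>\<^sup>+z. (\<integral>\<^sup>+r. wt z r * f (T z r) \<partial>\<theta>) \<partial>Z)"
proof -
  interpret finite_measure \<theta> by (rule admissible_finite_measure[OF \<theta>])
  note s = admissible_sets[OF \<theta>]
  have "(\<integral>\<^sup>+x. f x \<partial>Q \<theta>) = (\<integral>\<^sup>+x. f (case x of (z, r) \<Rightarrow> T z r) \<partial>density (Z \<Otimes>\<^sub>M \<theta>) (\<lambda>(z, r). wt z r))"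
    unfolding Q_def using T_measurable[OF s] f by (intro nn_integral_distr) simp_all
  also have "\<dots> = (\<integral>\<^sup>+x. (case x of (z, r) \<Rightarrow> wt z r) * f (case x of (z, r) \<Rightarrow> T z r) \<partial>(Z \<Otimes>\<^sub>M \<theta>))"
    using measurable_compose[OF T_measurable[OF s] f]
    by (intro nn_integral_density wt_measurable[OF s]) simp
  also have "\<dots> = (\<integral>\<^sup>+x. (case x of (z, r) \<Rightarrow> wt z r * f (T z r)) \<partial>(Z \<Otimes>\<^sub>M \<theta>))"
    by (simp add: split_beta')
  also have "\<dots> = (\<integral>\<^sup>+z. (\<integral>\<^sup>+r. wt z r * f (T z r) \<partial>\<theta>) \<partial>Z)"
    using nn_integral_fst[OF integrand_measurable[OF s f]] by simp
  finally show ?thesis .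
qed

lemma emeasure_Q:
  assumes "admissible s \<theta>" "B \<in> sets (cube_borel (Suc s))"
  shows "emeasure (Q \<theta>) B = (\<integral>\<^sup>+z. (\<integral>\<^sup>+r. wt z r * indicator B (T z r) \<partial>\<theta>) \<partial>Z)"
  using nn_integral_Q[OF assms(1) borel_measurable_indicator[OF assms(2)]] assms(2)
  by (simp only: nn_integral_indicator sets_Q)

text \<open>As \<open>psi\<close> decreases, the box becomes \<open>z i \<ge> a i\<close> for all
  \<open>i < s\<close> and \<open>r - \<Sum>z \<ge> a s\<close>. With the order of integration
  exchanged, the inner integral over \<open>z\<close> at fixed \<open>r\<close> is the volume of a
  simplex whose side is \<open>r\<close> minus the sum of all \<open>a i\<close>, and integrating
  over \<open>r\<close> gives back \<open>psi\<close>.\<close>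

lemma Q_lower_box:
  assumes a: "\<And>i. 0 \<le> a i"
  shows "emeasure (Q E) {y \<in> cube (Suc s). \<forall>i<Suc s. y i \<le> psi (a i)} = ennreal (psi (\<Sum>i<Suc s. a i))"
proof -
  let ?B = "{y \<in> cube (Suc s). \<forall>i<Suc s. y i \<le> psi (a i)}"
  have B: "?B \<in> sets (cube_borel (Suc s))" by (rule sets_lower_box)
  have eq: "wt z r * indicator ?B (T z r) =
      ennreal (fact s) * ((\<Prod>i<s. indicator {a i..} (z i)) * ennreal (simplex_volume 0 ((r - a s) - (\<Sum>i<s. z i))))" for z r
  proof (cases "(\<forall>i<s. 0 \<le> z i) \<and> 0 \<le> r - (\<Sum>i<s. z i)")
    case True
    have "T z r \<in> ?B \<longleftrightarrow> (\<forall>i<s. a i \<le> z i) \<and> a s \<le> r - (\<Sum>i<s. z i)"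
      using True a T_cube[of z r] by (simp add: T_def All_less_Suc psi_le_iff conj_commute)
    then show ?thesis using True by (auto simp: wt_def prod_indicator_eq simplex_volume_def indicator_def)
  next
    case False
    then have "wt z r = 0" by (auto simp: wt_def prod_indicator_eq indicator_def)
    moreover have "\<not> ((\<forall>i<s. a i \<le> z i) \<and> a s \<le> r - (\<Sum>i<s. z i))"
      using False a by (meson order_trans)
    ultimately show ?thesis by (auto simp: prod_indicator_eq simplex_volume_def indicator_def)
  qed
  have "emeasure (Q E) ?B = (\<integral>\<^sup>+z. (\<integral>\<^sup>+r. wt z r * indicator ?B (T z r) \<partial>E) \<partial>Z)"
    by (rule emeasure_Q[OF E_adm B])
  also have "\<dots> = (\<integral>\<^sup>+r. (\<integral>\<^sup>+z. wt z r * indicator ?B (T z r) \<partial>Z) \<partial>E)"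
  proof (rule pair_sigma_finite.Fubini'[symmetric])
    show "pair_sigma_finite Z E"
      by (rule pair_sigma_finite.intro[OF lborels.sigma_finite[OF finite_lessThan] E.sigma_finite_measure_axioms])
    show "(\<lambda>(z, r). wt z r * indicator ?B (T z r)) \<in> borel_measurable (Z \<Otimes>\<^sub>M E)"
      by (rule integrand_measurable[OF sets_E borel_measurable_indicator[OF B]])
  qed
  also have "\<dots> = (\<integral>\<^sup>+r. ennreal ((max 0 (r - (\<Sum>i<Suc s. a i))) ^ s) \<partial>E)"
  proof (rule nn_integral_cong)
    fix r
    have "(\<integral>\<^sup>+z. wt z r * indicator ?B (T z r) \<partial>Z) = ennreal (fact s) * ennreal (simplex_volume (0 + s) ((r - a s) - (\<Sum>i<s. a i)))"
      unfolding eq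
    proof (subst nn_integral_cmult)
      show "(\<lambda>z. (\<Prod>i<s. indicator {a i..} (z i)) * ennreal (simplex_volume 0 ((r - a s) - (\<Sum>i<s. z i)))) \<in> borel_measurable Z"
      proof (intro borel_measurable_times_ennreal borel_measurable_prod_ennreal)
        show "(\<lambda>z. indicator {a i..} (z i) :: ennreal) \<in> borel_measurable Z" if "i \<in> {..<s}" for i
          by (rule measurable_compose[OF coord_borel]) (use that in auto)
        have "(\<lambda>z. (r - a s) - (\<Sum>i<s. z i)) \<in> borel_measurable Z" using sum_borel by simp
        then show "(\<lambda>z. ennreal (simplex_volume 0 ((r - a s) - (\<Sum>i<s. z i)))) \<in> borel_measurable Z"
          by (rule measurable_compose) simp
      qed
    qed (simp only: nn_integral_simplex)
    also have "\<dots> = ennreal ((max 0 (r - (\<Sum>i<Suc s. a i))) ^ s)"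
      using s_pos by (simp add: simplex_volume_def ennreal_mult'[symmetric] algebra_simps max_def power_0_left)
    finally show "(\<integral>\<^sup>+z. wt z r * indicator ?B (T z r) \<partial>Z) = ennreal ((max 0 (r - (\<Sum>i<Suc s. a i))) ^ s)" .
  qed
  also have "\<dots> = ennreal (psi (\<Sum>i<Suc s. a i))"
    using a by (intro ennreal_psi[symmetric] sum_nonneg) auto
  finally show ?thesis .
qed

sublocale QE: prob_space "Q E"
proof
  have "{y \<in> cube (Suc s). \<forall>i<Suc s. y i \<le> psi 0} = cube (Suc s)"
    using cube_nth by (auto simp: psi_0)
  then show "emeasure (Q E) (space (Q E)) = 1"
    using Q_lower_box[of "\<lambda>_. 0"] by (simp add: psi_0)
qed

definition cop :: "(nat \<Rightarrow> real) \<Rightarrow> real" where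
  "cop = (\<lambda>x\<in>cube (Suc s). measure (Q E) {y \<in> cube (Suc s). \<forall>i<Suc s. y i \<le> x i})"

lemma has_distribution_function_cop: "has_distribution_function (Suc s) (Q E) cop"
  unfolding has_distribution_function_def by (simp add: cop_def QE.prob_space_axioms)

text \<open>Points of the cube with a coordinate 0 are out of reach of \<open>Q_lower_box\<close>
  because \<open>psi\<close> is positive; for the same reason they carry no mass.\<close>

lemma Q_face:
  assumes i: "i < Suc s"
  shows "emeasure (Q E) {y \<in> cube (Suc s). y i \<le> 0} = 0"
proof -
  have B: "{y \<in> cube (Suc s). y i \<le> 0} \<in> sets (cube_borel (Suc s))"
    using borel_measurable_le[OF borel_measurable_cube_nth[OF i] borel_measurable_const, of 0]
    by (simp add: space_cube_borel)
  have "T z r i > 0" for z r using i by (simp add: T_def psi_pos)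
  then have "indicator {y \<in> cube (Suc s). y i \<le> 0} (T z r) = (0 :: ennreal)" for z r
    by (simp add: not_le indicator_def)
  then show ?thesis by (subst emeasure_Q[OF E_adm B]) simp
qed

lemma Q_margin:
  assumes i: "i < Suc s" and t: "0 \<le> t" "t \<le> 1"
  shows "emeasure (Q E) {y \<in> cube (Suc s). y i \<le> t} = ennreal t"
proof (cases "t = 0")
  case True
  then show ?thesis using Q_face[OF i] by simp
next
  case False
  \<comment> \<open>Since \<open>psi 0 = 1\<close>, the argument 0 leaves the other coordinates
    unconstrained and adds nothing to the sum.\<close>
  define a where "a = (\<lambda>j. if j = i then phi t else 0)"
  have "{y \<in> cube (Suc s). y i \<le> t} = {y \<in> cube (Suc s). \<forall>j<Suc s. y j \<le> psi (a j)}"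
  proof (intro Collect_cong conj_cong refl iffI)
    fix y assume y: "y \<in> cube (Suc s)"
    show "\<forall>j<Suc s. y j \<le> psi (a j)" if "y i \<le> t"
      using that t False cube_nth[OF y] by (simp add: a_def psi_phi psi_0)
    show "y i \<le> t" if "\<forall>j<Suc s. y j \<le> psi (a j)"
      using that i t False psi_phi[of t] by (auto simp: a_def)
  qed
  then have "emeasure (Q E) {y \<in> cube (Suc s). y i \<le> t} = ennreal (psi (\<Sum>j<Suc s. a j))"
    using Q_lower_box[of a] phi_nonneg by (simp add: a_def)
  also have "(\<Sum>j<Suc s. a j) = phi t" unfolding a_def using i by (subst sum.delta) auto
  finally show ?thesis using t False by (simp add: psi_phi)
qed

lemma Q_margin_lborel:
  assumes i: "i < Suc s"
  shows "distr (Q E) unit_borel (\<lambda>x. x i) = unit_lborel"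
proof (rule measure_eqI_unit_borel)
  have m: "(\<lambda>x. x i) \<in> Q E \<rightarrow>\<^sub>M unit_borel" using measurable_cube_nth[OF i] by simp
  show "finite_measure (distr (Q E) unit_borel (\<lambda>x. x i))" by (rule QE.finite_measure_distr[OF m])
  show "finite_measure unit_lborel"
    by (intro finite_measureI) (simp add: emeasure_restrict_space space_restrict_space)
  fix q :: real
  have "emeasure (distr (Q E) unit_borel (\<lambda>x. x i)) ({..q} \<inter> {0..1}) = emeasure (Q E) {y \<in> cube (Suc s). y i \<le> q}"
    using cube_nth i by (subst emeasure_distr[OF m])
      (auto simp: sets_unit_borel_iff intro!: arg_cong[where f = "emeasure (Q E)"])
  also have "\<dots> = emeasure unit_lborel ({..q} \<inter> {0..1})"
  proof -
    consider "q < 0" | "0 \<le> q" "q \<le> 1" | "1 < q" by linarith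
    then show ?thesis
    proof cases
      case 1
      then have "\<not> y i \<le> q" if "y \<in> cube (Suc s)" for y using cube_nth[OF that i] by simp
      then have "{y \<in> cube (Suc s). y i \<le> q} = {}" by blast
      moreover have "{..q} \<inter> {0..1} = {}" using 1 by auto
      ultimately show ?thesis by (simp only: emeasure_empty)
    next
      case 2
      then have "{..q} \<inter> {0..1} = {0..q}" by auto
      then show ?thesis using 2 Q_margin[OF i 2] by (simp add: emeasure_restrict_space)
    next
      case 3
      then have "y i \<le> q" if "y \<in> cube (Suc s)" for y using cube_nth[OF that i] by simp
      then have "{y \<in> cube (Suc s). y i \<le> q} = space (Q E)" by auto
      moreover have "{..q} \<inter> {0..1} = {0..1}" using 3 by auto
      ultimately show ?thesis by (simp only: QE.emeasure_space_1) (simp add: emeasure_restrict_space)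
    qed
  qed
  finally show "emeasure (distr (Q E) unit_borel (\<lambda>x. x i)) ({..q} \<inter> {0..1}) = emeasure unit_lborel ({..q} \<inter> {0..1})" .
qed simp_all

lemma cop_copula: "cop \<in> copulas (Suc s)"
  unfolding copulas_def using has_distribution_function_cop Q_margin_lborel by (auto simp: cop_def)

lemma cop_gen_ext:
  assumes x: "x \<in> cube (Suc s)"
  shows "cop x = gen_ext psi (\<Sum>i<Suc s. pseudo_inverse psi (x i))"
proof (cases "\<forall>i<Suc s. 0 < x i")
  case True
  have ph: "psi (phi (x i)) = x i" if "i < Suc s" for i
    using True cube_nth[OF x that] that by (intro psi_phi) auto
  have "cop x = measure (Q E) {y \<in> cube (Suc s). \<forall>i<Suc s. y i \<le> psi (phi (x i))}"
    using x ph by (simp add: cop_def)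
  also have "\<dots> = psi (\<Sum>i<Suc s. phi (x i))"
    by (simp only: measure_def Q_lower_box phi_nonneg enn2real_ennreal psi_nonneg)
  also have "\<dots> = gen_ext psi (\<Sum>i<Suc s. pseudo_inverse psi (psi (phi (x i))))"
    by (rule gen_ext_sum_pseudo_inverse[symmetric, OF generator_psi]) (auto simp: phi_nonneg psi_pos)
  also have "\<dots> = gen_ext psi (\<Sum>i<Suc s. pseudo_inverse psi (x i))"
    by (intro arg_cong[where f = "gen_ext psi"] sum.cong refl) (simp add: ph)
  finally show ?thesis .
next
  case False
  then obtain i where i: "i < Suc s" "x i = 0" using cube_nth[OF x] by force
  have "emeasure (Q E) {y \<in> cube (Suc s). \<forall>i<Suc s. y i \<le> x i} \<le> emeasure (Q E) {y \<in> cube (Suc s). y i \<le> 0}"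
    using i borel_measurable_le[OF borel_measurable_cube_nth[OF i(1)] borel_measurable_const, of 0]
    by (intro emeasure_mono) (auto simp: space_cube_borel)
  then have "cop x = 0" using x Q_face[OF i(1)] by (simp add: cop_def measure_def)
  \<comment> \<open>A positive \<open>psi\<close> reaches 0 only at infinity, so one zero coordinate
    makes the sum of the pseudo-inverses infinite and both sides vanish.\<close>
  have "gen_ext psi z = 0 \<Longrightarrow> z = \<infinity>" for z
    using psi_pos[of "enn2real z"] by (simp add: gen_ext_def split: if_splits)
  then have "\<infinity> \<le> pseudo_inverse psi (x i)"
    unfolding pseudo_inverse_def i by (intro Inf_greatest) auto
  also have "\<dots> \<le> (\<Sum>i<Suc s. pseudo_inverse psi (x i))" using i by (intro member_le_sum) auto
  finally show ?thesis using \<open>cop x = 0\<close> by (simp add: gen_ext_def top_unique)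
qed

lemma cop_archimedean: "cop \<in> archimedean_copulas (Suc s)"
  unfolding archimedean_copulas_def
  by (intro CollectI conjI cop_copula exI[of _ psi] generator_psi ballI cop_gen_ext)

end

section \<open>The conditional kernel and its decomposition\<close>

lemma negligible_null_sets_lborel:
  "B \<in> sets borel \<Longrightarrow> negligible B \<longleftrightarrow> B \<in> null_sets (lborel :: real measure)"
  by (auto simp: negligible_iff_null_sets null_sets_def)

context radial begin

lemma copula_measure_cop: "copula_measure (Suc s) cop = Q E"
  by (rule copula_measure_eq[OF has_distribution_function_cop])

section \<open>The law of the first coordinates and the conditional kernel\<close>

definition marg :: "(nat \<Rightarrow> real) measure" where
  "marg = distr (Q E) (cube_borel s) (\<lambda>x. restrict x {..<s})"

lemma sets_marg [simp, measurable_cong]: "sets marg = sets (cube_borel s)"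
  by (simp add: marg_def)

lemma space_marg [simp]: "space marg = cube s"
  by (simp add: marg_def space_cube_borel)

lemma measurable_front: "(\<lambda>x. restrict x {..<s}) \<in> cube_borel (Suc s) \<rightarrow>\<^sub>M cube_borel s"
  unfolding cube_borel_def by (rule measurable_restrict_subset) auto

lemma measurable_front_Q: "(\<lambda>x. restrict x {..<s}) \<in> Q \<theta> \<rightarrow>\<^sub>M cube_borel s"
  using measurable_front by (simp cong: measurable_cong_sets)

sublocale marg: prob_space marg
  unfolding marg_def by (rule QE.prob_space_distr[OF measurable_front_Q])

lemma marginal_measure_cop: "marginal_measure (Suc s) cop = marg"
  unfolding marginal_measure_def
proof (rule copula_measure_eq)
  have "measure marg {y \<in> cube s. \<forall>i<s. y i \<le> x i} = marginal (Suc s) cop x" if x: "x \<in> cube s" for x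
  proof -
    have upd: "x(s := 1) \<in> cube (Suc s)"
      using x by (auto simp: cube_iff extensional_def less_Suc_eq)
    have "{y \<in> cube s. \<forall>i<s. y i \<le> x i} \<in> sets (cube_borel s)" by (rule sets_lower_box)
    then have "measure marg {y \<in> cube s. \<forall>i<s. y i \<le> x i} =
        measure (Q E) ((\<lambda>y. restrict y {..<s}) -` {y \<in> cube s. \<forall>i<s. y i \<le> x i} \<inter> space (Q E))"
      unfolding marg_def by (rule measure_distr[OF measurable_front_Q])
    also have "(\<lambda>y. restrict y {..<s}) -` {y \<in> cube s. \<forall>i<s. y i \<le> x i} \<inter> space (Q E) =
        {y \<in> cube (Suc s). \<forall>i<Suc s. y i \<le> (x(s := 1)) i}"
      by (rule set_eqI) (simp add: cube_iff All_less_Suc, blast)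
    also have "measure (Q E) \<dots> = cop (x(s := 1))" using upd by (simp add: cop_def)
    also have "\<dots> = marginal (Suc s) cop x" using x by (simp add: marginal_def)
    finally show ?thesis .
  qed
  then show "has_distribution_function (Suc s - 1) marg (marginal (Suc s) cop)"
    unfolding has_distribution_function_def by (simp add: marg.prob_space_axioms)
qed

text \<open>The point at which \<open>E\<close> is truncated: for \<open>x i = psi (z i)\<close>
  with \<open>z i \<ge> 0\<close> it recovers the sum of the \<open>z i\<close>.\<close>

definition \<sigma> :: "(nat \<Rightarrow> real) \<Rightarrow> real" where
  "\<sigma> x = (\<Sum>i<s. phi (x i))"

lemma \<sigma>_nonneg: "0 \<le> \<sigma> x"
  by (simp add: \<sigma>_def phi_nonneg sum_nonneg)

lemma \<sigma>_measurable: "\<sigma> \<in> borel_measurable (cube_borel s)"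
  unfolding \<sigma>_def
  by (intro borel_measurable_sum measurable_compose[OF borel_measurable_cube_nth phi_measurable]) simp

text \<open>Preimage of \<open>F\<close> under the last coordinate, as a function of
  \<open>r\<close> when the others have sum \<open>c\<close>. The condition \<open>c \<le> r\<close>
  removes the half line on which \<open>psi (r - c)\<close> is constantly 1.\<close>

definition W :: "real \<Rightarrow> real set \<Rightarrow> real set" where
  "W c F = {r. c \<le> r \<and> psi (r - c) \<in> F}"

lemma W_measurable: "F \<in> sets borel \<Longrightarrow> W c F \<in> sets borel"
proof -
  assume F: "F \<in> sets borel"
  have "(\<lambda>r. psi (r - c)) -` F \<inter> space borel \<in> sets borel"
    by (rule measurable_sets[OF _ F]) measurable
  then have "{c..} \<inter> (\<lambda>r. psi (r - c)) -` F \<in> sets borel" by auto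
  then show ?thesis by (simp add: W_def Int_def vimage_def)
qed

lemma W_all: "W c {0..1} = {c..}"
  by (auto simp: W_def psi_nonneg psi_le_1)

lemma emeasure_W_measurable:
  assumes \<theta>: "admissible s \<theta>" and F: "F \<in> sets borel"
  shows "(\<lambda>c. emeasure \<theta> (W c F)) \<in> borel_measurable borel"
proof -
  interpret finite_measure \<theta> by (rule admissible_finite_measure[OF \<theta>])
  note [measurable_cong] = admissible_sets[OF \<theta>]
  have 1: "(\<lambda>x. psi (snd x - fst x)) \<in> borel \<Otimes>\<^sub>M \<theta> \<rightarrow>\<^sub>M borel" by measurable
  have 2: "{x \<in> space (borel \<Otimes>\<^sub>M \<theta>). fst x \<le> snd x} \<in> sets (borel \<Otimes>\<^sub>M \<theta>)" by measurable
  have sp: "space \<theta> = UNIV" using sets_eq_imp_space_eq[OF admissible_sets[OF \<theta>]] by simp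
  have "{x. fst x \<le> snd x \<and> psi (snd x - fst x) \<in> F} =
      {x \<in> space (borel \<Otimes>\<^sub>M \<theta>). fst x \<le> snd x} \<inter> ((\<lambda>x. psi (snd x - fst x)) -` F \<inter> space (borel \<Otimes>\<^sub>M \<theta>))"
    by (auto simp: space_pair_measure sp)
  then have "{x. fst x \<le> snd x \<and> psi (snd x - fst x) \<in> F} \<in> sets (borel \<Otimes>\<^sub>M \<theta>)"
    using 2 measurable_sets[OF 1 F] by simp
  from measurable_emeasure_Pair[OF this] show ?thesis by (simp add: W_def vimage_def)
qed

text \<open>The normalising factor is the tail of \<open>E\<close> even when \<open>\<theta>\<close>
  is one of its parts; only so do the parts add up to the conditional law.\<close>

definition kernel_part :: "real measure \<Rightarrow> (nat \<Rightarrow> real) \<Rightarrow> real measure" where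
  "kernel_part \<theta> x = distr (density \<theta> (\<lambda>r. indicator {\<sigma> x..} r * inverse (emeasure E {\<sigma> x..}))) unit_borel
     (\<lambda>r. psi (r - \<sigma> x))"

lemma sets_kernel_part [simp]: "sets (kernel_part \<theta> x) = sets unit_borel"
  by (simp add: kernel_part_def)

lemma space_kernel_part [simp]: "space (kernel_part \<theta> x) = {0..1}"
  by (simp add: kernel_part_def space_unit_borel)

lemma emeasure_kernel_part:
  assumes \<theta>: "admissible s \<theta>" and F: "F \<in> sets unit_borel"
  shows "emeasure (kernel_part \<theta> x) F = emeasure \<theta> (W (\<sigma> x) F) * inverse (emeasure E {\<sigma> x..})"
proof -
  note [measurable_cong] = admissible_sets[OF \<theta>]
  have Fb: "F \<in> sets borel" using F by (simp add: sets_unit_borel_iff)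
  have m: "(\<lambda>r. psi (r - \<sigma> x)) \<in> \<theta> \<rightarrow>\<^sub>M unit_borel" by (rule psi_unit_borel) measurable
  have sp: "space \<theta> = UNIV" using sets_eq_imp_space_eq[OF admissible_sets[OF \<theta>]] by simp
  let ?g = "\<lambda>r. indicator {\<sigma> x..} r * inverse (emeasure E {\<sigma> x..})"
  have g: "?g \<in> borel_measurable \<theta>" by measurable
  have V: "(\<lambda>r. psi (r - \<sigma> x)) -` F \<in> sets \<theta>" using measurable_sets[OF m F] by (simp add: sp)
  have "emeasure (kernel_part \<theta> x) F = emeasure (density \<theta> ?g) ((\<lambda>r. psi (r - \<sigma> x)) -` F)"
    unfolding kernel_part_def using m F by (subst emeasure_distr) (simp_all add: sp)
  also have "\<dots> = (\<integral>\<^sup>+r. ?g r * indicator ((\<lambda>r. psi (r - \<sigma> x)) -` F) r \<partial>\<theta>)"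
    by (rule emeasure_density[OF g V])
  also have "\<dots> = (\<integral>\<^sup>+r. inverse (emeasure E {\<sigma> x..}) * indicator (W (\<sigma> x) F) r \<partial>\<theta>)"
    by (intro nn_integral_cong) (auto simp: W_def indicator_def)
  also have "\<dots> = inverse (emeasure E {\<sigma> x..}) * emeasure \<theta> (W (\<sigma> x) F)"
    using W_measurable[OF Fb] admissible_sets[OF \<theta>] by (intro nn_integral_cmult_indicator) simp
  finally show ?thesis by (simp add: mult.commute)
qed

lemma tail_inverse:
  assumes "0 \<le> c"
  shows "emeasure E {c..} * inverse (emeasure E {c..}) = 1"
proof -
  have "emeasure E {c..} / emeasure E {c..} = 1"
    using E_tail_pos[OF assms] by (intro ennreal_divide_self) (simp_all add: less_top[symmetric])
  then show ?thesis by (simp only: divide_ennreal_def)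
qed

lemma emeasure_kernel_part_measurable:
  assumes \<theta>: "admissible s \<theta>" and F: "F \<in> sets unit_borel"
  shows "(\<lambda>x. emeasure (kernel_part \<theta> x) F) \<in> borel_measurable (cube_borel s)"
proof -
  have Fb: "F \<in> sets borel" using F by (simp add: sets_unit_borel_iff)
  have "(\<lambda>x. emeasure \<theta> (W (\<sigma> x) F)) \<in> borel_measurable (cube_borel s)"
    by (rule measurable_compose[OF \<sigma>_measurable emeasure_W_measurable[OF \<theta> Fb]])
  moreover have "(\<lambda>x. emeasure E (W (\<sigma> x) {0..1})) \<in> borel_measurable (cube_borel s)"
    by (rule measurable_compose[OF \<sigma>_measurable emeasure_W_measurable[OF E_adm]]) simp
  ultimately show ?thesis
    unfolding emeasure_kernel_part[OF \<theta> F] W_all by measurable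
qed

lemma wt_eq: "wt z r = ennreal (fact s) * (if \<forall>i<s. 0 \<le> z i then 1 else 0) * indicator {(\<Sum>i<s. z i)..} r"
  by (auto simp: wt_def prod_indicator_eq indicator_def)

text \<open>Given \<open>z\<close>, the weight is constant in \<open>r\<close> above the sum of
  \<open>z\<close>. The law of the first coordinates therefore contributes the tail mass of
  \<open>E\<close>, which cancels the normalisation of \<open>kernel_part\<close>, and the measure
  of \<open>W\<close> under \<open>\<theta>\<close> remains. With \<open>\<theta> = E\<close> this
  is the defining identity of the conditional kernel; for the parts it identifies the kernel
  measures.\<close>

lemma Q_rect:
  assumes \<theta>: "admissible s \<theta>" and B: "B \<in> sets (cube_borel s)" and F: "F \<in> sets unit_borel"
  shows "emeasure (Q \<theta>) (rect (Suc s) B F) = (\<integral>\<^sup>+x\<in>B. emeasure (kernel_part \<theta> x) F \<partial>marg)"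
proof -
  let ?R = "rect (Suc s) B F"
  have Fb: "F \<in> sets borel" using F by (simp add: sets_unit_borel_iff)
  have R: "?R \<in> sets (cube_borel (Suc s))" using B F by (intro sets_rect) simp_all
  have g: "(\<lambda>x. emeasure (kernel_part \<theta> x) F * indicator B x) \<in> borel_measurable (cube_borel s)"
    by (intro borel_measurable_times_ennreal emeasure_kernel_part_measurable[OF \<theta> F] borel_measurable_indicator[OF B])
  define T1 where "T1 z = (\<lambda>i\<in>{..<s}. psi (z i))" for z
  have T1: "restrict (T z r) {..<s} = T1 z" for z r by (auto simp: T_def T1_def restrict_def)
  have \<sigma>_T1: "\<sigma> (T1 z) = (\<Sum>i<s. z i)" if "\<forall>i<s. 0 \<le> z i" for z
    unfolding \<sigma>_def T1_def by (intro sum.cong) (use that in \<open>auto simp: phi_psi\<close>)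
  have "(\<integral>\<^sup>+x\<in>B. emeasure (kernel_part \<theta> x) F \<partial>marg) =
      (\<integral>\<^sup>+y. emeasure (kernel_part \<theta> (restrict y {..<s})) F * indicator B (restrict y {..<s}) \<partial>Q E)"
    unfolding marg_def using g by (intro nn_integral_distr[OF measurable_front_Q]) simp
  also have "\<dots> = (\<integral>\<^sup>+z. (\<integral>\<^sup>+r. wt z r * (emeasure (kernel_part \<theta> (T1 z)) F * indicator B (T1 z)) \<partial>E) \<partial>Z)"
    using nn_integral_Q[OF E_adm measurable_compose[OF measurable_front g]] by (simp only: T1)
  also have "\<dots> = (\<integral>\<^sup>+z. (\<integral>\<^sup>+r. wt z r * indicator ?R (T z r) \<partial>\<theta>) \<partial>Z)"
  proof (rule nn_integral_cong)
    fix z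
    show "(\<integral>\<^sup>+r. wt z r * (emeasure (kernel_part \<theta> (T1 z)) F * indicator B (T1 z)) \<partial>E) =
      (\<integral>\<^sup>+r. wt z r * indicator ?R (T z r) \<partial>\<theta>)"
    proof (cases "\<forall>i<s. 0 \<le> z i")
      case False
      then have "wt z r = 0" for r unfolding wt_eq by (simp only: if_not_P) simp
      then show ?thesis by simp
    next
      case True
      let ?c = "\<Sum>i<s. z i"
      have c: "0 \<le> ?c" using True by (intro sum_nonneg) auto
      have wt: "wt z r = ennreal (fact s) * indicator {?c..} r" for r
        using True by (simp add: wt_eq)
      let ?k = "emeasure (kernel_part \<theta> (T1 z)) F * indicator B (T1 z)"
      have "(\<integral>\<^sup>+r. wt z r * ?k \<partial>E) = (\<integral>\<^sup>+r. (ennreal (fact s) * ?k) * indicator {?c..} r \<partial>E)"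
        unfolding wt by (simp only: mult_ac)
      also have "\<dots> = (ennreal (fact s) * ?k) * emeasure E {?c..}"
        by (rule nn_integral_cmult_indicator) simp
      \<comment> \<open>The first tail comes from integrating over \<open>r\<close>, the inverse
        from the definition of \<open>kernel_part\<close>.\<close>
      also have "\<dots> = ennreal (fact s) * indicator B (T1 z) * emeasure \<theta> (W ?c F) *
          (emeasure E {?c..} * inverse (emeasure E {?c..}))"
        by (simp only: emeasure_kernel_part[OF \<theta> F] \<sigma>_T1[OF True] mult_ac)
      also have "\<dots> = ennreal (fact s) * indicator B (T1 z) * emeasure \<theta> (W ?c F)"
        by (simp only: tail_inverse[OF c] mult_1_right)
      also have "\<dots> = (\<integral>\<^sup>+r. (ennreal (fact s) * indicator B (T1 z)) * indicator (W ?c F) r \<partial>\<theta>)"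
        using W_measurable[OF Fb] admissible_sets[OF \<theta>] by (intro nn_integral_cmult_indicator[symmetric]) simp
      also have "\<dots> = (\<integral>\<^sup>+r. wt z r * indicator ?R (T z r) \<partial>\<theta>)"
      proof (rule nn_integral_cong)
        fix r
        have "T z r s = psi (r - ?c)" by (simp add: T_def)
        then have "T z r \<in> ?R \<longleftrightarrow> T1 z \<in> B \<and> psi (r - ?c) \<in> F"
          using T_cube[of z r] T1[of z r] by (simp add: rect_def)
        then show "(ennreal (fact s) * indicator B (T1 z)) * indicator (W ?c F) r = wt z r * indicator ?R (T z r)"
          by (auto simp: wt W_def indicator_def)
      qed
      finally show ?thesis .
    qed
  qed
  also have "\<dots> = emeasure (Q \<theta>) ?R" by (rule emeasure_Q[OF \<theta> R, symmetric])
  finally show ?thesis ..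
qed

lemma prob_space_kernel_part_E: "prob_space (kernel_part E x)"
proof
  have "emeasure (kernel_part E x) {0..1} = 1"
    using emeasure_kernel_part[OF E_adm, of "{0..1}" x] tail_inverse[OF \<sigma>_nonneg[of x]]
    by (simp add: W_all sets_unit_borel_iff)
  then show "emeasure (kernel_part E x) (space (kernel_part E x)) = 1" by simp
qed

lemma is_cond_kernel_kernel_part: "is_cond_kernel (Suc s) cop (kernel_part E)"
proof -
  have "kernel_part E \<in> cube_borel s \<rightarrow>\<^sub>M prob_algebra unit_borel"
  proof (rule measurable_prob_algebra_generated[where \<Omega> = "{0..1}" and G = "sets unit_borel"])
    show "sets unit_borel = sigma_sets {0..1} (sets unit_borel)"
      using sets.sigma_sets_eq[of unit_borel] by (simp add: space_unit_borel)
    show "Int_stable (sets unit_borel)" by (rule sets.Int_stable)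
    show "sets unit_borel \<subseteq> Pow {0..1}"
      using sets.space_closed[of unit_borel] by (simp only: space_unit_borel)
  qed (simp_all add: prob_space_kernel_part_E emeasure_kernel_part_measurable E_adm)
  then show ?thesis
    unfolding is_cond_kernel_def copula_measure_cop marginal_measure_cop
    using Q_rect[OF E_adm] by simp
qed

text \<open>Existence of one kernel makes the choice in \<open>cond_kernel\<close> a kernel, and
  uniqueness then compares the two.\<close>

lemma AE_cond_kernel_eq: "AE x in marg. cond_kernel (Suc s) cop x = kernel_part E x"
proof -
  have "is_cond_kernel (Suc s) cop (cond_kernel (Suc s) cop)"
    unfolding cond_kernel_def by (rule someI[of "is_cond_kernel (Suc s) cop", OF is_cond_kernel_kernel_part])
  from is_cond_kernel_AE_unique[OF _ _ _ this is_cond_kernel_kernel_part] show ?thesis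
    unfolding marginal_measure_cop by (simp add: marg.finite_measure_axioms)
qed

text \<open>The set is covered by the image of \<open>F \<inter> {0<..1}\<close> under
  \<open>phi + c\<close>, and \<open>phi\<close> is locally Lipschitz by
  \<open>psi_decrease\<close>. This transfers absolute continuity from \<open>A\<close> to its
  image.\<close>

lemma W_negligible:
  assumes F: "F \<in> null_sets lborel"
  shows "W c F \<in> null_sets lborel"
proof -
  have Fb: "F \<in> sets borel" using F by auto
  let ?F = "F \<inter> {0<..1}"
  have "negligible F" using F negligible_null_sets_lborel[OF Fb] by (simp only:)
  then have "negligible ?F" by (rule negligible_subset) (rule Int_lower1)
  moreover have "\<exists>T B. open T \<and> u \<in> T \<and> (\<forall>v\<in>?F \<inter> T. norm ((phi v + c) - (phi u + c)) \<le> B * norm (v - u))"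
    if u: "u \<in> ?F" for u
  proof (intro exI conjI ballI)
    \<comment> \<open>Near 0 the inverse is unbounded. On \<open>(u / 2, 1]\<close> it stays below
      \<open>?L\<close>, where \<open>psi\<close> decreases at least at the rate \<open>?m\<close>,
      so \<open>1 / ?m\<close> is a Lipschitz constant there.\<close>
    let ?L = "phi (u / 2)" and ?m = "measure E {phi (u / 2) + 1..}"
    show "open {u / 2<..}" "u \<in> {u / 2<..}" using u by auto
    have m: "0 < ?m" using phi_nonneg[of "u / 2"] by (intro measure_tail_pos) simp
    have L: "phi v \<le> ?L" if "u / 2 < v" "v \<le> 1" for v
      using that u psi_le_iff[of ?L "phi v"] phi_nonneg psi_phi[of v] psi_phi[of "u / 2"] by simp
    have key: "\<bar>phi v - phi w\<bar> \<le> 1 / ?m * \<bar>v - w\<bar>"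
      if "phi v \<le> phi w" "u / 2 < v" "v \<le> 1" "u / 2 < w" "w \<le> 1" for v w
    proof -
      have "(phi w - phi v) * ?m \<le> psi (phi v) - psi (phi w)"
        using that L by (intro psi_decrease phi_nonneg) auto
      also have "\<dots> = v - w" using that u by (simp add: psi_phi)
      finally have "(phi w - phi v) * ?m \<le> \<bar>v - w\<bar>" by simp
      then show ?thesis using m that by (simp add: field_simps)
    qed
    fix v assume v: "v \<in> ?F \<inter> {u / 2<..}"
    show "norm ((phi v + c) - (phi u + c)) \<le> 1 / ?m * norm (v - u)"
      using key[of v u] key[of u v] u v by (cases "phi v \<le> phi u") (auto simp: abs_minus_commute)
  qed
  ultimately have "negligible ((\<lambda>u. phi u + c) ` ?F)"
    by (intro negligible_locally_Lipschitz_image) auto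
  moreover have "W c F \<subseteq> (\<lambda>u. phi u + c) ` ?F"
  proof
    fix r assume "r \<in> W c F"
    then have "c \<le> r" "psi (r - c) \<in> ?F" by (auto simp: W_def psi_pos psi_le_1)
    moreover have "r = phi (psi (r - c)) + c" using \<open>c \<le> r\<close> by (simp add: phi_psi)
    ultimately show "r \<in> (\<lambda>u. phi u + c) ` ?F" by blast
  qed
  ultimately have "negligible (W c F)" by (rule negligible_subset)
  then show ?thesis using negligible_null_sets_lborel[OF W_measurable[OF Fb]] by blast
qed

text \<open>The opposite direction, for the singular part: Lipschitz maps preserve null sets.
  Describing the set as a preimage under \<open>phi\<close> makes it visibly Borel, which an image
  under \<open>psi\<close> is not.\<close>

lemma null_sets_psi_image:
  fixes c :: real
  assumes Z: "Y \<in> null_sets lborel"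
  defines "V \<equiv> {u \<in> {0<..1}. phi u + c \<in> Y}"
  shows "V \<in> null_sets lborel"
proof -
  have Yb: "Y \<in> sets borel" using Z by auto
  have "(\<lambda>u. phi u + c) -` Y \<inter> space borel \<in> sets borel" by (rule measurable_sets[OF _ Yb]) measurable
  then have "{0<..1} \<inter> (\<lambda>u. phi u + c) -` Y \<in> sets borel" by auto
  then have Vb: "V \<in> sets borel" by (simp add: V_def Int_def vimage_def)
  obtain K where K: "0 \<le> K" "\<And>x y. \<bar>psi x - psi y\<bar> \<le> K * \<bar>x - y\<bar>" using psi_lipschitz by blast
  have "negligible Y" using Z negligible_null_sets_lborel[OF Yb] by (simp only:)
  then have "negligible ((\<lambda>r. psi (r - c)) ` Y)"
  proof (rule negligible_locally_Lipschitz_image[rotated])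
    show "\<exists>T B. open T \<and> x \<in> T \<and> (\<forall>y\<in>Y \<inter> T. norm (psi (y - c) - psi (x - c)) \<le> B * norm (y - x))" for x
    proof (intro exI conjI ballI)
      show "open (UNIV :: real set)" "x \<in> UNIV" by simp_all
      show "norm (psi (y - c) - psi (x - c)) \<le> K * norm (y - x)" for y using K(2)[of "y - c" "x - c"] by simp
    qed
  qed simp
  moreover have "V \<subseteq> (\<lambda>r. psi (r - c)) ` Y"
  proof
    fix u assume "u \<in> V"
    then have "phi u + c \<in> Y" "u = psi ((phi u + c) - c)" by (auto simp: V_def psi_phi)
    then show "u \<in> (\<lambda>r. psi (r - c)) ` Y" by blast
  qed
  ultimately have "negligible V" by (rule negligible_subset)
  then show ?thesis using negligible_null_sets_lborel[OF Vb] by blast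
qed

lemma emeasure_kernel_part_zero:
  assumes \<theta>: "admissible s \<theta>" and F: "F \<in> sets unit_borel" and B: "B \<in> sets borel" "emeasure \<theta> B = 0"
    and sub: "W (\<sigma> x) F \<subseteq> B"
  shows "emeasure (kernel_part \<theta> x) F = 0"
proof -
  have "emeasure \<theta> (W (\<sigma> x) F) \<le> emeasure \<theta> B"
    using sub B admissible_sets[OF \<theta>] by (intro emeasure_mono) simp_all
  then show ?thesis using B by (simp add: emeasure_kernel_part[OF \<theta> F])
qed

lemma null_sets_unit_lborel_iff:
  "F \<in> null_sets unit_lborel \<longleftrightarrow> F \<in> null_sets lborel \<and> F \<subseteq> {0..1}"
  by (subst null_sets_restrict_space) auto

text \<open>The map from \<open>r\<close> to \<open>psi (r - \<sigma> x)\<close> is injective on the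
  truncated half line, so images of diffuse measures are diffuse, while images of countable sets are
  always countable. It is Lipschitz with locally Lipschitz inverse, so null sets correspond to null
  sets in both directions.\<close>

lemma is_decomposition_kernel_part: "is_decomposition (kernel_part E x) (kernel_part A x) (kernel_part D x) (kernel_part S x)"
  unfolding is_decomposition_def
proof (intro conjI ballI)
  let ?c = "\<sigma> x"
  show "absolutely_continuous unit_lborel (kernel_part A x)"
    unfolding absolutely_continuous_def
  proof
    fix F assume "F \<in> null_sets unit_lborel"
    then have F: "F \<in> null_sets lborel" "F \<in> sets unit_borel"
      using null_sets_unit_lborel_iff by (auto simp: sets_unit_borel_iff)
    then have "W ?c F \<in> null_sets A" using W_negligible A_ac by (auto simp: absolutely_continuous_def)
    then have "emeasure A (W ?c F) = 0" by (rule null_setsD1)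
    then have "emeasure (kernel_part A x) F = 0" using F by (simp add: emeasure_kernel_part[OF A_adm])
    then show "F \<in> null_sets (kernel_part A x)" using F by (intro null_setsI) simp_all
  qed
  show "discrete_measure (kernel_part D x)"
  proof -
    obtain B where B: "countable B" "emeasure D (- B) = 0" using D_disc by blast
    let ?P = "(\<lambda>r. psi (r - ?c)) ` B"
    have "B \<in> sets borel" by (rule sets.countable) (simp_all add: B(1))
    then have Bb: "- B \<in> sets borel" by (rule borel_comp)
    have "?P \<in> sets borel" by (rule sets.countable) (simp_all add: B(1) countable_image)
    moreover have "?P \<subseteq> {0..1}" by (auto simp: psi_nonneg psi_le_1)
    ultimately have P: "?P \<in> sets unit_borel" unfolding sets_unit_borel_iff by blast
    then have "{0..1} - ?P \<in> sets unit_borel"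
      using sets.compl_sets[OF P] by (simp add: space_unit_borel)
    moreover have "W ?c ({0..1} - ?P) \<subseteq> - B" by (auto simp: W_def)
    ultimately have "emeasure (kernel_part D x) ({0..1} - ?P) = 0"
      by (rule emeasure_kernel_part_zero[OF D_adm _ Bb B(2)])
    then show ?thesis unfolding discrete_measure_def using P B(1) by (intro bexI[of _ ?P]) simp_all
  qed
  show "singular_measure (kernel_part S x)"
    unfolding singular_measure_def
  proof (intro conjI ballI)
    fix u assume "u \<in> space (kernel_part S x)"
    then have "{u} \<in> sets unit_borel" by (simp add: sets_unit_borel_iff)
    moreover have "W ?c {u} \<subseteq> {phi u + ?c}" by (auto simp: W_def phi_psi)
    ultimately show "emeasure (kernel_part S x) {u} = 0"
      by (intro emeasure_kernel_part_zero[OF S_adm _ _ S_diffuse[of "phi u + ?c"]]) simp_all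
  next
    obtain Y where Y: "Y \<in> null_sets lborel" "emeasure S (- Y) = 0" using S_null by blast
    let ?V = "{u \<in> {0<..1}. phi u + ?c \<in> Y}"
    have V: "?V \<in> null_sets unit_lborel"
      unfolding null_sets_unit_lborel_iff using null_sets_psi_image[OF Y(1)] by auto
    then have "?V \<in> sets unit_borel" using null_setsD2[OF V] by simp
    from sets.compl_sets[OF this] have "{0..1} - ?V \<in> sets unit_borel" by (simp add: space_unit_borel)
    moreover have "W ?c ({0..1} - ?V) \<subseteq> - Y" by (auto simp: W_def phi_psi psi_pos psi_le_1)
    moreover have "- Y \<in> sets borel" using Y(1) by (intro borel_comp) auto
    ultimately have "emeasure (kernel_part S x) ({0..1} - ?V) = 0"
      by (intro emeasure_kernel_part_zero[OF S_adm _ _ Y(2)])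
    then show "\<exists>P\<in>null_sets unit_lborel. emeasure (kernel_part S x) (space (kernel_part S x) - P) = 0"
      using V by (intro bexI[of _ ?V]) simp_all
  qed
  fix F assume F: "F \<in> sets unit_borel"
  then have "W ?c F \<in> sets borel" by (intro W_measurable) (simp add: sets_unit_borel_iff)
  then show "emeasure (kernel_part E x) F = emeasure (kernel_part A x) F + emeasure (kernel_part D x) F + emeasure (kernel_part S x) F"
    using F by (simp add: emeasure_kernel_part E_adm A_adm D_adm S_adm E_sum distrib_right)
qed simp_all

text \<open>The kernel is prescribed only almost everywhere because that is all that is known of
  \<open>cond_kernel\<close>. Domination by \<open>E\<close> bounds the mass of
  \<open>Q \<theta>\<close> by 1, as the uniqueness on rectangles requires.\<close>

lemma kernel_measure_Q:
  assumes \<theta>: "admissible s \<theta>" and le: "\<And>B. B \<in> sets borel \<Longrightarrow> emeasure \<theta> B \<le> emeasure E B"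
    and J: "AE x in marg. J x = kernel_part \<theta> x"
  shows "kernel_measure (Suc s) cop J = Q \<theta>"
proof -
  have int: "(\<integral>\<^sup>+x\<in>B. emeasure (J x) F \<partial>marg) = emeasure (Q \<theta>) (rect (Suc s) B F)"
    if "B \<in> sets (cube_borel s)" "F \<in> sets unit_borel" for B F
    unfolding Q_rect[OF \<theta> that] by (intro nn_integral_cong_AE) (use J in eventually_elim, simp)
  have "emeasure (Q \<theta>) (cube (Suc s)) < \<infinity>"
  proof -
    have "rect (Suc s) (cube s) {0..1} = cube (Suc s)"
      by (rule set_eqI) (simp add: rect_def cube_iff All_less_Suc, blast)
    moreover have "cube s \<in> sets (cube_borel s)" using sets.top[of "cube_borel s"] by (simp add: space_cube_borel)
    moreover have F: "{0..1} \<in> sets unit_borel" by (simp add: sets_unit_borel_iff)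
    ultimately have "emeasure (Q \<theta>) (cube (Suc s)) = (\<integral>\<^sup>+x\<in>cube s. emeasure (kernel_part \<theta> x) {0..1} \<partial>marg)"
      using Q_rect[OF \<theta>, of "cube s" "{0..1}"] by simp
    also have "\<dots> \<le> (\<integral>\<^sup>+x. 1 \<partial>marg)"
    proof (rule nn_integral_mono)
      fix x
      have "emeasure (kernel_part \<theta> x) {0..1} \<le> emeasure (kernel_part E x) {0..1}"
        unfolding emeasure_kernel_part[OF \<theta> F] emeasure_kernel_part[OF E_adm F] W_all
        by (intro mult_right_mono le) simp_all
      also have "\<dots> = 1" using prob_space.emeasure_space_1[OF prob_space_kernel_part_E[of x]] by simp
      finally show "emeasure (kernel_part \<theta> x) {0..1} * indicator (cube s) x \<le> 1" by (simp add: indicator_def)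
    qed
    also have "\<dots> = 1" using marg.emeasure_space_1 by simp
    finally show ?thesis by (simp add: le_less_trans)
  qed
  then have fin: "finite_measure (Q \<theta>)" by (intro finite_measureI) simp
  show ?thesis
    unfolding kernel_measure_def marginal_measure_cop diff_Suc_1
  proof (rule the_equality)
    show "sets (Q \<theta>) = sets (cube_borel (Suc s)) \<and> (\<forall>B\<in>sets (cube_borel s). \<forall>F\<in>sets unit_borel.
        emeasure (Q \<theta>) (rect (Suc s) B F) = (\<integral>\<^sup>+x\<in>B. emeasure (J x) F \<partial>marg))"
      by (simp add: int)
    fix N assume N: "sets N = sets (cube_borel (Suc s)) \<and> (\<forall>B\<in>sets (cube_borel s). \<forall>F\<in>sets unit_borel.
        emeasure N (rect (Suc s) B F) = (\<integral>\<^sup>+x\<in>B. emeasure (J x) F \<partial>marg))"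
    show "N = Q \<theta>"
    proof (rule measure_eqI_rect[OF _ _ fin, symmetric])
      show "emeasure (Q \<theta>) (rect (Suc s) B F) = emeasure N (rect (Suc s) B F)"
        if "B \<in> sets (cube_borel (Suc s - 1))" "F \<in> sets unit_borel" for B F
        using N int[of B F] that by simp
    qed (use N in simp_all)
  qed
qed

lemma mu_parts_cop:
  "mu_abs (Suc s) cop = Q A" "mu_dis (Suc s) cop = Q D" "mu_sing (Suc s) cop = Q S"
proof -
  have le: "emeasure A B \<le> emeasure E B" "emeasure D B \<le> emeasure E B" "emeasure S B \<le> emeasure E B"
    if "B \<in> sets borel" for B
    using E_sum[OF that] by (simp_all add: add_increasing add_increasing2)
  note p = decomposition_parts_eq[OF is_decomposition_kernel_part]
  show "mu_abs (Suc s) cop = Q A" unfolding mu_abs_def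
    by (rule kernel_measure_Q[OF A_adm le(1)]) (assumption, use AE_cond_kernel_eq in eventually_elim, simp add: p)
  show "mu_dis (Suc s) cop = Q D" unfolding mu_dis_def
    by (rule kernel_measure_Q[OF D_adm le(2)]) (assumption, use AE_cond_kernel_eq in eventually_elim, simp add: p)
  show "mu_sing (Suc s) cop = Q S" unfolding mu_sing_def
    by (rule kernel_measure_Q[OF S_adm le(3)]) (assumption, use AE_cond_kernel_eq in eventually_elim, simp add: p)
qed

end

section \<open>Supports\<close>

text \<open>A point of the interval may be an endpoint, so a small interval inside
  \<open>(0,1)\<close> is taken to its right, or to its left if the point is 1. Endpoints strictly
  between 0 and 1 have proper inverses under \<open>psi\<close>.\<close>

lemma openin_unit_interval:
  assumes V: "openin (top_of_set {0..1::real}) V" and x: "x \<in> V"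
  obtains \<alpha> \<beta> where "0 < \<alpha>" "\<alpha> < \<beta>" "\<beta> < 1" "{\<alpha><..<\<beta>} \<subseteq> V"
proof -
  obtain O' where O': "open O'" "V = {0..1} \<inter> O'" using V by (auto simp: openin_open)
  then obtain e where e: "0 < e" "ball x e \<subseteq> O'" using x by (meson IntD2 open_contains_ball)
  have x01: "0 \<le> x" "x \<le> 1" using x O'(2) by auto
  have ball: "y \<in> V" if "0 < y" "y < 1" "\<bar>y - x\<bar> < e" for y
    using that e(2) O'(2) by (auto simp: dist_real_def abs_minus_commute)
  show ?thesis
  proof (cases "x < 1")
    case True
    define \<delta> where "\<delta> = min e (1 - x)"
    have "0 < \<delta>" "\<delta> \<le> e" "\<delta> \<le> 1 - x" using e True by (auto simp: \<delta>_def)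
    then show ?thesis using x01 by (intro that[of "x + \<delta> / 3" "x + 2 * \<delta> / 3"]) (auto intro!: ball)
  next
    case False
    define \<delta> where "\<delta> = min e 1"
    have "0 < \<delta>" "\<delta> \<le> e" "\<delta> \<le> 1" using e by (auto simp: \<delta>_def)
    then show ?thesis using x01 False by (intro that[of "1 - 2 * \<delta> / 3" "1 - \<delta> / 3"]) (auto intro!: ball)
  qed
qed

context radial begin

text \<open>A nonempty open set contains a box of intervals. In the coordinates
  \<open>(z, r)\<close> it contains all points with \<open>z\<close> in an open box of positive
  Lebesgue measure and \<open>r\<close> minus the sum of \<open>z\<close> in an open interval, and
  for each such \<open>z\<close> that interval for \<open>r\<close> is charged by
  \<open>\<theta>\<close>. An open null set must therefore be empty.\<close>

lemma support_Q:
  assumes \<theta>: "admissible s \<theta>" and ch: "charges_intervals \<theta>"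
  shows "support_in (cube_topology (Suc s)) (Q \<theta>) = cube (Suc s)"
proof -
  have top: "topspace (cube_topology (Suc s)) = cube (Suc s)"
    by (simp add: cube_topology_def cube_def topspace_product_topology)
  have "U = {}" if U: "openin (cube_topology (Suc s)) U" "U \<in> null_sets (Q \<theta>)" for U
  proof (rule ccontr)
    assume "U \<noteq> {}"
    then obtain x where x: "x \<in> U" by blast
    obtain V where V: "\<forall>i\<in>{..<Suc s}. openin (top_of_set {0..1}) (V i)" "x \<in> Pi\<^sub>E {..<Suc s} V"
      "Pi\<^sub>E {..<Suc s} V \<subseteq> U"
      using U(1)[unfolded cube_topology_def openin_product_topology_alt, rule_format, OF x] by blast
    have "\<exists>p. 0 < fst p \<and> fst p < snd p \<and> snd p < 1 \<and> {fst p<..<snd p} \<subseteq> V i" if i: "i < Suc s" for i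
    proof -
      obtain \<alpha> \<beta> where "0 < \<alpha>" "\<alpha> < \<beta>" "\<beta> < 1" "{\<alpha><..<\<beta>} \<subseteq> V i"
        by (rule openin_unit_interval[of "V i" "x i"]) (use V i in auto)
      then show ?thesis by (intro exI[of _ "(\<alpha>, \<beta>)"]) simp
    qed
    then obtain p where p: "\<And>i. i < Suc s \<Longrightarrow> 0 < fst (p i) \<and> fst (p i) < snd (p i) \<and> snd (p i) < 1
        \<and> {fst (p i)<..<snd (p i)} \<subseteq> V i" by metis
    \<comment> \<open>Endpoints are interchanged because \<open>psi\<close> decreases.\<close>
    define a where "a i = phi (snd (p i))" for i
    define b where "b i = phi (fst (p i))" for i
    have a0: "0 \<le> a i" for i by (simp add: a_def phi_nonneg)
    have psi_ab: "psi (a i) = snd (p i)" "psi (b i) = fst (p i)" if "i < Suc s" for i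
      using p[OF that] by (auto simp: a_def b_def intro!: psi_phi)
    have ab: "a i < b i" if "i < Suc s" for i
      using psi_less_iff[of "b i" "a i"] p[OF that] psi_ab[OF that] by (simp add: a_def b_def phi_nonneg)
    have psi_in: "psi t \<in> V i" if "i < Suc s" "a i < t" "t < b i" for i t
    proof -
      have "0 \<le> t" using that a0[of i] by linarith
      then have "psi t < psi (a i)" "psi (b i) < psi t"
        using that a0[of i] by (auto simp: psi_less_iff)
      then show ?thesis using p[OF that(1)] psi_ab[OF that(1)] by auto
    qed
    define f where "f z = (\<integral>\<^sup>+r. wt z r * indicator U (T z r) \<partial>\<theta>)" for z
    have Us: "U \<in> sets (cube_borel (Suc s))" using null_setsD2[OF U(2)] by simp
    have "(\<integral>\<^sup>+z. f z \<partial>Z) = 0"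
      unfolding f_def using emeasure_Q[OF \<theta> Us] U(2) by (simp add: null_sets_def)
    moreover have "f \<in> borel_measurable Z"
    proof -
      interpret finite_measure \<theta> by (rule admissible_finite_measure[OF \<theta>])
      show ?thesis unfolding f_def
        by (rule borel_measurable_nn_integral)
          (rule integrand_measurable[OF admissible_sets[OF \<theta>] borel_measurable_indicator[OF Us]])
    qed
    ultimately have AE0: "AE z in Z. f z = 0" by (simp add: nn_integral_0_iff_AE)
    let ?B = "\<Pi>\<^sub>E i\<in>{..<s}. {a i<..<b i}"
    have f_pos: "0 < f z" if z: "z \<in> ?B" for z
    proof -
      let ?c = "\<Sum>i<s. z i"
      have zi: "a i < z i" "z i < b i" if "i < s" for i using z that by (auto simp: PiE_iff)
      have z0: "0 \<le> z i" if "i < s" for i using zi(1)[OF that] a0[of i] by linarith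
      then have c: "0 \<le> ?c" by (intro sum_nonneg) simp
      have "0 < emeasure \<theta> {?c + a s<..<?c + b s}"
        using ch c a0[of s] ab[of s] by (simp add: charges_intervals_def)
      also have "\<dots> = (\<integral>\<^sup>+r. indicator {?c + a s<..<?c + b s} r \<partial>\<theta>)"
        using admissible_sets[OF \<theta>] by (intro nn_integral_indicator[symmetric]) simp
      also have "\<dots> \<le> f z"
        unfolding f_def
      proof (rule nn_integral_mono)
        fix r
        show "indicator {?c + a s<..<?c + b s} r \<le> wt z r * indicator U (T z r)"
        proof (cases "r \<in> {?c + a s<..<?c + b s}")
          case True
          have "psi (if i < s then z i else r - ?c) \<in> V i" if "i < Suc s" for i
            using that True zi[of i] by (cases "i < s") (auto simp: less_Suc_eq intro!: psi_in)
          then have "T z r \<in> Pi\<^sub>E {..<Suc s} V"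
            unfolding T_def by (intro restrict_PiE_iff[THEN iffD2] ballI) simp
          then have "T z r \<in> U" using V(3) by blast
          moreover have "1 \<le> wt z r"
          proof -
            have "wt z r = ennreal (fact s)"
              using z0 True a0[of s] by (simp add: wt_def prod_indicator_eq)
            moreover have "ennreal 1 \<le> ennreal (fact s)" by (intro ennreal_leI fact_ge_1)
            ultimately show ?thesis by simp
          qed
          ultimately show ?thesis using True by simp
        qed simp
      qed
      finally show ?thesis .
    qed
    have "AE z in Z. z \<notin> ?B" using AE0 by eventually_elim (use f_pos in force)
    moreover have Bs: "?B \<in> sets Z" by (intro sets_PiM_I_finite) auto
    ultimately have "?B \<in> null_sets Z" by (simp add: AE_iff_null_sets)
    then have "emeasure Z ?B = 0" by (rule null_setsD1)
    moreover have "emeasure Z ?B = (\<Prod>i<s. emeasure lborel {a i<..<b i})"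
      by (rule lborels.emeasure_PiM) auto
    ultimately have "(\<Prod>i<s. emeasure lborel {a i<..<b i}) = 0" by simp
    then obtain i where "i < s" "emeasure lborel {a i<..<b i} = 0" by auto
    then show False using ab[of i] by simp
  qed
  then have "\<Union>{U. openin (cube_topology (Suc s)) U \<and> U \<in> null_sets (Q \<theta>)} = {}" by blast
  then show ?thesis unfolding support_in_def top by (simp only: Diff_empty)
qed

end

section \<open>Archimedean copulas and finite differences of their generators\<close>

lemma copula_margin:
  assumes N: "has_distribution_function d N C" and m: "distr N unit_borel (\<lambda>x. x i) = unit_lborel"
    and i: "i < d" and t: "0 \<le> t" "t \<le> 1"
  shows "measure N {y \<in> cube d. y i \<le> t} = t"
proof -
  have s: "sets N = sets (cube_borel d)" using N by (simp add: has_distribution_function_def)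
  have sp: "space N = cube d" using sets_eq_imp_space_eq[OF s] by (simp add: space_cube_borel)
  have meas: "(\<lambda>x. x i) \<in> N \<rightarrow>\<^sub>M unit_borel"
    using measurable_cube_nth[OF i] s by (simp cong: measurable_cong_sets)
  have "{y \<in> cube d. y i \<le> t} = (\<lambda>x. x i) -` {0..t} \<inter> space N"
    using cube_nth[OF _ i] by (auto simp: sp)
  then have "measure N {y \<in> cube d. y i \<le> t} = measure (distr N unit_borel (\<lambda>x. x i)) {0..t}"
    using t by (subst measure_distr[OF meas]) (auto simp: sets_unit_borel_iff)
  also have "\<dots> = t" unfolding m using t by (simp add: measure_restrict_space)
  finally show ?thesis .
qed

lemma sets_cube_Collect:
  assumes "sets N = sets (cube_borel d)" "i < d"
  shows "{y \<in> cube d. y i \<le> t} \<in> sets N"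
  using borel_measurable_le[OF borel_measurable_cube_nth[OF assms(2)] borel_measurable_const, of t] assms(1)
  by (simp add: space_cube_borel)

lemma copula_le_coord:
  assumes C: "C \<in> copulas d" and x: "x \<in> cube d" and i: "i < d"
  shows "C x \<le> x i"
proof -
  obtain N where N: "has_distribution_function d N C" "distr N unit_borel (\<lambda>x. x i) = unit_lborel"
    using C i by (auto simp: copulas_def)
  then have s: "sets N = sets (cube_borel d)" and "prob_space N"
    and Cx: "C x = measure N {y \<in> cube d. \<forall>i<d. y i \<le> x i}"
    using x by (simp_all add: has_distribution_function_def)
  interpret prob_space N by fact
  have "C x \<le> measure N {y \<in> cube d. y i \<le> x i}"
    unfolding Cx using i sets_cube_Collect[OF s i] by (intro finite_measure_mono) auto
  also have "\<dots> = x i" using copula_margin[OF N i] cube_nth[OF x i] by simp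
  finally show ?thesis .
qed

lemma copula_nonneg: "C \<in> copulas d \<Longrightarrow> x \<in> cube d \<Longrightarrow> 0 \<le> C x"
  using copula_range by fastforce

text \<open>The lower box of \<open>x\<close> is covered by that of \<open>y\<close> and the slabs
  between \<open>y i\<close> and \<open>x i\<close>, whose masses are known from the uniform
  margins.\<close>

lemma copula_lipschitz:
  assumes C: "C \<in> copulas d" and x: "x \<in> cube d" and y: "y \<in> cube d"
  shows "C x - C y \<le> (\<Sum>i<d. \<bar>x i - y i\<bar>)"
proof -
  obtain N where N: "has_distribution_function d N C" "\<And>i. i < d \<Longrightarrow> distr N unit_borel (\<lambda>x. x i) = unit_lborel"
    using C by (auto simp: copulas_def)
  then have s: "sets N = sets (cube_borel d)" and "prob_space N"
    and C: "C x = measure N {z \<in> cube d. \<forall>i<d. z i \<le> x i}" "C y = measure N {z \<in> cube d. \<forall>i<d. z i \<le> y i}"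
    using x y by (simp_all add: has_distribution_function_def)
  interpret prob_space N by fact
  note le = sets_cube_Collect[OF s]
  define S where "S i = {z \<in> cube d. z i \<le> x i} - {z \<in> cube d. z i \<le> y i}" for i
  have Ss: "S i \<in> sets N" if "i < d" for i using le[OF that] by (simp add: S_def)
  have box: "{z \<in> cube d. \<forall>i<d. z i \<le> w i} \<in> sets N" for w unfolding s by (rule sets_lower_box)
  have US: "(\<Union>i\<in>{..<d}. S i) \<in> sets N" by (rule sets.finite_UN) (simp_all add: Ss)
  have mS: "measure N (S i) \<le> \<bar>x i - y i\<bar>" if i: "i < d" for i
  proof (cases "x i \<le> y i")
    case True
    then have "S i = {}" by (auto simp: S_def)
    then show ?thesis by simp
  next
    case False
    then have "{z \<in> cube d. z i \<le> y i} \<subseteq> {z \<in> cube d. z i \<le> x i}" by auto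
    then have "measure N (S i) = x i - y i"
      unfolding S_def using le[OF i] copula_margin[OF N(1) N(2)[OF i] i] cube_nth[OF x i] cube_nth[OF y i]
      by (subst finite_measure_Diff) simp_all
    then show ?thesis by simp
  qed
  have "C x \<le> measure N ({z \<in> cube d. \<forall>i<d. z i \<le> y i} \<union> (\<Union>i\<in>{..<d}. S i))"
    unfolding C
  proof (rule finite_measure_mono[OF _ sets.Un[OF box US]], rule subsetI)
    fix z assume z: "z \<in> {z \<in> cube d. \<forall>i<d. z i \<le> x i}"
    show "z \<in> {z \<in> cube d. \<forall>i<d. z i \<le> y i} \<union> (\<Union>i\<in>{..<d}. S i)"
    proof (cases "\<forall>i<d. z i \<le> y i")
      case False
      then obtain i where "i < d" "\<not> z i \<le> y i" by blast
      then have "z \<in> S i" using z by (simp add: S_def)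
      then show ?thesis using \<open>i < d\<close> by blast
    qed (use z in simp)
  qed
  also have "\<dots> \<le> C y + measure N (\<Union>i\<in>{..<d}. S i)"
    unfolding C by (rule measure_Un_le[OF box US])
  also have "measure N (\<Union>i\<in>{..<d}. S i) \<le> (\<Sum>i<d. measure N (S i))"
    using Ss by (intro finite_measure_subadditive_finite) auto
  also have "\<dots> \<le> (\<Sum>i<d. \<bar>x i - y i\<bar>)" using mS by (intro sum_mono) simp
  finally show ?thesis by simp
qed

text \<open>Makes visible the generator that membership in \<open>archimedean_copulas\<close> only
  asserts to exist.\<close>

definition archimedean_with :: "nat \<Rightarrow> ((nat \<Rightarrow> real) \<Rightarrow> real) \<Rightarrow> (real \<Rightarrow> real) \<Rightarrow> bool" where
  "archimedean_with d C \<psi> \<longleftrightarrow> C \<in> copulas d \<and> generator \<psi> \<and>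
     (\<forall>x\<in>cube d. C x = gen_ext \<psi> (\<Sum>i<d. pseudo_inverse \<psi> (x i)))"

text \<open>Beyond the first zero of \<open>\<psi>\<close> the pseudo-inverse does not return
  \<open>a i\<close>, but there both sides are 0. Every later argument uses only this identity, with
  no pseudo-inverse left.\<close>

lemma archimedean_psi:
  assumes C: "archimedean_with d C \<psi>" and a: "\<And>i. i < d \<Longrightarrow> 0 \<le> a i"
  shows "C (\<lambda>i\<in>{..<d}. \<psi> (a i)) = \<psi> (\<Sum>i<d. a i)"
proof -
  have g: "generator \<psi>" and Cc: "C \<in> copulas d" using C by (simp_all add: archimedean_with_def)
  let ?x = "\<lambda>i\<in>{..<d}. \<psi> (a i)"
  have x: "?x \<in> cube d" using generator_range[OF g] a by (simp add: cube_iff)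
  show ?thesis
  proof (cases "\<forall>i<d. 0 < \<psi> (a i)")
    case True
    have "C ?x = gen_ext \<psi> (\<Sum>i<d. pseudo_inverse \<psi> (?x i))" using C x by (simp add: archimedean_with_def)
    also have "\<dots> = gen_ext \<psi> (\<Sum>i<d. pseudo_inverse \<psi> (\<psi> (a i)))" by simp
    also have "\<dots> = \<psi> (\<Sum>i<d. a i)" using True a by (intro gen_ext_sum_pseudo_inverse[OF g]) auto
    finally show ?thesis .
  next
    case False
    then obtain i where i: "i < d" "\<psi> (a i) = 0" using generator_range[OF g] a by (meson antisym_conv2 not_le)
    have "C ?x \<le> 0" using copula_le_coord[OF Cc x i(1)] i by simp
    then have "C ?x = 0" using copula_nonneg[OF Cc x] by simp
    have "\<psi> (\<Sum>i<d. a i) \<le> \<psi> (a i)"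
      using i a by (intro generator_antimono[OF g] member_le_sum) auto
    moreover have "0 \<le> (\<Sum>i<d. a i)" using a by (intro sum_nonneg) auto
    ultimately have "\<psi> (\<Sum>i<d. a i) = 0" using i generator_range[OF g, of "\<Sum>i<d. a i"] by linarith
    then show ?thesis using \<open>C ?x = 0\<close> by simp
  qed
qed

text \<open>Write \<open>x i = \<psi> (a i)\<close> and compare with the point
  \<open>\<psi>' (a i)\<close>. At these two points the copulas have the values of
  \<open>\<psi>\<close> and \<open>\<psi>'\<close> at the same sum, which differ by at most
  \<open>\<delta>\<close>; moving \<open>C'\<close> from one point to the other costs at most
  \<open>d\<close> times \<open>\<delta>\<close>. Inverses are never compared.\<close>

lemma d_infty_archimedean:
  assumes C: "archimedean_with d C \<psi>" and C': "archimedean_with d C' \<psi>'"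
    and \<delta>: "\<And>z. 0 \<le> z \<Longrightarrow> \<bar>\<psi> z - \<psi>' z\<bar> \<le> \<delta>"
  shows "d_infty d C C' \<le> (real d + 1) * \<delta>"
proof -
  have g: "generator \<psi>" "generator \<psi>'" and Cc: "C \<in> copulas d" "C' \<in> copulas d"
    using C C' by (simp_all add: archimedean_with_def)
  have \<delta>0: "0 \<le> \<delta>" using \<delta>[of 0] by simp
  have "\<bar>C x - C' x\<bar> \<le> (real d + 1) * \<delta>" if x: "x \<in> cube d" for x
  proof (cases "\<forall>i<d. 0 < x i")
    case True
    have "\<exists>z. 0 \<le> z \<and> \<psi> z = x i" if "i < d" for i
      using generator_surj[OF g(1), of "x i"] True cube_nth[OF x that] that by metis
    then obtain a where a: "\<And>i. i < d \<Longrightarrow> 0 \<le> a i \<and> \<psi> (a i) = x i" by metis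
    have xa: "x = (\<lambda>i\<in>{..<d}. \<psi> (a i))"
      using x a by (intro extensionalityI[of _ "{..<d}"]) (auto simp: cube_iff)
    let ?y = "\<lambda>i\<in>{..<d}. \<psi>' (a i)"
    have y: "?y \<in> cube d" using generator_range[OF g(2)] a by (simp add: cube_iff)
    have "C x = \<psi> (\<Sum>i<d. a i)" unfolding xa using archimedean_psi[OF C] a by blast
    moreover have "C' ?y = \<psi>' (\<Sum>i<d. a i)" using archimedean_psi[OF C'] a by blast
    moreover have "\<bar>\<psi> (\<Sum>i<d. a i) - \<psi>' (\<Sum>i<d. a i)\<bar> \<le> \<delta>" using a by (intro \<delta> sum_nonneg) auto
    moreover have "(\<Sum>i<d. \<bar>x i - ?y i\<bar>) \<le> (\<Sum>i<d. \<delta>)"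
    proof (rule sum_mono)
      fix i assume i: "i \<in> {..<d}"
      then show "\<bar>x i - ?y i\<bar> \<le> \<delta>" using \<delta>[of "a i"] a[of i] by simp
    qed
    moreover have "(\<Sum>i<d. \<bar>?y i - x i\<bar>) = (\<Sum>i<d. \<bar>x i - ?y i\<bar>)" by (simp add: abs_minus_commute)
    moreover have "(\<Sum>i<d. \<delta>) = real d * \<delta>" by simp
    moreover have "(real d + 1) * \<delta> = real d * \<delta> + \<delta>" by (simp add: algebra_simps)
    ultimately show ?thesis
      using copula_lipschitz[OF Cc(2) x y] copula_lipschitz[OF Cc(2) y x] by linarith
  next
    case False
    then obtain i where i: "i < d" "x i \<le> 0" by (auto simp: not_less)
    then have "C x = 0" "C' x = 0"
      using copula_le_coord[OF Cc(1) x i(1)] copula_le_coord[OF Cc(2) x i(1)]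
        copula_nonneg[OF Cc(1) x] copula_nonneg[OF Cc(2) x] by linarith+
    then show ?thesis using \<delta>0 by simp
  qed
  then show ?thesis using Cc by (auto simp: d_infty_def intro!: cSUP_least cube_nonempty)
qed

text \<open>Signed so that all differences up to order \<open>d\<close> of a generator of a copula
  turn out nonnegative.\<close>

primrec backward_difference :: "real \<Rightarrow> nat \<Rightarrow> (real \<Rightarrow> real) \<Rightarrow> real \<Rightarrow> real" where
  "backward_difference h 0 f z = f z"
| "backward_difference h (Suc j) f z = backward_difference h j f z - backward_difference h j f (z + h)"

text \<open>Induction on the set \<open>J\<close> of coordinates that carry a lower bound. Imposing
  one more lower bound removes the box in which that argument is raised by \<open>h\<close>; the sum
  of the arguments then also rises by \<open>h\<close>, which is one more difference.\<close>

lemma measure_box_backward_difference: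
  assumes C: "archimedean_with d C \<psi>" and N: "has_distribution_function d N C" and h: "0 \<le> h"
    and J: "J \<subseteq> {..<d}" and a: "\<And>i. i < d \<Longrightarrow> 0 \<le> a i"
  shows "measure N {y \<in> cube d. (\<forall>i<d. y i \<le> \<psi> (a i)) \<and> (\<forall>i\<in>J. \<psi> (a i + h) < y i)} =
    backward_difference h (card J) \<psi> (\<Sum>i<d. a i)"
proof -
  have g: "generator \<psi>" using C by (simp add: archimedean_with_def)
  have s: "sets N = sets (cube_borel d)" and "prob_space N"
    and Cx: "\<And>x. x \<in> cube d \<Longrightarrow> C x = measure N {y \<in> cube d. \<forall>i<d. y i \<le> x i}"
    using N by (simp_all add: has_distribution_function_def)
  interpret prob_space N by fact
  define B where "B J a = {y \<in> cube d. (\<forall>i<d. y i \<le> \<psi> (a i)) \<and> (\<forall>i\<in>J. \<psi> (a i + h) < y i)}" for J a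
  have Bs: "B J a \<in> sets N" if "finite J" "J \<subseteq> {..<d}" for J a
  proof -
    have "B J a = {y \<in> cube d. \<forall>i<d. y i \<le> \<psi> (a i)} - (\<Union>i\<in>J. {y \<in> cube d. y i \<le> \<psi> (a i + h)})"
      by (auto simp: B_def not_le)
    moreover have "(\<Union>i\<in>J. {y \<in> cube d. y i \<le> \<psi> (a i + h)}) \<in> sets N"
      using that by (intro sets.finite_UN sets_cube_Collect[OF s]) auto
    moreover have "{y \<in> cube d. \<forall>i<d. y i \<le> \<psi> (a i)} \<in> sets N" unfolding s by (rule sets_lower_box)
    ultimately show ?thesis by (simp only: sets.Diff)
  qed
  have fin: "finite J" using J finite_subset by blast
  have "measure N (B J a) = backward_difference h (card J) \<psi> (\<Sum>i<d. a i)"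
    using fin J a
  proof (induction J arbitrary: a rule: finite_induct)
    case empty
    let ?x = "\<lambda>i\<in>{..<d}. \<psi> (a i)"
    have x: "?x \<in> cube d" using generator_range[OF g] empty by (simp add: cube_iff)
    have "B {} a = {y \<in> cube d. \<forall>i<d. y i \<le> ?x i}" by (simp add: B_def)
    then have "measure N (B {} a) = C ?x" by (simp only: Cx[OF x])
    then show ?case using archimedean_psi[OF C] empty by simp
  next
    case (insert j J)
    let ?b = "a(j := a j + h)"
    have j: "j < d" using insert by simp
    have b0: "0 \<le> ?b i" if "i < d" for i using insert.prems(2)[OF that] insert.prems(2)[OF j] h by simp
    have eq: "B (insert j J) a = B J a - B J ?b"
    proof (intro set_eqI iffI)
      fix y assume y: "y \<in> B (insert j J) a"
      then have "\<not> y j \<le> \<psi> (?b j)" by (simp add: B_def)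
      then have "y \<notin> B J ?b" using j unfolding B_def by blast
      then show "y \<in> B J a - B J ?b" using y by (simp add: B_def)
    next
      fix y assume y: "y \<in> B J a - B J ?b"
      have "\<psi> (a j + h) < y j"
      proof (rule ccontr)
        assume *: "\<not> \<psi> (a j + h) < y j"
        have "y \<in> cube d" "\<forall>i<d. y i \<le> \<psi> (?b i)" "\<forall>i\<in>J. \<psi> (?b i + h) < y i"
          using y * insert.hyps(2) by (auto simp: B_def)
        then have "y \<in> B J ?b" by (simp add: B_def)
        then show False using y by blast
      qed
      then show "y \<in> B (insert j J) a" using y by (simp add: B_def)
    qed
    have sub: "B J ?b \<subseteq> B J a"
    proof
      fix y assume y: "y \<in> B J ?b"
      have "y i \<le> \<psi> (a i)" if i: "i < d" for i
      proof -
        have "\<psi> (?b i) \<le> \<psi> (a i)" using h insert.prems(2)[OF i] by (intro generator_antimono[OF g]) auto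
        moreover have "y i \<le> \<psi> (?b i)" using y i by (simp add: B_def del: fun_upd_apply)
        ultimately show ?thesis by linarith
      qed
      moreover have "\<psi> (a i + h) < y i" if "i \<in> J" for i
      proof -
        have "i \<noteq> j" using that insert.hyps by blast
        moreover have "\<psi> (?b i + h) < y i" using y that by (simp add: B_def del: fun_upd_apply)
        ultimately show ?thesis by simp
      qed
      ultimately show "y \<in> B J a" using y by (simp add: B_def del: fun_upd_apply)
    qed
    have sum: "(\<Sum>i<d. ?b i) = (\<Sum>i<d. a i) + h"
    proof -
      have "(\<Sum>i<d. ?b i) = (\<Sum>i<d. a i + (if i = j then h else 0))" by (intro sum.cong) auto
      also have "\<dots> = (\<Sum>i<d. a i) + h" using j by (simp add: sum.distrib)
      finally show ?thesis .
    qed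
    have "measure N (B (insert j J) a) = measure N (B J a) - measure N (B J ?b)"
      unfolding eq using insert sub by (intro finite_measure_Diff Bs) auto
    also have "measure N (B J a) = backward_difference h (card J) \<psi> (\<Sum>i<d. a i)"
      using insert.prems by (intro insert.IH) auto
    also have "measure N (B J ?b) = backward_difference h (card J) \<psi> ((\<Sum>i<d. a i) + h)"
      unfolding sum[symmetric] by (intro insert.IH b0) (use insert.prems in auto)
    finally show ?case using insert.hyps by simp
  qed
  then show ?thesis by (simp add: B_def)
qed

lemma backward_difference_nonneg:
  assumes C: "archimedean_with d C \<psi>" and h: "0 \<le> h" and z: "0 \<le> z" and d: "d \<ge> 1"
  shows "0 \<le> backward_difference h d \<psi> z"
proof -
  obtain N where N: "has_distribution_function d N C" using C by (auto simp: archimedean_with_def copulas_def)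
  \<comment> \<open>Only the sum of the arguments matters, so \<open>z\<close> is placed in a single
    coordinate.\<close>
  let ?a = "\<lambda>i::nat. if i = 0 then z else 0"
  have "(\<Sum>i<d. ?a i) = z" using d by simp
  then have "backward_difference h d \<psi> z = measure N {y \<in> cube d. (\<forall>i<d. y i \<le> \<psi> (?a i)) \<and> (\<forall>i\<in>{..<d}. \<psi> (?a i + h) < y i)}"
    using measure_box_backward_difference[OF C N h subset_refl, of ?a] z by simp
  then show ?thesis by simp
qed

section \<open>Recovering a generator by repeated summation of its differences\<close>

lemma backward_difference_tendsto:
  assumes "(f \<longlongrightarrow> 0) at_top" "0 < h"
  shows "(\<lambda>k. backward_difference h j f (real k * h)) \<longlonglongrightarrow> 0"
proof -
  have "(backward_difference h j f \<longlongrightarrow> 0) at_top"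
  proof (induction j)
    case 0
    then show ?case using assms(1) by simp
  next
    case (Suc j)
    have "((\<lambda>z. backward_difference h j f (z + h)) \<longlongrightarrow> 0) at_top"
      by (rule filterlim_compose[OF Suc]) (rule filterlim_tendsto_add_at_top[OF tendsto_const filterlim_ident, of h, simplified add.commute])
    from tendsto_diff[OF Suc this] show ?case by simp
  qed
  moreover have "filterlim (\<lambda>k. real k * h) at_top sequentially"
    using assms(2) by (intro filterlim_at_top_mult_tendsto_pos[OF tendsto_const] filterlim_real_sequentially)
  ultimately show ?thesis by (rule filterlim_compose)
qed

text \<open>Telescoping gives \<open>a k\<close> as the sum of the \<open>b (k + l)\<close>.
  Inserting the expansion of \<open>b\<close> and collecting the terms with \<open>l + m = n\<close>
  replaces the coefficients \<open>c\<close> by their partial sums.\<close>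

lemma cumulative_weights_step:
  fixes a b w c :: "nat \<Rightarrow> real"
  assumes a: "a \<longlonglongrightarrow> 0" and ab: "\<And>k. a k - a (Suc k) = b k"
    and b: "\<And>k. (\<Sum>m. ennreal (w (k + m) * c m)) = ennreal (b k)"
    and nn: "\<And>k. 0 \<le> b k" "\<And>k. 0 \<le> w k" "\<And>k. 0 \<le> c k"
  shows "(\<Sum>n. ennreal (w (k + n) * (\<Sum>m\<le>n. c m))) = ennreal (a k)"
proof -
  have "(\<lambda>l. a (k + l) - a (Suc (k + l))) sums (a (k + 0) - 0)"
    using telescope_sums'[of "\<lambda>l. a (k + l)" 0] LIMSEQ_ignore_initial_segment[OF a, of k] by (simp add: add.commute)
  then have sums: "(\<lambda>l. b (k + l)) sums a k" by (simp add: ab)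
  have "ennreal (a k) = (\<Sum>l. ennreal (b (k + l)))"
    using suminf_ennreal2[OF nn(1) sums_summable[OF sums]] sums_unique[OF sums] by simp
  also have "\<dots> = (\<Sum>l. \<Sum>m. ennreal (w (k + l + m) * c m))" by (simp only: b)
  also have "\<dots> = (\<Sum>m. \<Sum>l. ennreal (w (k + l + m) * c m))" by (rule suminf_commute_ennreal)
  also have "\<dots> = (\<Sum>m. \<Sum>n. if m \<le> n then ennreal (w (k + n) * c m) else 0)"
  proof (rule suminf_cong)
    fix m
    let ?f = "\<lambda>n. if m \<le> n then ennreal (w (k + n) * c m) else 0"
    have "(\<Sum>n. ?f n) = (\<Sum>l. ?f (l + m)) + (\<Sum>n<m. ?f n)" by (rule suminf_offset) simp
    also have "(\<Sum>n<m. ?f n) = 0" by (intro sum.neutral) auto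
    finally show "(\<Sum>l. ennreal (w (k + l + m) * c m)) = (\<Sum>n. ?f n)" by (simp add: add.assoc)
  qed
  also have "\<dots> = (\<Sum>n. \<Sum>m. if m \<le> n then ennreal (w (k + n) * c m) else 0)"
    by (rule suminf_commute_ennreal)
  also have "\<dots> = (\<Sum>n. ennreal (w (k + n) * (\<Sum>m\<le>n. c m)))"
  proof (rule suminf_cong)
    fix n
    have "(\<Sum>m. if m \<le> n then ennreal (w (k + n) * c m) else 0) =
        (\<Sum>m\<le>n. if m \<le> n then ennreal (w (k + n) * c m) else 0)"
      by (intro suminf_finite) auto
    also have "\<dots> = (\<Sum>m\<le>n. ennreal (w (k + n) * c m))" by (intro sum.cong) auto
    also have "\<dots> = ennreal (\<Sum>m\<le>n. w (k + n) * c m)" using nn by (intro sum_ennreal) auto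
    finally show "(\<Sum>m. if m \<le> n then ennreal (w (k + n) * c m) else 0) = ennreal (w (k + n) * (\<Sum>m\<le>n. c m))"
      by (simp add: sum_distrib_left)
  qed
  finally show ?thesis ..
qed

text \<open>Sum back \<open>i + 1\<close> times from the top difference; iterated partial sums of
  \<open>1, 0, 0, ...\<close> are binomial coefficients. Nonnegativity descends along the way,
  because a decreasing sequence with limit 0 is nonnegative. The order \<open>j\<close> varies in
  the induction; at \<open>j = 0\<close> the values of \<open>f\<close> on the grid are
  recovered.\<close>

lemma discrete_williamson:
  assumes f: "(f \<longlongrightarrow> 0) at_top" and h: "0 < h"
    and nn: "\<And>k. 0 \<le> backward_difference h (j + Suc i) f (real k * h)"
  shows "(\<Sum>n. ennreal (backward_difference h (j + Suc i) f (real (k + n) * h) * real ((n + i) choose i))) =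
      ennreal (backward_difference h j f (real k * h)) \<and> 0 \<le> backward_difference h j f (real k * h)"
  using nn
proof (induction i arbitrary: j k)
  case 0
  let ?w = "\<lambda>k. backward_difference h (Suc j) f (real k * h)"
  let ?a = "\<lambda>k. backward_difference h j f (real k * h)"
  have a: "?a \<longlonglongrightarrow> 0" by (rule backward_difference_tendsto[OF f h])
  have ab: "?a k - ?a (Suc k) = ?w k" for k by (simp add: algebra_simps)
  have w0: "0 \<le> ?w k" for k using 0[of k] by (simp del: backward_difference.simps)
  \<comment> \<open>The coefficient sequence \<open>1, 0, 0, ...\<close> expresses the top
    difference by itself.\<close>
  have "(\<Sum>m. ennreal (?w (k + m) * (if m = 0 then 1 else 0))) = ennreal (?w k)" for k
  proof -
    have "(\<Sum>m. ennreal (?w (k + m) * (if m = 0 then 1 else 0))) =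
      (\<Sum>m\<in>{0}. ennreal (?w (k + m) * (if m = 0 then 1 else 0)))"
      by (intro suminf_finite) auto
    then show ?thesis by (simp del: backward_difference.simps)
  qed
  from cumulative_weights_step[of ?a ?w ?w, OF a ab this w0 w0]
  have "(\<Sum>n. ennreal (?w (k + n) * (\<Sum>m\<le>n. if m = 0 then 1 else 0))) = ennreal (?a k)"
    by (simp del: backward_difference.simps)
  then have "(\<Sum>n. ennreal (?w (k + n) * 1)) = ennreal (?a k)" by (simp del: backward_difference.simps)
  moreover have "decseq ?a"
  proof (rule decseq_SucI)
    show "?a (Suc k) \<le> ?a k" for k using ab[of k] w0[of k] by linarith
  qed
  then have "0 \<le> ?a k" using a by (rule decseq_ge)
  ultimately show ?case by (simp del: backward_difference.simps)
next
  case (Suc i)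
  let ?w = "\<lambda>k. backward_difference h (j + Suc (Suc i)) f (real k * h)"
  let ?b = "\<lambda>k. backward_difference h (Suc j) f (real k * h)"
  let ?a = "\<lambda>k. backward_difference h j f (real k * h)"
  have a: "?a \<longlonglongrightarrow> 0" by (rule backward_difference_tendsto[OF f h])
  have ab: "?a k - ?a (Suc k) = ?b k" for k by (simp add: algebra_simps)
  have w0: "0 \<le> ?w k" for k by (rule Suc.prems)
  have IH: "(\<Sum>n. ennreal (?w (k + n) * real ((n + i) choose i))) = ennreal (?b k)" "0 \<le> ?b k" for k
    using Suc.IH[of "Suc j" k] Suc.prems by (simp_all del: backward_difference.simps)
  from cumulative_weights_step[of ?a ?b ?w "\<lambda>n. real ((n + i) choose i)", OF a ab IH(1) IH(2) w0, of k]
  have "(\<Sum>n. ennreal (?w (k + n) * (\<Sum>m\<le>n. real ((m + i) choose i)))) = ennreal (?a k)"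
    by (simp del: backward_difference.simps)
  \<comment> \<open>Hockey-stick identity for the partial sums of the binomial coefficients.\<close>
  moreover have "(\<Sum>m\<le>n. real ((m + i) choose i)) = real ((n + Suc i) choose Suc i)" for n
    using choose_rising_sum(1)[of i n] by (simp only: of_nat_sum[symmetric] add.commute) (simp add: add.commute)
  moreover have "decseq ?a"
  proof (rule decseq_SucI)
    show "?a (Suc k) \<le> ?a k" for k using ab[of k] IH(2)[of k] by linarith
  qed
  then have "0 \<le> ?a k" using a by (rule decseq_ge)
  ultimately show ?case by (simp del: backward_difference.simps)
qed

section \<open>Approximation by radial generators\<close>

lemma generator_uniform:
  assumes g: "generator \<psi>" and e: "0 < \<epsilon>" and c: "0 < c"
  obtains h where "0 < h" "\<And>z. 0 \<le> z \<Longrightarrow> \<psi> z - \<psi> (z + c * h) \<le> \<epsilon>"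
proof -
  have lim: "(\<psi> \<longlongrightarrow> 0) at_top" and cont: "continuous_on {0..} \<psi>"
    using g by (simp_all add: generator_def)
  have "\<forall>\<^sub>F z in at_top. \<psi> z < \<epsilon>" using lim e by (rule order_tendstoD)
  then have "\<forall>\<^sub>F z in at_top. \<psi> z < \<epsilon> \<and> 0 \<le> z"
    by (intro eventually_conj eventually_ge_at_top)
  then have "\<exists>b. \<psi> b < \<epsilon> \<and> 0 \<le> b"
    by (rule eventually_happens'[OF trivial_limit_at_top_linorder])
  then obtain L where L: "\<psi> L < \<epsilon>" "0 \<le> L" by blast
  \<comment> \<open>The extra unit keeps \<open>z + t\<close> inside for \<open>z \<le> L\<close>;
    beyond \<open>L\<close> the generator itself is below \<open>\<epsilon>\<close>.\<close>
  have "uniformly_continuous_on {0..L + 1} \<psi>"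
    by (rule compact_uniformly_continuous[OF continuous_on_subset[OF cont]]) auto
  then obtain \<delta> where \<delta>: "0 < \<delta>"
    "\<And>x y. x \<in> {0..L + 1} \<Longrightarrow> y \<in> {0..L + 1} \<Longrightarrow> dist y x < \<delta> \<Longrightarrow> dist (\<psi> y) (\<psi> x) < \<epsilon>"
    unfolding uniformly_continuous_on_def using e by blast
  define t where "t = min (\<delta> / 2) 1"
  have t: "0 < t" "t < \<delta>" "t \<le> 1" using \<delta>(1) by (auto simp: t_def)
  have "\<psi> z - \<psi> (z + t) \<le> \<epsilon>" if z: "0 \<le> z" for z
  proof (cases "z \<le> L")
    case True
    then have "dist (\<psi> (z + t)) (\<psi> z) < \<epsilon>" using z t by (intro \<delta>(2)) (auto simp: dist_real_def)
    then show ?thesis by (simp add: dist_real_def)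
  next
    case False
    then have "\<psi> z \<le> \<psi> L" using L by (intro generator_antimono[OF g]) auto
    moreover have "0 \<le> \<psi> (z + t)" using generator_range[OF g, of "z + t"] z t by simp
    ultimately show ?thesis using L by simp
  qed
  moreover have "c * (t / c) = t" using c by simp
  ultimately show ?thesis using t c by (intro that[of "t / c"]) (simp_all only: divide_pos_pos)
qed

text \<open>Together with \<open>fact_binomial_le_power\<close> this encloses the binomial weights
  between powers divided by \<open>fact s\<close>, up to a shift of \<open>s\<close> grid
  steps.\<close>

lemma power_le_fact_binomial: "(real n + 1) ^ k \<le> fact k * real ((n + k) choose k)"
proof (induction k)
  case (Suc k)
  have "(real n + 1) ^ Suc k \<le> (real n + 1) * (fact k * real ((n + k) choose k))"
    using Suc by (simp add: mult_left_mono)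
  also have "\<dots> \<le> real (Suc (n + k)) * (fact k * real ((n + k) choose k))"
    by (intro mult_right_mono) auto
  also have "\<dots> = fact k * real (Suc (n + k) * ((n + k) choose k))" by (simp only: of_nat_mult mult_ac)
  also have "Suc (n + k) * ((n + k) choose k) = Suc k * (Suc (n + k) choose Suc k)"
    by (rule Suc_times_binomial[symmetric])
  also have "fact k * real (Suc k * (Suc (n + k) choose Suc k)) = fact (Suc k) * real (Suc (n + k) choose Suc k)"
    by (simp only: fact_Suc of_nat_mult mult_ac)
  finally show ?case by (simp only: add_Suc_right)
qed simp

lemma fact_binomial_le_power: "fact k * real (n choose k) \<le> real n ^ k"
proof -
  have "real ((n choose k) * fact k) \<le> real (n ^ k)"
    using binomial_fact_pow[of n k] by (simp only: of_nat_le_iff)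
  then show ?thesis by (simp add: mult.commute)
qed

text \<open>Replacing the binomial weights by powers turns the exact formula on the grid into a
  mixture of truncated powers \<open>L\<close> with
  \<open>\<psi> ((k + s) * h) \<le> L (k * h) \<le> \<psi> (k * h)\<close>. Monotonicity of
  \<open>L\<close> and \<open>\<psi>\<close> extends this from the grid to all
  \<open>z\<close>.\<close>

lemma simplicial_approximation:
  assumes C: "archimedean_with (Suc s) C \<psi>" and s: "1 \<le> s" and e: "0 < \<epsilon>"
  obtains u \<rho> :: "nat \<Rightarrow> real" and l :: "real \<Rightarrow> real"
  where "\<And>m. 0 \<le> u m" "\<And>m. 0 < \<rho> m" "(\<Sum>m. ennreal (u m)) < \<infinity>"
    "\<And>z. 0 \<le> z \<Longrightarrow> (\<Sum>m. ennreal (u m * (max 0 (\<rho> m - z)) ^ s)) = ennreal (l z)"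
    "\<And>z. 0 \<le> z \<Longrightarrow> 0 \<le> l z \<and> \<bar>l z - \<psi> z\<bar> \<le> \<epsilon>"
proof -
  have g: "generator \<psi>" using C by (simp add: archimedean_with_def)
  \<comment> \<open>A stretch of \<open>s + 2\<close> steps covers the shift by \<open>s\<close> and
    the rounding of \<open>z\<close> to the grid.\<close>
  obtain h where h: "0 < h" and unif: "\<And>z. 0 \<le> z \<Longrightarrow> \<psi> z - \<psi> (z + (real s + 2) * h) \<le> \<epsilon>"
    using generator_uniform[OF g e, of "real s + 2"] by auto
  define w where "w m = backward_difference h (Suc s) \<psi> (real m * h)" for m
  have w0: "0 \<le> w m" for m
    unfolding w_def using h by (intro backward_difference_nonneg[OF C]) auto
  have lim: "(\<psi> \<longlongrightarrow> 0) at_top" using g by (simp add: generator_def)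
  have dw: "(\<Sum>n. ennreal (w (k + n) * real ((n + s) choose s))) = ennreal (\<psi> (real k * h))" for k
    using discrete_williamson[OF lim h, of 0 s k] w0 unfolding w_def by (simp del: backward_difference.simps(2))
  define u where "u m = w m / (fact s * h ^ s)" for m
  \<comment> \<open>With \<open>m + 1\<close> in place of \<open>m\<close> no mass sits at 0, and on
    the grid the powers \<open>(n + 1) ^ s\<close> appear, which the binomial weights
    dominate.\<close>
  define \<rho> where "\<rho> m = (real m + 1) * h" for m
  have u0: "0 \<le> u m" for m using w0 h by (simp add: u_def)
  have \<rho>0: "0 < \<rho> m" for m using h by (simp add: \<rho>_def add_nonneg_pos)
  define L where "L z = (\<Sum>m. ennreal (u m * (max 0 (\<rho> m - z)) ^ s))" for z
  have L_anti: "L y \<le> L x" if "x \<le> y" for x y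
    unfolding L_def using that u0
    by (intro suminf_le ennreal_leI mult_left_mono power_mono) auto
  define q where "q k n = w (k + n) * ((real n + 1) ^ s / fact s)" for k n
  have L_grid: "L (real k * h) = (\<Sum>n. ennreal (q k n))" for k
  proof -
    let ?f = "\<lambda>m. ennreal (u m * (max 0 (\<rho> m - real k * h)) ^ s)"
    have max: "max 0 (\<rho> m - real k * h) = h * max 0 (real m + 1 - real k)" for m
    proof -
      have "\<rho> m - real k * h = h * (real m + 1 - real k)" by (simp add: \<rho>_def algebra_simps)
      then show ?thesis using h by (simp add: max_def zero_le_mult_iff)
    qed
    have "(\<Sum>m. ?f m) = (\<Sum>n. ?f (n + k)) + (\<Sum>m<k. ?f m)" by (rule suminf_offset) simp
    also have "(\<Sum>m<k. ?f m) = 0"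
    proof (intro sum.neutral ballI)
      fix m assume "m \<in> {..<k}"
      then have "max 0 (real m + 1 - real k) = 0" by simp
      then show "?f m = 0" unfolding max using s by (simp add: power_0_left)
    qed
    also have "(\<Sum>n. ?f (n + k)) = (\<Sum>n. ennreal (q k n))"
    proof (rule suminf_cong)
      fix n
      have "max 0 (real (n + k) + 1 - real k) = real n + 1" by simp
      then show "?f (n + k) = ennreal (q k n)"
        unfolding max using h by (simp add: u_def q_def power_mult_distrib add.commute)
    qed
    finally show ?thesis by (simp add: L_def)
  qed
  have L_up: "L (real k * h) \<le> ennreal (\<psi> (real k * h))" for k
    unfolding L_grid dw[symmetric] q_def
    using power_le_fact_binomial[of _ s] w0
    by (intro suminf_le ennreal_leI mult_left_mono) (simp_all add: divide_le_eq mult.commute)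
  have L_lo: "ennreal (\<psi> (real (k + s) * h)) \<le> L (real k * h)" for k
  proof -
    have "ennreal (\<psi> (real (k + s) * h)) = (\<Sum>n. ennreal (w (k + s + n) * real ((n + s) choose s)))"
      by (rule dw[symmetric])
    also have "\<dots> \<le> (\<Sum>n. ennreal (q k (n + s)))"
    proof (intro suminf_le ennreal_leI)
      fix n
      have "fact s * real ((n + s) choose s) \<le> real (n + s) ^ s" by (rule fact_binomial_le_power)
      also have "\<dots> \<le> (real (n + s) + 1) ^ s" by (intro power_mono) auto
      finally have "real ((n + s) choose s) \<le> (real (n + s) + 1) ^ s / fact s"
        by (simp add: le_divide_eq mult.commute)
      then have "w (k + s + n) * real ((n + s) choose s) \<le> w (k + s + n) * ((real (n + s) + 1) ^ s / fact s)"
        using w0 by (intro mult_left_mono)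
      then show "w (k + s + n) * real ((n + s) choose s) \<le> q k (n + s)"
        by (simp add: q_def add_ac)
    qed auto
    also have "\<dots> \<le> (\<Sum>n. ennreal (q k (n + s))) + (\<Sum>n<s. ennreal (q k n))" by simp
    also have "\<dots> = L (real k * h)" unfolding L_grid by (rule suminf_offset[symmetric]) simp
    finally show ?thesis .
  qed
  have bounds: "ennreal (\<psi> z - \<epsilon>) \<le> L z \<and> L z \<le> ennreal (\<psi> z + \<epsilon>)" if z: "0 \<le> z" for z
  proof -
    define k where "k = nat \<lfloor>z / h\<rfloor>"
    have "0 \<le> \<lfloor>z / h\<rfloor>" using z h by simp
    then have "real k = of_int \<lfloor>z / h\<rfloor>" by (simp add: k_def)
    then have "real k \<le> z / h" "z / h < real k + 1" by linarith+
    then have k: "real k * h \<le> z" "z \<le> real (Suc k) * h" using h by (simp_all add: field_simps)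
    have kh: "0 \<le> real k * h" using h by simp
    have up: "\<psi> (real k * h) \<le> \<psi> z + \<epsilon>"
    proof -
      have "real (Suc k) * h \<le> real k * h + (real s + 2) * h" using h by (simp add: algebra_simps)
      then have "\<psi> (real k * h + (real s + 2) * h) \<le> \<psi> z" using k z by (intro generator_antimono[OF g]) auto
      then show ?thesis using unif[OF kh] by linarith
    qed
    have lo: "\<psi> z - \<epsilon> \<le> \<psi> (real (Suc k + s) * h)"
    proof -
      have "real (Suc k + s) * h \<le> z + (real s + 2) * h" using k h by (simp add: algebra_simps)
      then have "\<psi> (z + (real s + 2) * h) \<le> \<psi> (real (Suc k + s) * h)"
        using h by (intro generator_antimono[OF g]) auto
      then show ?thesis using unif[OF z] by linarith
    qed
    have "L z \<le> L (real k * h)" by (rule L_anti[OF k(1)])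
    also have "\<dots> \<le> ennreal (\<psi> (real k * h))" by (rule L_up)
    also have "\<dots> \<le> ennreal (\<psi> z + \<epsilon>)" by (rule ennreal_leI[OF up])
    finally have 1: "L z \<le> ennreal (\<psi> z + \<epsilon>)" .
    have "ennreal (\<psi> z - \<epsilon>) \<le> ennreal (\<psi> (real (Suc k + s) * h))" by (rule ennreal_leI[OF lo])
    also have "\<dots> \<le> L (real (Suc k) * h)" by (rule L_lo)
    also have "\<dots> \<le> L z" by (rule L_anti[OF k(2)])
    finally show ?thesis using 1 by blast
  qed
  define l where "l z = enn2real (L z)" for z
  have Ll: "L z = ennreal (l z)" if "0 \<le> z" for z
  proof -
    have "L z < \<infinity>"
      using le_less_trans[OF conjunct2[OF bounds[OF that]] ennreal_less_top] by simp
    then show ?thesis by (simp add: l_def)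
  qed
  show ?thesis
  proof (rule that[of u \<rho> l])
    show "(\<Sum>m. ennreal (u m * (max 0 (\<rho> m - z)) ^ s)) = ennreal (l z)" if "0 \<le> z" for z
      using Ll[OF that] by (simp add: L_def)
    show "0 \<le> l z \<and> \<bar>l z - \<psi> z\<bar> \<le> \<epsilon>" if z: "0 \<le> z" for z
    proof -
      have l0: "0 \<le> l z" by (simp add: l_def)
      have "0 \<le> \<psi> z + \<epsilon>" using generator_range[OF g z] e by simp
      then have "l z \<le> \<psi> z + \<epsilon>"
        using conjunct2[OF bounds[OF z]] unfolding Ll[OF z] by (simp only: ennreal_le_iff)
      moreover have "\<psi> z - \<epsilon> \<le> l z"
        using conjunct1[OF bounds[OF z]] l0 unfolding Ll[OF z] by (simp only: ennreal_le_iff)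
      ultimately show ?thesis using l0 by linarith
    qed
    have "(\<Sum>m. ennreal (u m)) \<le> (\<Sum>m. ennreal (1 / h ^ s) * ennreal (u m * (max 0 (\<rho> m - 0)) ^ s))"
    proof (intro suminf_le)
      fix m
      \<comment> \<open>All \<open>\<rho> m\<close> are at least \<open>h\<close>, so the total mass
        is at most \<open>L 0 / h ^ s\<close>.\<close>
      have "h ^ s \<le> (max 0 (\<rho> m - 0)) ^ s"
        using h by (intro power_mono) (auto simp: \<rho>_def le_max_iff_disj)
      then have "u m * h ^ s \<le> u m * (max 0 (\<rho> m - 0)) ^ s" using u0 by (intro mult_left_mono)
      then have "u m \<le> 1 / h ^ s * (u m * (max 0 (\<rho> m - 0)) ^ s)"
        using h by (simp add: field_simps)
      then show "ennreal (u m) \<le> ennreal (1 / h ^ s) * ennreal (u m * (max 0 (\<rho> m - 0)) ^ s)"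
        using h u0 by (simp only: ennreal_mult[symmetric] ennreal_leI divide_nonneg_nonneg
            zero_le_power less_imp_le zero_le_one mult_nonneg_nonneg max.cobounded1)
    qed auto
    also have "\<dots> = ennreal (1 / h ^ s) * L 0" by (simp add: L_def)
    also have "\<dots> < \<infinity>" using Ll[of 0] by (simp add: ennreal_mult_less_top)
    finally show "(\<Sum>m. ennreal (u m)) < \<infinity>" .
  qed (rule u0 \<rho>0)+
qed

section \<open>Completing an approximating mixture to a radial measure\<close>

lemma admissible_mixture_mono:
  assumes M: "admissible s (mixture w N)" and N: "\<And>n. sets (N n) = sets borel" and le: "\<And>n. w' n \<le> w n"
  shows "admissible s (mixture w' N)"
proof -
  have em: "emeasure (mixture w' N) B \<le> emeasure (mixture w N) B" if "B \<in> sets borel" for B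
    unfolding emeasure_mixture[OF N that] by (intro suminf_le mult_right_mono le) auto
  have "(\<lambda>r::real. ennreal (r ^ s)) \<in> borel_measurable borel" by simp
  then have "(\<integral>\<^sup>+r. ennreal (r ^ s) \<partial>mixture w' N) \<le> (\<integral>\<^sup>+r. ennreal (r ^ s) \<partial>mixture w N)"
    by (subst (1 2) nn_integral_mixture[OF N]) (auto intro!: suminf_le mult_right_mono le)
  then show ?thesis
    using M em[of UNIV] em[of "{..0}"] by (auto simp: admissible_def intro: le_less_trans)
qed

lemma moment_eq:
  assumes "admissible s M"
  shows "(\<integral>\<^sup>+r. ennreal ((max 0 (r - 0)) ^ s) \<partial>M) = (\<integral>\<^sup>+r. ennreal (r ^ s) \<partial>M)"
proof (rule nn_integral_cong_AE)
  have "{..0} \<in> null_sets M"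
    by (rule null_setsI) (use assms in \<open>simp_all add: admissible_def\<close>)
  then have "AE r in M. r \<notin> {..0}" by (rule AE_not_in)
  then show "AE r in M. ennreal ((max 0 (r - 0)) ^ s) = ennreal (r ^ s)"
    by eventually_elim simp
qed

lemma moment_pos:
  assumes M: "admissible s M" and ch: "charges_intervals M"
  shows "0 < (\<integral>\<^sup>+r. ennreal ((max 0 (r - 0)) ^ s) \<partial>M)"
proof -
  have "0 < emeasure M {1<..<2}" using ch by (simp add: charges_intervals_def)
  also have "\<dots> = (\<integral>\<^sup>+r. indicator {1<..<2} r \<partial>M)" using M by (simp add: admissible_def)
  also have "\<dots> \<le> (\<integral>\<^sup>+r. ennreal ((max 0 (r - 0)) ^ s) \<partial>M)"
  proof (rule nn_integral_mono)
    fix r :: real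
    show "indicator {1<..<2} r \<le> ennreal ((max 0 (r - 0)) ^ s)"
    proof (cases "r \<in> {1<..<2}")
      case True
      then have "ennreal 1 \<le> ennreal ((max 0 (r - 0)) ^ s)" by (intro ennreal_leI one_le_power) auto
      then show ?thesis using True by simp
    qed simp
  qed
  finally show ?thesis .
qed

text \<open>The approximating mixture, scaled by \<open>1 - \<epsilon>\<close>, is completed by a
  common multiple of three charging measures so that the moment becomes 1. Of the bound
  \<open>3 * \<epsilon>\<close>, one \<open>\<epsilon>\<close> is due to the approximation; the rest
  covers the scaling in one direction and the addition in the other.\<close>

lemma radial_approximation:
  assumes C: "archimedean_with (Suc s) C \<psi>" and s: "1 \<le> s" and e: "0 < \<epsilon>" "\<epsilon> < 1"
  obtains E A D S where "radial s E A D S"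
    "\<And>z. 0 \<le> z \<Longrightarrow> \<bar>\<psi> z - radial.psi s E z\<bar> \<le> 3 * \<epsilon>"
proof -
  have g: "generator \<psi>" using C by (simp add: archimedean_with_def)
  then have \<psi>0: "\<psi> 0 = 1" by (simp add: generator_def)
  obtain u \<rho> :: "nat \<Rightarrow> real" and l :: "real \<Rightarrow> real" where u: "\<And>m. 0 \<le> u m" "\<And>m. 0 < \<rho> m" "(\<Sum>m. ennreal (u m)) < \<infinity>"
    and L: "\<And>z. 0 \<le> z \<Longrightarrow> (\<Sum>m. ennreal (u m * (max 0 (\<rho> m - z)) ^ s)) = ennreal (l z)"
    and l: "\<And>z. 0 \<le> z \<Longrightarrow> 0 \<le> l z \<and> \<bar>l z - \<psi> z\<bar> \<le> \<epsilon>"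
    using simplicial_approximation[OF C s e(1)] by blast
  obtain Na where Na: "admissible s Na" "charges_intervals Na" "absolutely_continuous lborel Na"
    using ex_charging_absolutely_continuous by blast
  obtain Nd B0 where Nd: "admissible s Nd" "charges_intervals Nd" and B0: "countable B0" "emeasure Nd (- B0) = 0"
    using ex_charging_discrete by blast
  obtain Ns Z0 where Ns: "admissible s Ns" "charges_intervals Ns" "\<And>x. emeasure Ns {x} = 0"
    and Z0: "Z0 \<in> null_sets lborel" "emeasure Ns (- Z0) = 0"
    using ex_charging_singular by blast
  define V where "V z = (\<integral>\<^sup>+r. ennreal ((max 0 (r - z)) ^ s) \<partial>Na) + (\<integral>\<^sup>+r. ennreal ((max 0 (r - z)) ^ s) \<partial>Nd)
    + (\<integral>\<^sup>+r. ennreal ((max 0 (r - z)) ^ s) \<partial>Ns)" for z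
  have V_anti: "V z \<le> V 0" if "0 \<le> z" for z
    unfolding V_def using that by (intro add_mono nn_integral_mono ennreal_leI power_mono) auto
  have "V 0 < \<infinity>"
    unfolding V_def moment_eq[OF Na(1)] moment_eq[OF Nd(1)] moment_eq[OF Ns(1)]
    using Na(1) Nd(1) Ns(1) by (simp add: admissible_def)
  moreover have "0 < V 0" unfolding V_def using moment_pos[OF Na(1,2)] by (simp add: add_pos_nonneg)
  ultimately obtain v where v: "V 0 = ennreal v" "0 < v"
    by (cases "V 0") auto
  have l0: "0 \<le> l 0" "l 0 \<le> 1 + \<epsilon>" "1 - \<epsilon> \<le> l 0" using l[of 0] \<psi>0 by auto
  \<comment> \<open>The moment still missing. Since only \<open>l 0 \<le> 1 + \<epsilon>\<close> is
    known, scaling by \<open>1 - \<epsilon>\<close> is what makes \<open>t\<close> positive, through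
    \<open>(1 - \<epsilon>) * (1 + \<epsilon>) < 1\<close>.\<close>
  define t where "t = 1 - (1 - \<epsilon>) * l 0"
  have "(1 - \<epsilon>) * l 0 \<le> (1 - \<epsilon>) * (1 + \<epsilon>)" using l0 e by (intro mult_left_mono) auto
  also have "\<dots> < 1" using e by (simp add: algebra_simps)
  finally have t0: "0 < t" by (simp add: t_def)
  have "(1 - \<epsilon>) * (1 - \<epsilon>) \<le> (1 - \<epsilon>) * l 0" using l0 e by (intro mult_left_mono) auto
  moreover have "1 - 2 * \<epsilon> \<le> (1 - \<epsilon>) * (1 - \<epsilon>)" by (simp add: algebra_simps)
  ultimately have t2: "t \<le> 2 * \<epsilon>" by (simp add: t_def)
  define c where "c = t / v"
  have c: "0 < c" "c * v = t" using t0 v by (simp_all add: c_def)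
  \<comment> \<open>The first three places hold the charging measures, the others the point masses
    of the approximation.\<close>
  define N where "N n = (if n = 0 then Na else if n = 1 then Nd else if n = 2 then Ns else return borel (\<rho> (n - 3)))" for n :: nat
  define w where "w n = (if n < 3 then ennreal c else ennreal ((1 - \<epsilon>) * u (n - 3)))" for n :: nat
  have N: "sets (N n) = sets borel" for n
    using Na(1) Nd(1) Ns(1) by (simp add: N_def admissible_def)
  have int: "(\<integral>\<^sup>+r. f r \<partial>mixture w N) = (\<Sum>n. ennreal ((1 - \<epsilon>) * u n) * f (\<rho> n)) +
      ennreal c * ((\<integral>\<^sup>+r. f r \<partial>Na) + (\<integral>\<^sup>+r. f r \<partial>Nd) + (\<integral>\<^sup>+r. f r \<partial>Ns))"
    if f: "f \<in> borel_measurable borel" for f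
  proof -
    let ?g = "\<lambda>n. w n * (\<integral>\<^sup>+r. f r \<partial>N n)"
    have "(\<integral>\<^sup>+r. f r \<partial>mixture w N) = (\<Sum>n. ?g n)" by (rule nn_integral_mixture[OF N f])
    also have "\<dots> = (\<Sum>n. ?g (n + 3)) + (\<Sum>n<3. ?g n)" by (rule suminf_offset) simp
    also have "(\<Sum>n. ?g (n + 3)) = (\<Sum>n. ennreal ((1 - \<epsilon>) * u n) * f (\<rho> n))"
      using f by (intro suminf_cong) (simp add: w_def N_def nn_integral_return)
    also have "(\<Sum>n<3. ?g n) = ennreal c * ((\<integral>\<^sup>+r. f r \<partial>Na) + (\<integral>\<^sup>+r. f r \<partial>Nd) + (\<integral>\<^sup>+r. f r \<partial>Ns))"
      by (simp add: eval_nat_numeral w_def N_def distrib_left)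
    finally show ?thesis .
  qed
  have int_z: "(\<integral>\<^sup>+r. ennreal ((max 0 (r - z)) ^ s) \<partial>mixture w N) = ennreal ((1 - \<epsilon>) * l z) + ennreal c * V z"
    if "0 \<le> z" for z
  proof -
    have "(\<Sum>n. ennreal ((1 - \<epsilon>) * u n) * ennreal ((max 0 (\<rho> n - z)) ^ s)) =
        (\<Sum>n. ennreal (1 - \<epsilon>) * ennreal (u n * (max 0 (\<rho> n - z)) ^ s))"
      using e u(1) by (intro suminf_cong) (simp add: ennreal_mult mult.assoc)
    also have "\<dots> = ennreal (1 - \<epsilon>) * ennreal (l z)" by (simp add: L[OF that])
    also have "\<dots> = ennreal ((1 - \<epsilon>) * l z)" using e l[OF that] by (simp add: ennreal_mult)
    moreover have "(\<lambda>r. ennreal ((max 0 (r - z)) ^ s)) \<in> borel_measurable borel" by simp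
    ultimately show ?thesis by (subst int) (simp_all add: V_def)
  qed
  define E where "E = mixture w N"
  have pos_zero: "emeasure (N n) {..0} = 0" for n
    using Na(1) Nd(1) Ns(1) u(2)[of "n - 3"] by (simp add: N_def admissible_def)
  have E0: "emeasure E {..0} = 0" unfolding E_def using pos_zero by (intro emeasure_mixture_zero[OF N]) auto
  have E_int0: "(\<integral>\<^sup>+r. ennreal ((max 0 (r - 0)) ^ s) \<partial>E) = 1"
  proof -
    have "(\<integral>\<^sup>+r. ennreal ((max 0 (r - 0)) ^ s) \<partial>E) = ennreal ((1 - \<epsilon>) * l 0) + ennreal c * ennreal v"
      unfolding E_def using int_z[of 0] v by simp
    also have "ennreal c * ennreal v = ennreal (c * v)" using c v by (intro ennreal_mult[symmetric]) auto
    also have "ennreal ((1 - \<epsilon>) * l 0) + ennreal (c * v) = ennreal ((1 - \<epsilon>) * l 0 + c * v)"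
      using e l0 c v by (intro ennreal_plus[symmetric]) auto
    also have "(1 - \<epsilon>) * l 0 + c * v = 1" by (simp add: c t_def)
    finally show ?thesis by simp
  qed
  have "{..0} \<in> null_sets E" by (rule null_setsI[OF E0]) (simp add: E_def)
  then have "AE r in E. r \<notin> {..0}" by (rule AE_not_in)
  then have "AE r in E. ennreal ((max 0 (r - 0)) ^ s) = ennreal (r ^ s)"
    by eventually_elim simp
  then have "(\<integral>\<^sup>+r. ennreal ((max 0 (r - 0)) ^ s) \<partial>E) = (\<integral>\<^sup>+r. ennreal (r ^ s) \<partial>E)"
    by (rule nn_integral_cong_AE)
  then have E_mom: "(\<integral>\<^sup>+r. ennreal (r ^ s) \<partial>E) = 1" using E_int0 by simp
  have "emeasure E UNIV < \<infinity>"
  proof -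
    have "emeasure E UNIV = (\<integral>\<^sup>+r. 1 \<partial>E)" by (simp add: E_def)
    also have "\<dots> = (\<Sum>n. ennreal (1 - \<epsilon>) * ennreal (u n)) + ennreal c *
        (emeasure Na (space Na) + emeasure Nd (space Nd) + emeasure Ns (space Ns))"
      unfolding E_def using e u(1) by (subst int) (simp_all add: ennreal_mult)
    also have "\<dots> < \<infinity>"
      using u(3) Na(1) Nd(1) Ns(1) by (auto simp: admissible_def ennreal_mult_less_top dest: sets_eq_imp_space_eq)
    finally show ?thesis .
  qed
  then have E_adm: "admissible s E" using E0 E_mom by (simp add: admissible_def E_def)
  define wa where "wa n = (if n = 0 then w n else 0)" for n :: nat
  \<comment> \<open>The point masses of the approximation join the discrete part.\<close>
  define wd where "wd n = (if n = 0 \<or> n = 2 then 0 else w n)" for n :: nat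
  define ws where "ws n = (if n = 2 then w n else 0)" for n :: nat
  have le: "wa n \<le> w n" "wd n \<le> w n" "ws n \<le> w n" for n by (simp_all add: wa_def wd_def ws_def)
  have w_small: "0 < w 0" "0 < w 1" "0 < w 2" using c by (simp_all add: w_def)
  have ch: "charges_intervals (mixture w' N)" if n: "0 < w' n" "charges_intervals (N n)" for w' n
    unfolding charges_intervals_def
  proof (intro allI impI)
    fix a b :: real assume "0 \<le> a" "a < b"
    then have "0 < emeasure (N n) {a<..<b}" using n(2) by (simp add: charges_intervals_def)
    then show "0 < emeasure (mixture w' N) {a<..<b}"
      by (intro emeasure_mixture_pos[where n = n] N n(1)) simp_all
  qed
  have rad: "radial s E (mixture wa N) (mixture wd N) (mixture ws N)"
  proof
    show "1 \<le> s" "admissible s E" by fact+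
    show "admissible s (mixture wa N)" "admissible s (mixture wd N)" "admissible s (mixture ws N)"
      by (rule admissible_mixture_mono[OF E_adm[unfolded E_def] N le(1)] admissible_mixture_mono[OF E_adm[unfolded E_def] N le(2)]
          admissible_mixture_mono[OF E_adm[unfolded E_def] N le(3)])+
    show "emeasure E B = emeasure (mixture wa N) B + emeasure (mixture wd N) B + emeasure (mixture ws N) B"
      if B: "B \<in> sets borel" for B
    proof -
      have "emeasure E B = (\<Sum>n. wa n * emeasure (N n) B + wd n * emeasure (N n) B + ws n * emeasure (N n) B)"
        unfolding E_def emeasure_mixture[OF N B] by (intro suminf_cong) (simp add: wa_def wd_def ws_def)
      then show ?thesis unfolding emeasure_mixture[OF N B] by (simp add: suminf_add)
    qed
    show "(\<integral>\<^sup>+r. ennreal (r ^ s) \<partial>E) = 1" by (rule E_mom)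
    show "charges_intervals (mixture wa N)"
      by (rule ch[of _ 0]) (use Na w_small in \<open>simp_all add: wa_def N_def\<close>)
    show "charges_intervals (mixture wd N)"
      by (rule ch[of _ 1]) (use Nd w_small in \<open>simp_all add: wd_def N_def\<close>)
    show "charges_intervals (mixture ws N)"
      by (rule ch[of _ 2]) (use Ns w_small in \<open>simp_all add: ws_def N_def\<close>)
    show "absolutely_continuous lborel (mixture wa N)"
      unfolding absolutely_continuous_def
    proof
      fix B assume B: "B \<in> null_sets (lborel :: real measure)"
      then have "emeasure Na B = 0" using Na(3) by (auto simp: absolutely_continuous_def)
      then have "emeasure (mixture wa N) B = 0"
        using B by (intro emeasure_mixture_zero[OF N]) (auto simp: wa_def N_def)
      then show "B \<in> null_sets (mixture wa N)" using B by (intro null_setsI) auto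
    qed
    show "\<exists>B. countable B \<and> emeasure (mixture wd N) (- B) = 0"
    proof (intro exI conjI)
      show cB: "countable (B0 \<union> range \<rho>)" using B0 by simp
      have "B0 \<union> range \<rho> \<in> sets borel" by (rule sets.countable[OF _ cB]) simp
      then have Bb: "- (B0 \<union> range \<rho>) \<in> sets borel" by (rule borel_comp)
      have B0b: "- B0 \<in> sets Nd"
        using borel_comp[OF sets.countable[OF _ B0(1)]] Nd(1) by (simp add: admissible_def)
      have "emeasure Nd (- (B0 \<union> range \<rho>)) \<le> emeasure Nd (- B0)" by (intro emeasure_mono B0b) auto
      then have "emeasure Nd (- (B0 \<union> range \<rho>)) = 0" using B0 by simp
      then show "emeasure (mixture wd N) (- (B0 \<union> range \<rho>)) = 0"
        using Bb by (intro emeasure_mixture_zero[OF N]) (auto simp: wd_def N_def)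
    qed
    show "emeasure (mixture ws N) {x} = 0" for x
      using Ns(3) by (intro emeasure_mixture_zero[OF N]) (auto simp: ws_def N_def)
    show "\<exists>Z\<in>null_sets lborel. emeasure (mixture ws N) (- Z) = 0"
    proof
      show "Z0 \<in> null_sets lborel" by fact
      then have "- Z0 \<in> sets borel" by (intro borel_comp) auto
      then show "emeasure (mixture ws N) (- Z0) = 0"
        using Z0(2) by (intro emeasure_mixture_zero[OF N]) (auto simp: ws_def N_def)
    qed
  qed
  interpret radial s E "mixture wa N" "mixture wd N" "mixture ws N" by (rule rad)
  have "\<bar>\<psi> z - psi z\<bar> \<le> 3 * \<epsilon>" if z: "0 \<le> z" for z
  proof -
    have eq: "ennreal (psi z) = ennreal ((1 - \<epsilon>) * l z) + ennreal c * V z"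
      unfolding ennreal_psi[OF z] using int_z[OF z] by (simp add: E_def)
    have lz: "0 \<le> l z" "\<bar>l z - \<psi> z\<bar> \<le> \<epsilon>" using l[OF z] by auto
    have \<psi>z: "0 \<le> \<psi> z" "\<psi> z \<le> 1" using generator_range[OF g z] by auto
    have "ennreal c * V z \<le> ennreal c * V 0" using V_anti[OF z] by (intro mult_left_mono) auto
    also have "\<dots> = ennreal t" using c v by (simp add: ennreal_mult[symmetric])
    finally have "ennreal (psi z) \<le> ennreal ((1 - \<epsilon>) * l z) + ennreal t" unfolding eq by (intro add_left_mono)
    also have "\<dots> = ennreal ((1 - \<epsilon>) * l z + t)" using e lz t0 by simp
    finally have up: "psi z \<le> (1 - \<epsilon>) * l z + t"
      using e lz t0 by (subst (asm) ennreal_le_iff) auto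
    have "ennreal ((1 - \<epsilon>) * l z) \<le> ennreal (psi z)" unfolding eq by simp
    then have lo: "(1 - \<epsilon>) * l z \<le> psi z" using psi_nonneg by (simp add: ennreal_le_iff)
    \<comment> \<open>From \<open>l z \<le> 1 + \<epsilon> \<le> 2\<close>: the scaling costs at
      most \<open>2 * \<epsilon>\<close>, the same bound as for \<open>t\<close>.\<close>
    have "\<epsilon> * l z \<le> \<epsilon> * 2" using e lz \<psi>z by (intro mult_left_mono) auto
    moreover have "0 \<le> \<epsilon> * l z" using e lz by simp
    moreover have "(1 - \<epsilon>) * l z = l z - \<epsilon> * l z" by (simp add: algebra_simps)
    ultimately show ?thesis using up lo t2 lz(2) by linarith
  qed
  with rad show ?thesis by (rule that)
qed

theorem corollary3p16:
  fixes d :: nat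
  assumes "d \<ge> 2"
  shows "Metric_space.mtopology (archimedean_copulas d) (d_infty d) closure_of
           {C \<in> archimedean_copulas d.
              support_in (cube_topology d) (mu_abs d C) = cube d \<and>
              support_in (cube_topology d) (mu_dis d C) = cube d \<and>
              support_in (cube_topology d) (mu_sing d C) = cube d}
         = archimedean_copulas d"
proof -
  interpret Metric_space "archimedean_copulas d" "d_infty d" by (rule Metric_space_archimedean_copulas)
  obtain s where d: "d = Suc s" and s: "1 \<le> s" using assms by (cases d) auto
  let ?F = "{C \<in> archimedean_copulas d.
              support_in (cube_topology d) (mu_abs d C) = cube d \<and>
              support_in (cube_topology d) (mu_dis d C) = cube d \<and>
              support_in (cube_topology d) (mu_sing d C) = cube d}"
  have "\<exists>C'\<in>?F. C' \<in> mball C r" if C: "C \<in> archimedean_copulas d" and r: "0 < r" for C r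
  proof -
    obtain \<psi> where \<psi>: "archimedean_with d C \<psi>"
      using C by (auto simp: archimedean_copulas_def archimedean_with_def)
    \<comment> \<open>The copulas will differ by at most \<open>d + 1\<close> times
      \<open>3 * \<epsilon>\<close>; dividing by 4 makes this strictly less than \<open>r\<close>,
      and the bound \<open>1/2\<close> secures \<open>\<epsilon> < 1\<close>.\<close>
    define \<epsilon> where "\<epsilon> = min (1/2) (r / (4 * (real d + 1)))"
    have e: "0 < \<epsilon>" "\<epsilon> < 1" using r by (auto simp: \<epsilon>_def)
    have "\<epsilon> \<le> r / (4 * (real d + 1))" by (simp add: \<epsilon>_def)
    then have er: "(real d + 1) * (4 * \<epsilon>) \<le> r" by (simp add: field_simps)
    obtain E A D S where rad: "radial s E A D S" and app: "\<And>z. 0 \<le> z \<Longrightarrow> \<bar>\<psi> z - radial.psi s E z\<bar> \<le> 3 * \<epsilon>"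
      using radial_approximation[OF \<psi>[unfolded d] s e] by blast
    interpret R: radial s E A D S by (rule rad)
    have cop: "archimedean_with d R.cop R.psi"
      unfolding archimedean_with_def d
      using R.cop_copula R.generator_psi R.cop_gen_ext by blast
    have "d_infty d C R.cop \<le> (real d + 1) * (3 * \<epsilon>)" by (rule d_infty_archimedean[OF \<psi> cop app])
    also have "\<dots> < (real d + 1) * (4 * \<epsilon>)" using e by (intro mult_strict_left_mono) auto
    finally have "d_infty d C R.cop < r" using er by linarith
    moreover have "R.cop \<in> archimedean_copulas d" unfolding d by (rule R.cop_archimedean)
    ultimately have "R.cop \<in> mball C r" unfolding in_mball using C by blast
    moreover have "R.cop \<in> ?F"
      unfolding d using R.cop_archimedean
      by (simp add: R.mu_parts_cop R.support_Q R.A_adm R.D_adm R.S_adm R.A_charges R.D_charges R.S_charges)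
    ultimately show ?thesis by blast
  qed
  then show ?thesis unfolding metric_closure_of by blast
qed

end
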